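(* Let $H$ and $H'$ be two graded, connected Hopf algebras over $K$, both free and cofree, with $\mathfrak g=\mathrm{Prim}(H)$ and $\mathfrak g'=\mathrm{Prim}(H')$. The following are equivalent: (1) $H$ and $H'$ are isomorphic graded Hopf algebras; (2) $\frac{\mathfrak{g}}{\mathfrak{g}\cap H^{+2}}$ and $\frac{\mathfrak{g}'}{\mathfrak{g}'\cap H'^{+2}}$ are isomorphic graded vector spaces; (3) $H$ and $H'$ have the same Poincaré–Hilbert series $\sum_n \dim(H_n)h^n=\sum_n\dim(H'_n)h^n$.
   Context: $K$ is a commutative field of characteristic $\neq 2$. A graded connected Hopf algebra is a Hopf algebra $H=\bigoplus_{n\ge0}H_n$ over $K$ with homogeneous structure maps, $H_0=K$ and every $H_n$ finite-dimensional. $H^+=\bigoplus_{n\ge1}H_n$, $H^{+2}$ is the span of products of two elements of $H^+$, and $\mathrm{Prim}(H)$ is the graded space of primitive elements. $H$ is free if there is a graded subspace $V$ with $T(V)\to H$ an algebra isomorphism; $H$ is cofree if it is isomorphic, as a graded coalgebra, to the tensor coalgebra $coT(W)$ ($T(W)$ with deconcatenation coproduct) for some graded $W$ with $W_0=0$. *)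

theory Defs
  imports Main "HOL-Library.Function_Algebras" "HOL-Computational_Algebra.Formal_Power_Series"
begin

text \<open>
  Representation: a graded connected Hopf algebra H over the field 'k with finite-dimensional
  homogeneous components is presented by a homogeneous basis indexed by the type 'b.
  Vectors of H are finitely supported functions 'b => 'k (coordinates w.r.t. the basis);
  H (x) H is represented by finitely supported functions on 'b \<times> 'b, and so on.
  The grading is given by a degree function on the basis: H_n = span of basis vectors of degree n.
  The structure maps (product, unit, coproduct, counit) are given by their values on basis
  vectors (structure constants) and extended linearly.
\<close>

definition supp :: "('b \<Rightarrow> 'k::zero) \<Rightarrow> 'b set" where
  "supp v = {x. v x \<noteq> 0}"

definition fsupp :: "('b \<Rightarrow> 'k::zero) \<Rightarrow> bool" where
  "fsupp v \<longleftrightarrow> finite (supp v)"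

definition scaleF :: "'k::times \<Rightarrow> ('b \<Rightarrow> 'k) \<Rightarrow> ('b \<Rightarrow> 'k)" where
  "scaleF c v = (\<lambda>x. c * v x)"

definition bas :: "'b \<Rightarrow> 'b \<Rightarrow> 'k::{zero,one}" where
  "bas b = (\<lambda>x. if x = b then 1 else 0)"

definition lin :: "('b \<Rightarrow> 'c \<Rightarrow> 'k::comm_semiring_1) \<Rightarrow> ('b \<Rightarrow> 'k) \<Rightarrow> ('c \<Rightarrow> 'k)" where
  "lin F v = (\<Sum>b\<in>supp v. scaleF (v b) (F b))"

definition lfun :: "('b \<Rightarrow> 'k::comm_semiring_1) \<Rightarrow> ('b \<Rightarrow> 'k) \<Rightarrow> 'k" where
  "lfun \<phi> v = (\<Sum>b\<in>supp v. v b * \<phi> b)"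

definition tens :: "('a \<Rightarrow> 'k::times) \<Rightarrow> ('b \<Rightarrow> 'k) \<Rightarrow> ('a \<times> 'b \<Rightarrow> 'k)" where
  "tens u v = (\<lambda>(x, y). u x * v y)"

definition tmap :: "('a \<Rightarrow> 'c \<Rightarrow> 'k::times) \<Rightarrow> ('b \<Rightarrow> 'd \<Rightarrow> 'k) \<Rightarrow> ('a \<times> 'b \<Rightarrow> 'c \<times> 'd \<Rightarrow> 'k)" where
  "tmap F G = (\<lambda>(a, b). tens (F a) (G b))"

record ('b, 'k) hopf_data =
  deg :: "'b \<Rightarrow> nat"
  mu :: "'b \<Rightarrow> 'b \<Rightarrow> 'b \<Rightarrow> 'k"
  one_vec :: "'b \<Rightarrow> 'k"
  delta :: "'b \<Rightarrow> 'b \<times> 'b \<Rightarrow> 'k"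
  counit :: "'b \<Rightarrow> 'k"

definition hmul :: "('b, 'k::field) hopf_data \<Rightarrow> ('b \<Rightarrow> 'k) \<Rightarrow> ('b \<Rightarrow> 'k) \<Rightarrow> ('b \<Rightarrow> 'k)" where
  "hmul H u v = lin (\<lambda>(a, b). mu H a b) (tens u v)"

definition hDelta :: "('b, 'k::field) hopf_data \<Rightarrow> ('b \<Rightarrow> 'k) \<Rightarrow> ('b \<times> 'b \<Rightarrow> 'k)" where
  "hDelta H v = lin (delta H) v"

definition hcounit :: "('b, 'k::field) hopf_data \<Rightarrow> ('b \<Rightarrow> 'k) \<Rightarrow> 'k" where
  "hcounit H v = lfun (counit H) v"

definition tmul :: "('b, 'k::field) hopf_data \<Rightarrow> ('b \<times> 'b \<Rightarrow> 'k) \<Rightarrow> ('b \<times> 'b \<Rightarrow> 'k) \<Rightarrow> ('b \<times> 'b \<Rightarrow> 'k)" where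
  "tmul H s t = lin (\<lambda>((x, y), (x', y')). tens (mu H x x') (mu H y y')) (tens s t)"

definition graded_connected_hopf :: "('b, 'k::field) hopf_data \<Rightarrow> bool" where
  "graded_connected_hopf H \<longleftrightarrow>
     \<comment> \<open>each H_n finite-dimensional, H_0 = K\<close>
     (\<forall>n. finite {b. deg H b = n}) \<and> card {b. deg H b = 0} = 1 \<and>
     \<comment> \<open>structure maps well defined\<close>
     (\<forall>a b. fsupp (mu H a b)) \<and> fsupp (one_vec H) \<and> (\<forall>a. fsupp (delta H a)) \<and>
     \<comment> \<open>structure maps homogeneous\<close>
     (\<forall>a b c. mu H a b c \<noteq> 0 \<longrightarrow> deg H c = deg H a + deg H b) \<and>
     (\<forall>c. one_vec H c \<noteq> 0 \<longrightarrow> deg H c = 0) \<and>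
     (\<forall>a x y. delta H a (x, y) \<noteq> 0 \<longrightarrow> deg H x + deg H y = deg H a) \<and>
     (\<forall>a. counit H a \<noteq> 0 \<longrightarrow> deg H a = 0) \<and>
     \<comment> \<open>associative unital algebra\<close>
     (\<forall>a b c. hmul H (hmul H (bas a) (bas b)) (bas c) = hmul H (bas a) (hmul H (bas b) (bas c))) \<and>
     (\<forall>a. hmul H (one_vec H) (bas a) = bas a \<and> hmul H (bas a) (one_vec H) = bas a) \<and>
     \<comment> \<open>coassociative counital coalgebra\<close>
     (\<forall>a x y z. lin (tmap (delta H) bas) (delta H a) ((x, y), z)
                = lin (tmap bas (delta H)) (delta H a) (x, (y, z))) \<and>
     (\<forall>a. lin (\<lambda>(x, y). scaleF (counit H x) (bas y)) (delta H a) = bas a \<and>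
          lin (\<lambda>(x, y). scaleF (counit H y) (bas x)) (delta H a) = bas a) \<and>
     \<comment> \<open>coproduct and counit are algebra morphisms\<close>
     (\<forall>a b. hDelta H (hmul H (bas a) (bas b)) = tmul H (delta H a) (delta H b)) \<and>
     hDelta H (one_vec H) = tens (one_vec H) (one_vec H) \<and>
     (\<forall>a b. hcounit H (hmul H (bas a) (bas b)) = counit H a * counit H b) \<and>
     hcounit H (one_vec H) = 1 \<and>
     \<comment> \<open>existence of an antipode S (given on basis vectors)\<close>
     (\<exists>S :: 'b \<Rightarrow> 'b \<Rightarrow> 'k. (\<forall>a. fsupp (S a)) \<and>
        (\<forall>a. lin (\<lambda>(x, y). hmul H (S x) (bas y)) (delta H a) = scaleF (counit H a) (one_vec H) \<and>
             lin (\<lambda>(x, y). hmul H (bas x) (S y)) (delta H a) = scaleF (counit H a) (one_vec H)))"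

definition hom :: "('b, 'k::field) hopf_data \<Rightarrow> nat \<Rightarrow> ('b \<Rightarrow> 'k) set" where
  "hom H n = {v. fsupp v \<and> (\<forall>b. v b \<noteq> 0 \<longrightarrow> deg H b = n)}"

definition Hplus :: "('b, 'k::field) hopf_data \<Rightarrow> ('b \<Rightarrow> 'k) set" where
  "Hplus H = {v. fsupp v \<and> (\<forall>b. v b \<noteq> 0 \<longrightarrow> deg H b \<ge> 1)}"

definition Hplus2 :: "('b, 'k::field) hopf_data \<Rightarrow> ('b \<Rightarrow> 'k) set" where
  "Hplus2 H = {(\<Sum>i<n. hmul H (u i) (w i)) | (n::nat) u w. \<forall>i<n. u i \<in> Hplus H \<and> w i \<in> Hplus H}"

definition Prim :: "('b, 'k::field) hopf_data \<Rightarrow> ('b \<Rightarrow> 'k) set" where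
  "Prim H = {x. fsupp x \<and> hDelta H x = tens x (one_vec H) + tens (one_vec H) x}"

definition lin_indep_fam :: "('i \<Rightarrow> ('b \<Rightarrow> 'k::field)) \<Rightarrow> 'i set \<Rightarrow> bool" where
  "lin_indep_fam e I \<longleftrightarrow>
     (\<forall>F c. finite F \<and> F \<subseteq> I \<and> (\<Sum>i\<in>F. scaleF (c i) (e i)) = 0 \<longrightarrow> (\<forall>i\<in>F. c i = 0))"

definition spans_H :: "('i \<Rightarrow> ('b \<Rightarrow> 'k::field)) \<Rightarrow> 'i set \<Rightarrow> bool" where
  "spans_H e I \<longleftrightarrow>
     (\<forall>v. fsupp v \<longrightarrow> (\<exists>F c. finite F \<and> F \<subseteq> I \<and> v = (\<Sum>i\<in>F. scaleF (c i) (e i))))"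

definition basis_fam :: "('i \<Rightarrow> ('b \<Rightarrow> 'k::field)) \<Rightarrow> 'i set \<Rightarrow> bool" where
  "basis_fam e I \<longleftrightarrow> lin_indep_fam e I \<and> spans_H e I"

text \<open>Free: T(V) -> H is an algebra isomorphism for a graded subspace V; V is described by a
  homogeneous basis X, so T(V) has the basis of words over X, mapped to their products.\<close>
definition free_hopf :: "('b, 'k::field) hopf_data \<Rightarrow> bool" where
  "free_hopf H \<longleftrightarrow>
     (\<exists>X. (\<forall>x\<in>X. \<exists>n. x \<in> hom H n) \<and>
          basis_fam (\<lambda>w. foldr (hmul H) w (one_vec H)) (lists X))"

text \<open>Cofree: H is isomorphic as a graded coalgebra to coT(W), W graded with W_0 = 0.
  W is described by a homogeneous basis A (a set of natural numbers, W having countable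
  dimension) with degrees d; E w is the image in H of the word w (basis of coT(W)).\<close>
definition cofree_hopf :: "('b, 'k::field) hopf_data \<Rightarrow> bool" where
  "cofree_hopf H \<longleftrightarrow>
     (\<exists>(A :: nat set) (d :: nat \<Rightarrow> nat) (E :: nat list \<Rightarrow> ('b \<Rightarrow> 'k)).
        (\<forall>a\<in>A. d a \<ge> 1) \<and>
        (\<forall>w\<in>lists A. E w \<in> hom H (sum_list (map d w))) \<and>
        basis_fam E (lists A) \<and>
        (\<forall>w\<in>lists A. hDelta H (E w) = (\<Sum>i\<le>length w. tens (E (take i w)) (E (drop i w)))) \<and>
        (\<forall>w\<in>lists A. hcounit H (E w) = (if w = [] then 1 else 0)))"

text \<open>Isomorphism of graded Hopf algebras (a bijective graded bialgebra morphism; it then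
  automatically commutes with the antipodes). F a is the image of the basis vector a.\<close>
definition hopf_iso :: "('b, 'k::field) hopf_data \<Rightarrow> ('c, 'k) hopf_data \<Rightarrow> ('b \<Rightarrow> 'c \<Rightarrow> 'k) \<Rightarrow> bool" where
  "hopf_iso H H' F \<longleftrightarrow>
     (\<forall>a. fsupp (F a)) \<and>
     (\<forall>a c. F a c \<noteq> 0 \<longrightarrow> deg H' c = deg H a) \<and>
     (\<exists>G. (\<forall>c. fsupp (G c)) \<and> (\<forall>a. lin G (F a) = bas a) \<and> (\<forall>c. lin F (G c) = bas c)) \<and>
     (\<forall>a b. lin F (hmul H (bas a) (bas b)) = hmul H' (F a) (F b)) \<and>
     lin F (one_vec H) = one_vec H' \<and>
     (\<forall>a. hDelta H' (F a) = lin (tmap F F) (delta H a)) \<and>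
     (\<forall>a. hcounit H' (F a) = counit H a)"

definition hopf_isomorphic :: "('b, 'k::field) hopf_data \<Rightarrow> ('c, 'k) hopf_data \<Rightarrow> bool" where
  "hopf_isomorphic H H' \<longleftrightarrow> (\<exists>F. hopf_iso H H' F)"

text \<open>g/(g \<inter> H^{+2}) and g'/(g' \<inter> H'^{+2}) are isomorphic graded vector spaces: expressed by a
  degree-preserving linear map phi : g -> g' (a lift of the isomorphism) inducing a bijection
  on the quotients.\<close>
definition prim_quot_isomorphic :: "('b, 'k::field) hopf_data \<Rightarrow> ('c, 'k) hopf_data \<Rightarrow> bool" where
  "prim_quot_isomorphic H H' \<longleftrightarrow>
     (\<exists>\<phi> :: ('b \<Rightarrow> 'k) \<Rightarrow> ('c \<Rightarrow> 'k).
        (\<forall>x\<in>Prim H. \<phi> x \<in> Prim H') \<and>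
        (\<forall>x\<in>Prim H. \<forall>y\<in>Prim H. \<phi> (x + y) = \<phi> x + \<phi> y) \<and>
        (\<forall>c. \<forall>x\<in>Prim H. \<phi> (scaleF c x) = scaleF c (\<phi> x)) \<and>
        (\<forall>n. \<forall>x\<in>Prim H \<inter> hom H n. \<phi> x \<in> hom H' n) \<and>
        (\<forall>x\<in>Prim H. \<phi> x \<in> Hplus2 H' \<longleftrightarrow> x \<in> Hplus2 H) \<and>
        (\<forall>y\<in>Prim H'. \<exists>x\<in>Prim H. y - \<phi> x \<in> Hplus2 H'))"

definition dimH :: "('b, 'k) hopf_data \<Rightarrow> nat \<Rightarrow> nat" where
  "dimH H n = card {b. deg H b = n}"

definition poincare_series :: "('b, 'k) hopf_data \<Rightarrow> int fps" where
  "poincare_series H = Abs_fps (\<lambda>n. int (dimH H n))"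

end

theory Submission
  imports Defs "HOL-Library.Poly_Mapping"
begin

text \<open>
  An isomorphism is built degree by degree. Suppose graded isomorphisms
  \<open>H\<^sub>k \<cong> H'\<^sub>k\<close> for \<open>k < n\<close>, compatible with products and coproducts, are given.
  Since \<open>H\<close> is free, the kernel of the multiplication
  \<open>(H\<^sup>+ \<otimes> H\<^sup>+)\<^sub>n \<rightarrow> H\<^sub>n\<close> is spanned by the elements \<open>ab \<otimes> c - a \<otimes> bc\<close>, so the
  isomorphism extends to the decomposable part \<open>(H\<^sup>+\<^sup>2)\<^sub>n\<close>. Dually, since \<open>H\<close> is cofree, the image
  of the reduced coproduct on \<open>H\<^sub>n\<close> consists of all \<open>t\<close> with
  \<open>(\<Delta> \<otimes> id) t = (id \<otimes> \<Delta>) t\<close>. Both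
  descriptions involve lower degrees only; hence \<open>g\<^sub>n \<inter> H\<^sup>+\<^sup>2\<close> and \<open>H\<^sub>n / g\<^sub>n\<close> are
  already identified with their counterparts in \<open>H'\<close>. It follows that \<open>dim H\<^sub>n = dim H'\<^sub>n\<close> exactly when
  \<open>g\<^sub>n / (g\<^sub>n \<inter> H\<^sup>+\<^sup>2)\<close> and its counterpart are isomorphic, and in this case linear algebra extends
  the isomorphism to \<open>H\<^sub>n\<close>: first to \<open>H\<^sup>+\<^sup>2 + g\<close>, then by lifting along the reduced coproduct.
\<close>

section \<open>Finitely supported vectors\<close>

text \<open>Freeness and cofreeness are given by bases of words that need not be related to each
  other, nor between \<open>H\<close> and \<open>H'\<close>, so generators are never matched with
  generators. Each property enters only through a consequence that mentions no such basis: a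
  balanced map on \<open>H\<^sup>+ \<otimes> H\<^sup>+\<close> factors through the product, and a
  cobalanced element of \<open>H\<^sup>+ \<otimes> H\<^sup>+\<close> is a reduced coproduct.
  Statements of this kind can be transported along an isomorphism of the lower degrees.

  In degree n the products prescribe the map on decomposables, and the reduced coproduct prescribes
  it modulo primitives. The two prescriptions agree because the coproduct is multiplicative. Neither
  says how the primitives outside \<open>H\<^sup>+\<^sup>2\<close> are to be matched; this is the
  role of the quotient isomorphism. Once that is available, every truncated isomorphism extends,
  whatever choices were made below, so no choice has to be revised and the stages can be
  glued.\<close>

lift_definition psc :: "'k::field \<Rightarrow> ('b \<Rightarrow>\<^sub>0 'k) \<Rightarrow> ('b \<Rightarrow>\<^sub>0 'k)" is "\<lambda>c v b. c * v b"
  by (rule finite_subset) auto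

abbreviation lookup :: "('b \<Rightarrow>\<^sub>0 'k::zero) \<Rightarrow> 'b \<Rightarrow> 'k" where "lookup \<equiv> Poly_Mapping.lookup"

abbreviation keys :: "('b \<Rightarrow>\<^sub>0 'k::zero) \<Rightarrow> 'b set" where "keys \<equiv> Poly_Mapping.keys"

lemma lookup_psc [simp]: "lookup (psc c v) b = c * lookup v b"
  by (simp add: psc.rep_eq)

text \<open>Finite support is built into this type, so linear algebra applies to the whole type.
  Among plain functions the finitely supported ones form only a subset.\<close>

global_interpretation pv: vector_space "psc :: 'k::field \<Rightarrow> ('b \<Rightarrow>\<^sub>0 'k) \<Rightarrow> ('b \<Rightarrow>\<^sub>0 'k)"
  by unfold_locales (auto intro!: poly_mapping_eqI simp: lookup_add algebra_simps)

global_interpretation pp: vector_space_pair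
  "psc :: 'k::field \<Rightarrow> ('b \<Rightarrow>\<^sub>0 'k) \<Rightarrow> ('b \<Rightarrow>\<^sub>0 'k)" "psc :: 'k::field \<Rightarrow> ('c \<Rightarrow>\<^sub>0 'k) \<Rightarrow> ('c \<Rightarrow>\<^sub>0 'k)"
  by unfold_locales

abbreviation plin :: "(('b \<Rightarrow>\<^sub>0 'k::field) \<Rightarrow> ('c \<Rightarrow>\<^sub>0 'k)) \<Rightarrow> bool" where
  "plin \<equiv> Vector_Spaces.linear psc psc"

abbreviation bs :: "'b \<Rightarrow> ('b \<Rightarrow>\<^sub>0 'k::field)" where
  "bs b \<equiv> Poly_Mapping.single b 1"

lemma plin_iff: "plin f \<longleftrightarrow> (\<forall>x y. f (x + y) = f x + f y) \<and> (\<forall>c x. f (psc c x) = psc c (f x))"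
  by (simp add: Vector_Spaces.linear_iff pv.vector_space_axioms)

lemma plin_id [simp, intro]: "plin (\<lambda>x. x)" "plin id"
  by (auto simp: plin_iff)

lemma plin_comp: "plin f \<Longrightarrow> plin g \<Longrightarrow> plin (\<lambda>x. f (g x))"
  by (auto simp: plin_iff)

lemma plin_add: "plin f \<Longrightarrow> plin g \<Longrightarrow> plin (\<lambda>x. f x + g x)"
  by (auto simp: plin_iff algebra_simps)

definition pext :: "('b \<Rightarrow> ('c \<Rightarrow>\<^sub>0 'k::field)) \<Rightarrow> ('b \<Rightarrow>\<^sub>0 'k) \<Rightarrow> ('c \<Rightarrow>\<^sub>0 'k)" where
  "pext F v = (\<Sum>b\<in>keys v. psc (lookup v b) (F b))"

lemma pext_superset:
  assumes "finite S" "keys v \<subseteq> S"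
  shows "pext F v = (\<Sum>b\<in>S. psc (lookup v b) (F b))"
  unfolding pext_def by (rule sum.mono_neutral_left) (use assms in \<open>auto simp: in_keys_iff\<close>)

lemma plin_pext [simp, intro]: "plin (pext F)"
proof -
  have "pext F (x + y) = pext F x + pext F y" for x y
    using keys_add[of x y]
    by (simp add: pext_superset[of "keys x \<union> keys y"] lookup_add pv.scale_left_distrib sum.distrib)
  moreover have "pext F (psc c x) = psc c (pext F x)" for c x
    by (subst (1 2) pext_superset[of "keys x"]) (auto simp: in_keys_iff pv.scale_sum_right)
  ultimately show ?thesis by (simp add: plin_iff)
qed

lemma pext_bs [simp]: "pext F (bs b) = F b"
  by (simp add: pext_def)

lemma pext_bs_id: "pext bs v = v"
proof (rule poly_mapping_eqI)
  fix b
  have "lookup (pext bs v) b = (\<Sum>a\<in>keys v. if b = a then lookup v a else 0)"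
    unfolding pext_def lookup_sum by (intro sum.cong) (auto simp: lookup_single)
  then show "lookup (pext bs v) b = lookup v b"
    by (auto simp: in_keys_iff)
qed

lemma plin_expand:
  assumes "plin f" shows "f v = pext (\<lambda>b. f (bs b)) v"
proof -
  have "f v = f (\<Sum>b\<in>keys v. psc (lookup v b) (bs b))"
    using pext_bs_id[of v] by (simp add: pext_def)
  then show ?thesis
    by (simp add: pp.linear_sum[OF assms] pp.linear_scale[OF assms] pext_def)
qed

lemma plin_eqI:
  assumes "plin f" "plin g" "\<And>b. b \<in> keys v \<Longrightarrow> f (bs b) = g (bs b)"
  shows "f v = g v"
  by (subst plin_expand[OF assms(1)], subst plin_expand[OF assms(2)])
     (auto simp: pext_def assms(3) intro!: sum.cong)

lemma plin_mem:
  assumes "plin f" "pv.subspace S" "\<And>b. b \<in> keys v \<Longrightarrow> f (bs b) \<in> S"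
  shows "f v \<in> S"
  by (subst plin_expand[OF assms(1)]) (auto simp: pext_def intro!: pv.subspace_sum pv.subspace_scale assms)

lemma mem_subspace_of_bs:
  assumes "pv.subspace S" "\<And>b. b \<in> keys v \<Longrightarrow> bs b \<in> S"
  shows "v \<in> S"
  using plin_mem[OF plin_id(1) assms] by simp

text \<open>The coordinate projection along the remaining basis vectors. Homogeneous components
  (\<open>hpart\<close>) and the passage to the reduced coproduct (\<open>Rd\<close>) are
  instances.\<close>

definition pres :: "'b set \<Rightarrow> ('b \<Rightarrow>\<^sub>0 'k::field) \<Rightarrow> ('b \<Rightarrow>\<^sub>0 'k)" where
  "pres S = pext (\<lambda>b. if b \<in> S then bs b else 0)"

lemma plin_pres [simp, intro]: "plin (pres S)"
  by (simp add: pres_def)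

lemma pres_bs: "pres S (bs b) = (if b \<in> S then bs b else 0)"
  by (simp add: pres_def)

lemma lookup_pres: "lookup (pres S v) b = (if b \<in> S then lookup v b else 0)"
proof -
  have "lookup (pres S v) b = (\<Sum>a\<in>keys v. if b = a then (if b \<in> S then lookup v a else 0) else 0)"
    unfolding pres_def pext_def lookup_sum by (intro sum.cong) (auto simp: lookup_single)
  then show ?thesis by (auto simp: in_keys_iff)
qed

lemma pres_ident: "keys v \<subseteq> S \<Longrightarrow> pres S v = v"
  by (rule poly_mapping_eqI) (auto simp: lookup_pres in_keys_iff)

lemma pres_zero: "keys v \<inter> S = {} \<Longrightarrow> pres S v = 0"
  by (rule poly_mapping_eqI) (auto simp: lookup_pres in_keys_iff disjoint_iff)

lemma keys_pres: "keys (pres S v) = keys v \<inter> S"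
  by (auto simp: in_keys_iff lookup_pres split: if_splits)

lemma pres_pres: "pres S (pres T v) = pres (S \<inter> T) v"
  by (rule poly_mapping_eqI) (auto simp: lookup_pres)

subsection \<open>Tensors\<close>

definition tns :: "('a \<Rightarrow>\<^sub>0 'k::field) \<Rightarrow> ('b \<Rightarrow>\<^sub>0 'k) \<Rightarrow> ('a \<times> 'b \<Rightarrow>\<^sub>0 'k)" where
  "tns u v = pext (\<lambda>a. pext (\<lambda>b. bs (a, b)) v) u"

lemma tns_bs [simp]: "tns (bs a) (bs b) = bs (a, b)"
  by (simp add: tns_def)

lemma pext_add: "pext (\<lambda>a. F a + G a) v = pext F v + pext G v"
  by (simp add: pext_def pv.scale_right_distrib sum.distrib)

lemma pext_psc: "pext (\<lambda>a. psc c (F a)) v = psc c (pext F v)"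
  by (simp add: pext_def pv.scale_sum_right mult.commute)

lemma plin_tns_left [simp, intro]: "plin (\<lambda>u. tns u v)"
  unfolding tns_def by (rule plin_pext)

lemma plin_tns_right [simp, intro]: "plin (tns u)"
  by (simp add: plin_iff tns_def pext_add pext_psc pp.linear_add[OF plin_pext] pp.linear_scale[OF plin_pext])

lemma lookup_tns: "lookup (tns u v) (a, b) = lookup u a * lookup v b"
proof -
  have 1: "lookup (pext (\<lambda>b. bs (a', b)) v) (a, b) = (if a = a' then lookup v b else 0)" for a'
  proof -
    have "lookup (pext (\<lambda>b. bs (a', b)) v) (a, b)
        = (\<Sum>b'\<in>keys v. if b = b' then (if a = a' then lookup v b' else 0) else 0)"
      unfolding pext_def lookup_sum by (intro sum.cong) (auto simp: lookup_single)
    then show ?thesis by (auto simp: in_keys_iff)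
  qed
  have "lookup (tns u v) (a, b) = (\<Sum>a'\<in>keys u. if a = a' then lookup u a' * lookup v b else 0)"
    unfolding tns_def pext_def[of _ u] lookup_sum by (intro sum.cong) (auto simp: 1)
  then show ?thesis by (auto simp: in_keys_iff)
qed

lemma keys_tns: "keys (tns u v) = keys u \<times> keys v"
  by (auto simp: in_keys_iff lookup_tns)

definition tm :: "(('a \<Rightarrow>\<^sub>0 'k::field) \<Rightarrow> ('c \<Rightarrow>\<^sub>0 'k)) \<Rightarrow> (('b \<Rightarrow>\<^sub>0 'k) \<Rightarrow> ('d \<Rightarrow>\<^sub>0 'k))
    \<Rightarrow> ('a \<times> 'b \<Rightarrow>\<^sub>0 'k) \<Rightarrow> ('c \<times> 'd \<Rightarrow>\<^sub>0 'k)" where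
  "tm f g = pext (\<lambda>(a, b). tns (f (bs a)) (g (bs b)))"

lemma plin_tm [simp, intro]: "plin (tm f g)"
  by (simp add: tm_def)

lemma tm_bs [simp]: "tm f g (bs (a, b)) = tns (f (bs a)) (g (bs b))"
  by (simp add: tm_def)

text \<open>Only basis vectors occurring in \<open>u\<close> and \<open>v\<close> are tested: many
  equations below hold in certain degrees only, and the support of a homogeneous vector respects
  such a bound.\<close>

lemma bilinear_eqI:
  assumes "\<And>v. plin (\<lambda>u. f u v)" "\<And>u. plin (f u)" "\<And>v. plin (\<lambda>u. g u v)" "\<And>u. plin (g u)"
    and eq: "\<And>a b. a \<in> keys u \<Longrightarrow> b \<in> keys v \<Longrightarrow> f (bs a) (bs b) = g (bs a) (bs b)"
  shows "f u v = g u v"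
proof (rule plin_eqI[of "\<lambda>u. f u v" "\<lambda>u. g u v" u])
  fix a assume "a \<in> keys u"
  then show "f (bs a) v = g (bs a) v"
    by (intro plin_eqI[of "f (bs a)" "g (bs a)" v] assms)
qed (use assms in auto)

lemma tm_tns [simp]:
  assumes f: "plin f" and g: "plin g"
  shows "tm f g (tns u v) = tns (f u) (g v)"
  by (rule bilinear_eqI[of "\<lambda>u v. tm f g (tns u v)" "\<lambda>u v. tns (f u) (g v)"])
     (auto intro: plin_comp[OF plin_tm plin_tns_left] plin_comp[OF plin_tm plin_tns_right]
        plin_comp[OF plin_tns_left f] plin_comp[OF plin_tns_right g])

lemma tm_tm:
  assumes "plin f" "plin g"
  shows "tm f g (tm f' g' t) = tm (\<lambda>x. f (f' x)) (\<lambda>x. g (g' x)) t"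
  by (rule plin_eqI) (auto intro: plin_comp assms simp: assms)

text \<open>Serves to exchange maps that agree only in low degrees, inside a coproduct whose tensor
  factors have low degree.\<close>

lemma tm_cong:
  assumes "\<And>a b. (a, b) \<in> keys t \<Longrightarrow> f (bs a) = f' (bs a)" "\<And>a b. (a, b) \<in> keys t \<Longrightarrow> g (bs b) = g' (bs b)"
  shows "tm f g t = tm f' g' t"
  by (rule plin_eqI) (auto dest: assms simp: assms)

text \<open>The two bracketings of a triple tensor product are indexed by different types, so
  coassociativity needs an explicit associator.\<close>

definition asc :: "(('a \<times> 'b) \<times> 'c \<Rightarrow>\<^sub>0 'k::field) \<Rightarrow> ('a \<times> 'b \<times> 'c \<Rightarrow>\<^sub>0 'k)" where
  "asc = pext (\<lambda>((a, b), c). bs (a, b, c))"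

lemma plin_asc [simp, intro]: "plin asc"
  by (simp add: asc_def)

lemma asc_tns [simp]: "asc (tns (tns u v) w) = tns u (tns v w)"
proof -
  have 1: "asc (tns (tns u v) (bs c)) = tns u (tns v (bs c))" for c
  proof (rule bilinear_eqI[of "\<lambda>u v. asc (tns (tns u v) (bs c))" "\<lambda>u v. tns u (tns v (bs c))"])
    show "plin (\<lambda>u. asc (tns (tns u v) (bs c)))" for v
      by (rule plin_comp[OF plin_asc plin_comp[OF plin_tns_left plin_tns_left]])
    show "plin (\<lambda>v. asc (tns (tns u v) (bs c)))" for u
      by (rule plin_comp[OF plin_asc plin_comp[OF plin_tns_left plin_tns_right]])
    show "plin (\<lambda>v. tns u (tns v (bs c)))" for u :: "'a \<Rightarrow>\<^sub>0 'd"
      by (rule plin_comp[OF plin_tns_right plin_tns_left])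
  qed (auto simp: asc_def)
  show ?thesis
    by (rule plin_eqI[of "\<lambda>w. asc (tns (tns u v) w)" "\<lambda>w. tns u (tns v w)"])
       (auto simp: 1 intro: plin_comp[OF plin_asc plin_tns_right] plin_comp[OF plin_tns_right plin_tns_right])
qed

lemma asc_natural:
  assumes "plin f" "plin g" "plin h"
  shows "asc (tm (tm f g) h t) = tm f (tm g h) (asc t)"
proof (rule plin_eqI[of "\<lambda>t. asc (tm (tm f g) h t)" "\<lambda>t. tm f (tm g h) (asc t)"])
  fix b assume "b \<in> keys t"
  obtain x y z where "b = ((x, y), z)" by (metis surj_pair)
  then show "asc (tm (tm f g) h (bs b)) = tm f (tm g h) (asc (bs b))"
    by (simp add: tns_bs[symmetric] assms del: tns_bs)
qed (auto intro: plin_comp)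

subsection \<open>Gradings\<close>

definition hm :: "('b \<Rightarrow> nat) \<Rightarrow> nat \<Rightarrow> ('b \<Rightarrow>\<^sub>0 'k::field) set" where
  "hm d n = {v. \<forall>b\<in>keys v. d b = n}"

lemma hmD: "v \<in> hm d n \<Longrightarrow> b \<in> keys v \<Longrightarrow> d b = n"
  by (auto simp: hm_def)

lemma subspace_hm [simp, intro]: "pv.subspace (hm d n)"
  by (rule pv.subspaceI) (use keys_add in \<open>fastforce simp: hm_def in_keys_iff lookup_add\<close>)+

lemma bs_hm [simp]: "(bs b :: 'b \<Rightarrow>\<^sub>0 'k::field) \<in> hm d n \<longleftrightarrow> d b = n"
  by (simp add: hm_def)

lemma zero_hm [simp]: "0 \<in> hm d n"
  by (simp add: hm_def)

definition d2 :: "('a \<Rightarrow> nat) \<Rightarrow> ('b \<Rightarrow> nat) \<Rightarrow> 'a \<times> 'b \<Rightarrow> nat" where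
  "d2 d e = (\<lambda>(x, y). d x + e y)"

lemma d2_simp [simp]: "d2 d e (x, y) = d x + e y"
  by (simp add: d2_def)

lemma tns_hm: "u \<in> hm d m \<Longrightarrow> v \<in> hm e n \<Longrightarrow> tns u v \<in> hm (d2 d e) (m + n)"
  by (auto simp: hm_def keys_tns)

definition hpart :: "('b \<Rightarrow> nat) \<Rightarrow> nat \<Rightarrow> ('b \<Rightarrow>\<^sub>0 'k::field) \<Rightarrow> ('b \<Rightarrow>\<^sub>0 'k)" where
  "hpart d n = pres {b. d b = n}"

lemma plin_hpart [simp, intro]: "plin (hpart d n)"
  by (simp add: hpart_def)

lemma hpart_hm [simp]: "hpart d n v \<in> hm d n"
  by (auto simp: hpart_def hm_def keys_pres)

lemma hpart_of_hm: "v \<in> hm d m \<Longrightarrow> hpart d n v = (if m = n then v else 0)"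
  by (auto simp: hpart_def hm_def intro!: pres_ident pres_zero)

lemma hpart_bs: "hpart d n (bs b) = (if d b = n then bs b else 0)"
  by (simp add: hpart_def pres_bs)

lemma sum_hpart:
  assumes "\<And>b. b \<in> keys v \<Longrightarrow> d b \<le> N"
  shows "(\<Sum>n\<le>N. hpart d n v) = v"
proof (rule poly_mapping_eqI)
  fix b
  show "lookup (\<Sum>n\<le>N. hpart d n v) b = lookup v b"
    using assms[of b] by (auto simp: lookup_sum hpart_def lookup_pres in_keys_iff)
qed

lemma hpart_commute:
  assumes "plin f" "\<And>b. f (bs b) \<in> hm e (d b)"
  shows "hpart e n (f v) = f (hpart d n v)"
  by (rule plin_eqI) (auto intro: plin_comp assms simp: hpart_bs hpart_of_hm[OF assms(2)] pp.linear_0[OF assms(1)])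

lemma plin_hm:
  assumes "plin f" "v \<in> hm d n" "\<And>b. d b = n \<Longrightarrow> f (bs b) \<in> hm e m"
  shows "f v \<in> hm e m"
  by (rule plin_mem) (use assms in \<open>auto dest: hmD\<close>)

lemma plin_eq_hm:
  assumes "plin f" "plin g" "v \<in> hm d n" "\<And>b. d b = n \<Longrightarrow> f (bs b) = g (bs b)"
  shows "f v = g v"
  by (rule plin_eqI) (use assms in \<open>auto dest: hmD\<close>)

section \<open>Extending isomorphisms of vector spaces\<close>

text \<open>The linear map that fixes \<open>B\<close> and kills \<open>C\<close> both fixes and
  kills \<open>x\<close>.\<close>

lemma span_disjoint_independent:
  fixes B C :: "('b \<Rightarrow>\<^sub>0 'k::field) set"
  assumes "pv.independent (B \<union> C)" "B \<inter> C = {}" "x \<in> pv.span B" "x \<in> pv.span C"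
  shows "x = 0"
proof -
  obtain k :: "('b \<Rightarrow>\<^sub>0 'k) \<Rightarrow> ('b \<Rightarrow>\<^sub>0 'k)"
    where k: "plin k" "\<And>x. x \<in> B \<union> C \<Longrightarrow> k x = (if x \<in> B then x else 0)"
    using pp.linear_independent_extend[OF assms(1), of "\<lambda>x. if x \<in> B then x else 0"] by blast
  have "k x = x"
    by (rule pp.linear_eq_on[OF k(1) plin_id(1) assms(3)]) (use k in auto)
  moreover have "k x = 0"
    by (rule pp.linear_eq_0_on_span[OF k(1) _ assms(4)]) (use k assms(2) in auto)
  ultimately show ?thesis by simp
qed

text \<open>Rank-nullity in the form needed later: a basis \<open>CG\<close> of the kernel is
  extended to a basis \<open>C\<close> of \<open>W\<close>, and \<open>L\<close> maps the added
  vectors injectively onto a basis of the image.\<close>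

lemma card_basis_minus_kernel_basis:
  fixes W C CG :: "('x \<Rightarrow>\<^sub>0 'k::field) set" and L :: "('x \<Rightarrow>\<^sub>0 'k) \<Rightarrow> ('c \<Rightarrow>\<^sub>0 'k)"
  assumes C: "CG \<subseteq> C" "C \<subseteq> W" "pv.independent C" "W \<subseteq> pv.span C" and L: "plin L" and W: "pv.subspace W"
    and CG: "CG \<subseteq> {x\<in>W. L x = 0}" "{x\<in>W. L x = 0} \<subseteq> pv.span CG"
  shows "card (C - CG) = pv.dim (L ` W)"
proof -
  have spanW: "pv.span (C - CG) \<subseteq> W"
    using C W pv.span_minimal[of "C - CG" W] by blast
  have inj: "inj_on L (pv.span (C - CG))"
    unfolding pp.linear_inj_on_iff_eq_0[OF L pv.subspace_span]
  proof safe
    fix x assume x: "x \<in> pv.span (C - CG)" "L x = 0"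
    then have "x \<in> pv.span CG" using spanW CG by blast
    then show "x = 0"
      using span_disjoint_independent[of "C - CG" CG x] x C by (auto simp: Un_absorb2)
  qed
  have "pv.independent (L ` (C - CG))"
    using pp.linear_independent_injective_image[OF L _ inj] C(3) pv.independent_mono by blast
  moreover have "L ` W \<subseteq> pv.span (L ` (C - CG))"
  proof
    fix y assume "y \<in> L ` W"
    then obtain x where x: "x \<in> W" "y = L x" by auto
    have "x \<in> pv.span (CG \<union> (C - CG))" using x C by (auto simp: Un_absorb1)
    then obtain a b where ab: "a \<in> pv.span CG" "b \<in> pv.span (C - CG)" "x = a + b"
      unfolding pv.span_Un by auto
    have "L a = 0" by (rule pp.linear_eq_0_on_span[OF L _ ab(1)]) (use CG in auto)
    then have "y = L b" using x ab by (simp add: pp.linear_add[OF L])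
    then show "y \<in> pv.span (L ` (C - CG))" using ab pp.linear_span_image[OF L] by auto
  qed
  moreover have "L ` (C - CG) \<subseteq> L ` W" using C by auto
  ultimately have "card (L ` (C - CG)) = pv.dim (L ` W)"
    using pv.basis_card_eq_dim by blast
  moreover have "card (L ` (C - CG)) = card (C - CG)"
    by (rule card_image) (rule inj_on_subset[OF inj pv.span_superset])
  ultimately show ?thesis by simp
qed

text \<open>The linear algebra of one degree. In the application \<open>V\<close> and
  \<open>V'\<close> are the components of degree n, \<open>P\<close> and \<open>P'\<close> their
  decomposable parts, \<open>f\<close> the map forced by products, \<open>D\<close> the reduced
  coproduct of \<open>H'\<close>, and \<open>E\<close> that of \<open>H\<close> carried over to
  \<open>H'\<close> by the lower degrees. Then \<open>g\<close> and \<open>g'\<close> are the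
  primitives.\<close>

locale extension_problem =
  fixes V P :: "('a \<Rightarrow>\<^sub>0 'k::field) set" and V' P' :: "('b \<Rightarrow>\<^sub>0 'k) set"
    and f :: "('a \<Rightarrow>\<^sub>0 'k) \<Rightarrow> ('b \<Rightarrow>\<^sub>0 'k)"
    and E :: "('a \<Rightarrow>\<^sub>0 'k) \<Rightarrow> ('c \<Rightarrow>\<^sub>0 'k)" and D :: "('b \<Rightarrow>\<^sub>0 'k) \<Rightarrow> ('c \<Rightarrow>\<^sub>0 'k)"
    and g :: "('a \<Rightarrow>\<^sub>0 'k) set" and g' :: "('b \<Rightarrow>\<^sub>0 'k) set"
  assumes sub: "pv.subspace V" "pv.subspace V'" "pv.subspace P" "pv.subspace P'" "P \<subseteq> V" "P' \<subseteq> V'"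
    and lin: "plin f" "plin E" "plin D"
    and f_onto: "f ` P = P'" and f_inj: "\<And>x. x \<in> P \<Longrightarrow> f x = 0 \<Longrightarrow> x = 0"
    and f_compat: "\<And>x. x \<in> P \<Longrightarrow> D (f x) = E x"
    and img: "E ` V = D ` V'"
    and g_def: "g = {x\<in>V. E x = 0}" "g' = {x\<in>V'. D x = 0}"
begin

lemma subspace_g: "pv.subspace g" "pv.subspace g'"
  unfolding g_def using sub lin
  by (auto simp: pv.subspace_def pp.linear_add pp.linear_scale pp.linear_0)

text \<open>A basis adapted to \<open>P\<close>, then \<open>P + g\<close>, then \<open>V\<close>
  lets the three prescriptions be made independently. On the intersection of \<open>g\<close> and
  \<open>P\<close> the maps \<open>f\<close> and \<open>\<theta>\<close> may disagree, so
  \<open>\<theta>\<close> is followed only on a complement \<open>U\<close> of this intersection in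
  \<open>g\<close>.\<close>

lemma extend:
  assumes th_mem: "\<And>x. x \<in> g \<Longrightarrow> \<theta> x \<in> g'"
    and th_add: "\<And>x y. x \<in> g \<Longrightarrow> y \<in> g \<Longrightarrow> \<theta> (x + y) = \<theta> x + \<theta> y"
    and th_scale: "\<And>c x. x \<in> g \<Longrightarrow> \<theta> (psc c x) = psc c (\<theta> x)"
    and th_inj: "\<And>x. x \<in> g \<Longrightarrow> \<theta> x \<in> P' \<longleftrightarrow> x \<in> P"
    and th_surj: "\<And>y. y \<in> g' \<Longrightarrow> \<exists>x\<in>g. y - \<theta> x \<in> P'"
  shows "\<exists>\<chi>. plin \<chi> \<and> (\<forall>x\<in>P. \<chi> x = f x) \<and> \<chi> ` V = V' \<and> inj_on \<chi> V \<and> (\<forall>x\<in>V. D (\<chi> x) = E x)"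
proof -
  obtain B0 where B0: "B0 \<subseteq> P" "pv.independent B0" "P \<subseteq> pv.span B0"
    using pv.maximal_independent_subset[of P] by blast
  have P_span: "P = pv.span B0"
    using B0 sub(3) pv.span_minimal by blast
  \<comment> \<open>The new vectors are selected from \<open>g\<close> itself and not merely from
    \<open>P + g\<close>, so that \<open>\<theta>\<close> can be applied to them.\<close>
  obtain BG where BG: "B0 \<subseteq> BG" "BG \<subseteq> B0 \<union> g" "pv.independent BG" "B0 \<union> g \<subseteq> pv.span BG"
    using pv.maximal_independent_subset_extend[of B0 "B0 \<union> g"] B0 by blast
  have "BG \<subseteq> V" using BG(2) B0(1) sub(5) g_def by auto
  then obtain B where B: "BG \<subseteq> B" "B \<subseteq> V" "pv.independent B" "V \<subseteq> pv.span B"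
    using pv.maximal_independent_subset_extend[of BG V] BG by blast
  define B1 where "B1 = BG - B0"
  have B1: "B1 \<subseteq> g" "BG = B0 \<union> B1" "B0 \<inter> B1 = {}" using BG by (auto simp: B1_def)
  define U where "U = pv.span B1"
  have Ug: "U \<subseteq> g" unfolding U_def using B1(1) subspace_g pv.span_minimal by blast
  have PU: "x = 0" if "x \<in> P" "x \<in> U" for x
    using span_disjoint_independent[of B0 B1 x] BG(3) B1 that by (auto simp: P_span U_def)
  have g_split: "\<exists>p\<in>P. \<exists>u\<in>U. x = p + u" if "x \<in> g" for x
  proof -
    have "x \<in> pv.span (B0 \<union> B1)" using that BG(4) B1(2) by auto
    then show ?thesis unfolding pv.span_Un P_span U_def by auto
  qed
  have lift: "\<exists>c. c \<in> V' \<and> D c = E b" if "b \<in> V" for b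
  proof -
    have "E b \<in> D ` V'" using that img by blast
    then show ?thesis by auto
  qed
  \<comment> \<open>Decomposables follow \<open>f\<close>, the added primitives follow
    \<open>\<theta>\<close>, and any other basis vector goes to some \<open>D\<close>-preimage of
    its \<open>E\<close>-value, which exists because the images of \<open>E\<close> and
    \<open>D\<close> coincide.\<close>
  define h where "h b = (if b \<in> B0 then f b else if b \<in> BG then \<theta> b else (SOME c. c \<in> V' \<and> D c = E b))" for b
  obtain \<chi> where chi: "plin \<chi>" "\<And>b. b \<in> B \<Longrightarrow> \<chi> b = h b"
    using pp.linear_independent_extend[OF B(3), of h] by blast
  have chi_P: "\<chi> x = f x" if "x \<in> P" for x
    by (rule pp.linear_eq_on[OF chi(1) lin(1)]) (use that BG B P_span chi(2) in \<open>auto simp: h_def\<close>)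
  have hV: "h b \<in> V' \<and> D (h b) = E b" if "b \<in> B" for b
  proof -
    consider "b \<in> B0" | "b \<in> B1" | "b \<notin> BG" using B1 by auto
    then show ?thesis
    proof cases
      case 1
      then have "b \<in> P" using B0 by auto
      then show ?thesis using 1 f_compat f_onto sub by (auto simp: h_def)
    next
      case 2
      then have "b \<in> g" "h b = \<theta> b" using B1 by (auto simp: h_def)
      then show ?thesis using th_mem[of b] by (auto simp: g_def)
    next
      case 3
      then have "h b = (SOME c. c \<in> V' \<and> D c = E b)" using BG by (auto simp: h_def)
      then show ?thesis using someI_ex[OF lift[of b]] that B by auto
    qed
  qed
  have chi_V: "\<chi> x \<in> V'" if "x \<in> V" for x
  proof -
    have "x \<in> pv.span B" using that B by auto
    then have "\<chi> x \<in> pv.span (\<chi> ` B)" using pp.linear_span_image[OF chi(1), of B] by blast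
    moreover have "pv.span (\<chi> ` B) \<subseteq> V'"
      by (rule pv.span_minimal) (use hV chi(2) sub in auto)
    ultimately show ?thesis by blast
  qed
  have chi_E: "D (\<chi> x) = E x" if "x \<in> V" for x
    by (rule pp.linear_eq_on[OF plin_comp[OF lin(3) chi(1)] lin(2), of x B]) (use that B hV chi(2) in auto)
  have th0: "\<theta> 0 = 0"
    using th_scale[of 0 0] pv.subspace_0[OF subspace_g(1)] by simp
  have chi_U: "\<chi> u = \<theta> u" if "u \<in> U" for u
  proof -
    have "pv.subspace {u\<in>g. \<chi> u = \<theta> u}"
      by (rule pv.subspaceI)
         (use subspace_g(1) th0 in \<open>auto simp: pv.subspace_def pp.linear_add[OF chi(1)]
           pp.linear_scale[OF chi(1)] pp.linear_0[OF chi(1)] th_add th_scale\<close>)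
    moreover have "B1 \<subseteq> {u\<in>g. \<chi> u = \<theta> u}"
      using B1(1) B(1) chi(2) by (auto simp: h_def B1_def)
    ultimately show ?thesis
      using pv.span_minimal[of B1 "{u\<in>g. \<chi> u = \<theta> u}"] that by (auto simp: U_def)
  qed
  have "inj_on \<chi> V"
    unfolding pp.linear_inj_on_iff_eq_0[OF chi(1) sub(1)]
  proof safe
    \<comment> \<open>A kernel element lies in \<open>g\<close> because \<open>\<chi>\<close>
      carries \<open>E\<close> to \<open>D\<close>. Splitting it as \<open>p + u\<close> puts
      \<open>\<theta> u\<close> into \<open>P'\<close>, hence \<open>u\<close> into
      \<open>P\<close>, where it meets \<open>U\<close> only in 0.\<close>
    fix x assume x: "x \<in> V" "\<chi> x = 0"
    then have "x \<in> g" using chi_E[of x] by (simp add: g_def pp.linear_0[OF lin(3)])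
    then obtain p u where pu: "p \<in> P" "u \<in> U" "x = p + u" using g_split by blast
    have "f p + \<theta> u = 0"
      using x pu chi_P chi_U by (simp add: pp.linear_add[OF chi(1)])
    then have "\<theta> u = f (- p)" by (simp add: pp.linear_neg[OF lin(1)] eq_neg_iff_add_eq_0 add.commute)
    moreover have "- p \<in> P" using pu sub(3) pv.subspace_neg by blast
    ultimately have "\<theta> u \<in> P'" using f_onto by auto
    then have "u \<in> P" using th_inj pu Ug by blast
    then have "u = 0" using PU pu by blast
    then have "f p = 0" using \<open>f p + \<theta> u = 0\<close> th0 by simp
    then show "x = 0" using f_inj pu \<open>u = 0\<close> by auto
  qed
  moreover have "V' \<subseteq> \<chi> ` V"
  proof
    fix y assume y: "y \<in> V'"
    then obtain x where x: "x \<in> V" "D y = E x" using img by (metis imageE imageI)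
    \<comment> \<open>After correcting the \<open>D\<close>-value, the error is handled by
      surjectivity of \<open>\<theta>\<close> modulo \<open>P'\<close>; what then remains lies in
      \<open>P'\<close> and is reached by \<open>f\<close>.\<close>
    have "y - \<chi> x \<in> g'"
      using x y chi_E chi_V sub(2) by (auto simp: g_def pp.linear_diff[OF lin(3)] pv.subspace_diff)
    then obtain z where z: "z \<in> g" "y - \<chi> x - \<theta> z \<in> P'" using th_surj by blast
    then obtain p u where pu: "p \<in> P" "u \<in> U" "z = p + u" using g_split by blast
    \<comment> \<open>Additivity of \<open>\<theta>\<close> is available on \<open>g\<close> only.
      With \<open>p\<close> in \<open>g\<close>, the term \<open>\<theta> p\<close> can be absorbed
      into \<open>P'\<close>, where it need not equal \<open>f p\<close>.\<close>
    have pg: "p \<in> g"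
      using pu z Ug pv.subspace_diff[OF subspace_g(1), of z u] by auto
    then have "\<theta> p \<in> P'" using th_inj pu by blast
    moreover have "\<theta> z = \<theta> p + \<chi> u" using th_add[of p u] pg pu Ug chi_U by auto
    ultimately have "y - \<chi> x - \<chi> u \<in> P'"
      using z(2) pv.subspace_add[OF sub(4), of "y - \<chi> x - \<theta> z" "\<theta> p"] by (simp add: algebra_simps)
    then obtain q where q: "q \<in> P" "y - \<chi> x - \<chi> u = \<chi> q" using f_onto chi_P by force
    then have "y = \<chi> (x + u + q)" by (simp add: pp.linear_add[OF chi(1)] algebra_simps)
    moreover have "x + u + q \<in> V"
      using x q pu Ug sub g_def by (auto intro!: pv.subspace_add)
    ultimately show "y \<in> \<chi> ` V" by blast
  qed
  ultimately show ?thesis using chi chi_P chi_V chi_E by blast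
qed

text \<open>Since \<open>f\<close> carries \<open>E\<close> to \<open>D\<close> on \<open>P\<close>,
  it matches their kernels there.\<close>

lemma f_prim: "f ` (g \<inter> P) = g' \<inter> P'"
proof
  show "f ` (g \<inter> P) \<subseteq> g' \<inter> P'" using f_compat f_onto sub by (auto simp: g_def)
  show "g' \<inter> P' \<subseteq> f ` (g \<inter> P)"
  proof
    fix y assume y: "y \<in> g' \<inter> P'"
    then obtain x where x: "x \<in> P" "y = f x" using f_onto by auto
    then have "E x = 0" using y f_compat[of x] by (simp add: g_def)
    then show "y \<in> f ` (g \<inter> P)" using x sub by (auto simp: g_def)
  qed
qed

text \<open>By rank-nullity the kernels \<open>g\<close> and \<open>g'\<close> have equal dimension, hence so do
  \<open>g/(g \<inter> P)\<close> and \<open>g'/(g' \<inter> P')\<close>.\<close>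

lemma ex_quotient_iso:
  assumes fin: "finite S" "V \<subseteq> pv.span S" "finite S'" "V' \<subseteq> pv.span S'" and dim: "pv.dim V = pv.dim V'"
  shows "\<exists>\<theta>. plin \<theta> \<and> (\<forall>x\<in>g. \<theta> x \<in> g') \<and> (\<forall>x\<in>g. \<theta> x \<in> P' \<longleftrightarrow> x \<in> P) \<and> (\<forall>y\<in>g'. \<exists>x\<in>g. y - \<theta> x \<in> P')"
proof -
  obtain B0 where B0: "B0 \<subseteq> g \<inter> P" "pv.independent B0" "g \<inter> P \<subseteq> pv.span B0"
    using pv.maximal_independent_subset[of "g \<inter> P"] by blast
  obtain BG where BG: "B0 \<subseteq> BG" "BG \<subseteq> g" "pv.independent BG" "g \<subseteq> pv.span BG"
    using pv.maximal_independent_subset_extend[of B0 g] B0 by blast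
  have gV: "g \<subseteq> V" "g' \<subseteq> V'" by (auto simp: g_def)
  obtain B where B: "BG \<subseteq> B" "B \<subseteq> V" "pv.independent B" "V \<subseteq> pv.span B"
    using pv.maximal_independent_subset_extend[OF subset_trans[OF BG(2) gV(1)] BG(3)] by blast
  define B0' where "B0' = f ` B0"
  have subP: "pv.subspace (g \<inter> P)" "pv.subspace (g' \<inter> P')"
    using subspace_g sub by (auto intro: pv.subspace_inter)
  have span0: "pv.span B0 = g \<inter> P" using B0 subP pv.span_minimal by blast
  have f_inj_on: "inj_on f (g \<inter> P)"
    unfolding pp.linear_inj_on_iff_eq_0[OF lin(1) subP(1)] using f_inj by auto
  have B0': "pv.independent B0'" "pv.span B0' = g' \<inter> P'" "card B0' = card B0"
    using pp.linear_independent_injective_image[OF lin(1) B0(2)] f_inj_on span0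
      pp.linear_span_image[OF lin(1), of B0] f_prim card_image[OF inj_on_subset[OF f_inj_on B0(1)]]
    by (auto simp: B0'_def)
  have "B0' \<subseteq> g'" using B0'(2) pv.span_superset[of B0'] by auto
  then obtain BG' where BG': "B0' \<subseteq> BG'" "BG' \<subseteq> g'" "pv.independent BG'" "g' \<subseteq> pv.span BG'"
    using pv.maximal_independent_subset_extend[of B0' g'] B0' by blast
  obtain B' where B': "BG' \<subseteq> B'" "B' \<subseteq> V'" "pv.independent B'" "V' \<subseteq> pv.span B'"
    using pv.maximal_independent_subset_extend[OF subset_trans[OF BG'(2) gV(2)] BG'(3)] by blast
  have finB: "finite B" "finite B'"
    using pv.independent_span_bound[OF fin(1) B(3)] pv.independent_span_bound[OF fin(3) B'(3)] B B' fin by auto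
  have cardB: "card B = card B'"
    using pv.basis_card_eq_dim[OF B(2,4,3)] pv.basis_card_eq_dim[OF B'(2,4,3)] dim by simp
  \<comment> \<open>Both numbers are the dimension of the common image of \<open>E\<close> and
    \<open>D\<close>. Subtracting them, and then the sizes of the matched bases \<open>B0\<close>
    and \<open>B0'\<close>, leaves equally many vectors in the two complements.\<close>
  have "card (B - BG) = card (B' - BG')"
    using card_basis_minus_kernel_basis[OF B(1,2,3,4) lin(2) sub(1)] card_basis_minus_kernel_basis[OF B'(1,2,3,4)
        lin(3) sub(2)] BG BG' img
    by (simp add: g_def)
  then have "card (BG - B0) = card (BG' - B0')"
    using card_Diff_subset[of BG B] card_Diff_subset[of BG' B'] card_Diff_subset[of B0 BG]
      card_Diff_subset[of B0' BG'] card_mono[OF finB(1) B(1)] card_mono[OF finB(2) B'(1)]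
      cardB B(1) B'(1) BG(1) BG'(1) B0'(3) finite_subset[OF B(1) finB(1)] finite_subset[OF B'(1) finB(2)]
    by (simp add: finite_subset)
  moreover have "finite (BG - B0)" "finite (BG' - B0')"
    using finite_subset[OF B(1) finB(1)] finite_subset[OF B'(1) finB(2)] by auto
  ultimately obtain h where h: "bij_betw h (BG - B0) (BG' - B0')"
    using finite_same_card_bij by meson
  \<comment> \<open>Only the quotients matter, so \<open>\<theta>\<close> may kill the intersection
    of \<open>g\<close> and \<open>P\<close>; the complement bases are matched by an arbitrary
    bijection.\<close>
  obtain \<theta> where th: "plin \<theta>" "\<And>b. b \<in> BG \<Longrightarrow> \<theta> b = (if b \<in> B0 then 0 else h b)"
    using pp.linear_independent_extend[OF BG(3), of "\<lambda>b. if b \<in> B0 then 0 else h b"] by blast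
  have th_img: "\<theta> ` (BG - B0) = BG' - B0'" and th_inj: "inj_on \<theta> (BG - B0)"
    using h th(2) by (auto simp: bij_betw_def image_iff inj_on_def)
  have split: "\<exists>p u. p \<in> pv.span B0 \<and> u \<in> pv.span (BG - B0) \<and> x = p + u" if "x \<in> g" for x
  proof -
    have "x \<in> pv.span (B0 \<union> (BG - B0))" using that BG by (auto simp: Un_absorb1)
    then show ?thesis unfolding pv.span_Un by auto
  qed
  have split': "\<exists>p u. p \<in> pv.span B0' \<and> u \<in> pv.span (BG' - B0') \<and> x = p + u" if "x \<in> g'" for x
  proof -
    have "x \<in> pv.span (B0' \<union> (BG' - B0'))" using that BG' by (auto simp: Un_absorb1)
    then show ?thesis unfolding pv.span_Un by auto
  qed
  have th_span: "\<theta> ` pv.span (BG - B0) = pv.span (BG' - B0')"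
    using pp.linear_span_image[OF th(1), of "BG - B0"] th_img by simp
  have th_inj': "inj_on \<theta> (pv.span (BG - B0))"
    by (rule pp.linear_inj_on_span_independent_image[OF th(1)])
       (use th_img th_inj pv.independent_mono[OF BG'(3), of "BG' - B0'"] in auto)
  have th0: "\<theta> p = 0" if "p \<in> pv.span B0" for p
    by (rule pp.linear_eq_0_on_span[OF th(1) _ that]) (use th BG in auto)
  have spang': "pv.span (BG' - B0') \<subseteq> g'"
    using BG' subspace_g(2) pv.span_minimal[of "BG' - B0'" g'] by blast
  show ?thesis
  proof (intro exI[of _ \<theta>] conjI ballI)
    fix x assume x: "x \<in> g"
    then obtain p u where pu: "p \<in> pv.span B0" "u \<in> pv.span (BG - B0)" "x = p + u" using split by blast
    have xu: "\<theta> x = \<theta> u" using pu th0 by (simp add: pp.linear_add[OF th(1)])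
    show "\<theta> x \<in> g'" using xu th_span pu spang' by auto
    show "\<theta> x \<in> P' \<longleftrightarrow> x \<in> P"
    proof
      assume "x \<in> P"
      then have "x \<in> pv.span B0" using x span0 by auto
      then show "\<theta> x \<in> P'" using th0 sub(4) pv.subspace_0 by auto
    next
      assume "\<theta> x \<in> P'"
      then have "\<theta> u \<in> pv.span B0'" using \<open>\<theta> x \<in> g'\<close> xu B0' by auto
      moreover have "\<theta> u \<in> pv.span (BG' - B0')" using pu th_span by auto
      ultimately have "\<theta> u = 0"
        using span_disjoint_independent[of B0' "BG' - B0'" "\<theta> u"] BG' by (auto simp: Un_absorb1)
      then have "u = 0"
        using th_inj' pu(2) unfolding pp.linear_inj_on_iff_eq_0[OF th(1) pv.subspace_span] by auto
      then show "x \<in> P" using pu span0 by auto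
    qed
  next
    fix y assume "y \<in> g'"
    then obtain p u where pu: "p \<in> pv.span B0'" "u \<in> pv.span (BG' - B0')" "y = p + u" using split' by blast
    then obtain x where x: "x \<in> pv.span (BG - B0)" "u = \<theta> x" using th_span by auto
    have "x \<in> g" using x BG subspace_g(1) pv.span_minimal[of "BG - B0" g] by auto
    moreover have "y - \<theta> x \<in> P'" using pu x B0' by auto
    ultimately show "\<exists>x\<in>g. y - \<theta> x \<in> P'" by blast
  qed (rule th)
qed

end

section \<open>Graded connected bialgebras\<close>

subsection \<open>Coordinate functions as finitely supported vectors\<close>

text \<open>Meaningful only for finitely supported functions; \<open>lookup_pm\<close> therefore
  carries that condition.\<close>

definition pm :: "('b \<Rightarrow> 'k::field) \<Rightarrow> ('b \<Rightarrow>\<^sub>0 'k)" where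
  "pm v = Abs_poly_mapping v"

lemma lookup_pm: "fsupp v \<Longrightarrow> lookup (pm v) = v"
  by (simp add: pm_def fsupp_def supp_def)

lemma pm_lookup [simp]: "pm (lookup v) = v"
  by (simp add: pm_def lookup_inverse)

lemma fsupp_lookup [simp]: "fsupp (lookup v)"
  by (simp add: fsupp_def supp_def)

lemma supp_lookup: "supp (lookup v) = keys v"
  by (auto simp: supp_def in_keys_iff)

lemma sum_fun_apply: "(\<Sum>i\<in>I. f i) x = (\<Sum>i\<in>I. f i x)" for f :: "'i \<Rightarrow> 'a \<Rightarrow> 'b::comm_monoid_add"
  by (induction I rule: infinite_finite_induct) auto

lemma sum_lookup: "(\<Sum>i\<in>I. lookup (f i)) = lookup (\<Sum>i\<in>I. f i)"
  by (rule ext) (simp add: sum_fun_apply lookup_sum)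

lemma add_lookup: "lookup u + lookup v = lookup (u + v)"
  by (rule ext) (simp add: lookup_add)

lemma minus_lookup: "lookup u - lookup v = lookup (u - v)"
  by (rule ext) (simp add: lookup_minus fun_diff_def)

lemma zero_lookup: "0 = lookup 0"
  by (rule ext) simp

lemma lookup_inj: "lookup u = lookup v \<longleftrightarrow> u = v"
  by (rule poly_mapping_eq_iff[symmetric])

lemma scaleF_lookup: "scaleF c (lookup v) = lookup (psc c v)"
  by (rule ext) (simp add: scaleF_def)

lemma bas_lookup: "bas b = lookup (bs b)"
  by (rule ext) (simp add: bas_def lookup_single when_def)

lemma tens_lookup: "tens (lookup u) (lookup v) = lookup (tns u v)"
  by (rule ext) (auto simp: tens_def lookup_tns)

lemma lin_lookup: "lin (\<lambda>b. lookup (F b)) (lookup v) = lookup (pext F v)"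
  by (simp add: lin_def supp_lookup pext_def scaleF_lookup sum_lookup)

lemma lin_lookup':
  assumes "\<And>b. F b = lookup (G b)"
  shows "lin F (lookup v) = lookup (pext G v)"
proof -
  have "F = (\<lambda>b. lookup (G b))" using assms by auto
  then show ?thesis by (simp add: lin_lookup)
qed

subsection \<open>Structure maps\<close>

text \<open>\<open>Mu\<close>, \<open>unt\<close>, \<open>Dl\<close> are the product (as a map on \<open>H \<otimes> H\<close>), the unit and the coproduct; \<open>Rd\<close>
  projects \<open>H \<otimes> H\<close> onto \<open>H\<^sup>+ \<otimes> H\<^sup>+\<close> and \<open>Dr\<close> is the reduced coproduct.\<close>

definition Mu :: "('b, 'k::field) hopf_data \<Rightarrow> ('b \<times> 'b \<Rightarrow>\<^sub>0 'k) \<Rightarrow> ('b \<Rightarrow>\<^sub>0 'k)" where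
  "Mu H = pext (\<lambda>(a, b). pm (mu H a b))"

definition mul :: "('b, 'k::field) hopf_data \<Rightarrow> ('b \<Rightarrow>\<^sub>0 'k) \<Rightarrow> ('b \<Rightarrow>\<^sub>0 'k) \<Rightarrow> ('b \<Rightarrow>\<^sub>0 'k)" where
  "mul H u v = Mu H (tns u v)"

definition unt :: "('b, 'k::field) hopf_data \<Rightarrow> ('b \<Rightarrow>\<^sub>0 'k)" where
  "unt H = pm (one_vec H)"

definition Dl :: "('b, 'k::field) hopf_data \<Rightarrow> ('b \<Rightarrow>\<^sub>0 'k) \<Rightarrow> ('b \<times> 'b \<Rightarrow>\<^sub>0 'k)" where
  "Dl H = pext (\<lambda>a. pm (delta H a))"

definition tmulP :: "('b, 'k::field) hopf_data \<Rightarrow> ('b \<times> 'b \<Rightarrow>\<^sub>0 'k) \<Rightarrow> ('b \<times> 'b \<Rightarrow>\<^sub>0 'k) \<Rightarrow> ('b \<times> 'b \<Rightarrow>\<^sub>0 'k)" where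
  "tmulP H s t = pext (\<lambda>((x, y), (x', y')). tns (mul H (bs x) (bs x')) (mul H (bs y) (bs y'))) (tns s t)"

definition Rd :: "('b \<Rightarrow> nat) \<Rightarrow> ('b \<times> 'b \<Rightarrow>\<^sub>0 'k::field) \<Rightarrow> ('b \<times> 'b \<Rightarrow>\<^sub>0 'k)" where
  "Rd d = pres {(x, y). 0 < d x \<and> 0 < d y}"

definition Dr :: "('b, 'k::field) hopf_data \<Rightarrow> ('b \<Rightarrow>\<^sub>0 'k) \<Rightarrow> ('b \<times> 'b \<Rightarrow>\<^sub>0 'k)" where
  "Dr H v = Rd (deg H) (Dl H v)"

lemma plin_Mu [simp, intro]: "plin (Mu H)"
  by (simp add: Mu_def)

lemma plin_mul_left [simp, intro]: "plin (\<lambda>u. mul H u v)"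
  unfolding mul_def by (rule plin_comp[OF plin_Mu plin_tns_left])

lemma plin_mul_right [simp, intro]: "plin (mul H u)"
  unfolding mul_def[abs_def] by (rule plin_comp[OF plin_Mu plin_tns_right])

lemma plin_Dl [simp, intro]: "plin (Dl H)"
  by (simp add: Dl_def)

lemma plin_Rd [simp, intro]: "plin (Rd d)"
  by (simp add: Rd_def)

lemma plin_Dr [simp, intro]: "plin (Dr H)"
  unfolding Dr_def[abs_def] by (rule plin_comp) auto

lemma Rd_bs: "Rd d (bs (x, y)) = (if 0 < d x \<and> 0 < d y then bs (x, y) else 0)"
  by (simp add: Rd_def pres_bs)

lemma lookup_Rd: "lookup (Rd d t) (x, y) = (if 0 < d x \<and> 0 < d y then lookup t (x, y) else 0)"
  by (simp add: Rd_def lookup_pres)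

lemma plin_tmulP_left [simp, intro]: "plin (\<lambda>s. tmulP H s t)"
  unfolding tmulP_def by (rule plin_comp[OF plin_pext plin_tns_left])

lemma plin_tmulP_right [simp, intro]: "plin (tmulP H s)"
  unfolding tmulP_def[abs_def] by (rule plin_comp[OF plin_pext plin_tns_right])

lemma tmulP_bs: "tmulP H (bs (a, b)) (bs (c, d)) = tns (mul H (bs a) (bs c)) (mul H (bs b) (bs d))"
  by (simp add: tmulP_def)

lemma tmulP_tns: "tmulP H (tns x y) (tns x' y') = tns (mul H x x') (mul H y y')"
proof -
  have 1: "tmulP H (bs (a, b)) (tns x' y') = tns (mul H (bs a) x') (mul H (bs b) y')" for a b
    by (rule bilinear_eqI[of "\<lambda>x' y'. tmulP H (bs (a, b)) (tns x' y')" "\<lambda>x' y'. tns (mul H (bs a) x') (mul H (bs b) y')"])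
       (auto intro: plin_comp[OF plin_tmulP_right plin_tns_left] plin_comp[OF plin_tmulP_right plin_tns_right]
         plin_comp[OF plin_tns_left plin_mul_right] plin_comp[OF plin_tns_right plin_mul_right] simp: tmulP_bs)
  show ?thesis
    by (rule bilinear_eqI[of "\<lambda>x y. tmulP H (tns x y) (tns x' y')" "\<lambda>x y. tns (mul H x x') (mul H y y')"])
       (auto intro: plin_comp[OF plin_tmulP_left plin_tns_left] plin_comp[OF plin_tmulP_left plin_tns_right]
         plin_comp[OF plin_tns_left plin_mul_left] plin_comp[OF plin_tns_right plin_mul_left] simp: 1)
qed

lemma lookup_asc: "lookup (asc t) (x, y, z) = lookup t ((x, y), z)"
proof -
  have "lookup (asc t) (x, y, z) = (\<Sum>p\<in>keys t. if p = ((x, y), z) then lookup t p else 0)"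
    unfolding asc_def pext_def lookup_sum by (intro sum.cong) (auto simp: lookup_single)
  then show ?thesis by (auto simp: in_keys_iff)
qed

section \<open>The bialgebra axioms as identities between linear maps\<close>

locale gcb =
  fixes H :: "('b, 'k::field) hopf_data"
  assumes gch: "graded_connected_hopf H"
begin

abbreviation "dg \<equiv> deg H"
abbreviation "hd2 \<equiv> d2 dg dg"

lemmas gch_unfolded = gch[unfolded graded_connected_hopf_def]
lemmas gch_finite = gch_unfolded[THEN conjunct2, THEN conjunct2]
lemmas gch_degree = gch_finite[THEN conjunct2, THEN conjunct2, THEN conjunct2]
lemmas gch_algebra = gch_degree[THEN conjunct2, THEN conjunct2, THEN conjunct2, THEN conjunct2]
lemmas gch_compat = gch_algebra[THEN conjunct2, THEN conjunct2, THEN conjunct2, THEN conjunct2]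

lemma finite_degree: "finite {b. dg b = n}"
  and card_degree_0: "card {b. dg b = 0} = 1"
  using gch_unfolded[THEN conjunct1] gch_unfolded[THEN conjunct2, THEN conjunct1] by simp_all
lemma fsupp_mu: "fsupp (mu H a b)"
  and fsupp_one: "fsupp (one_vec H)"
  and fsupp_delta: "fsupp (delta H a)"
  using gch_finite[THEN conjunct1] gch_finite[THEN conjunct2, THEN conjunct1] gch_finite[THEN conjunct2, THEN
      conjunct2, THEN conjunct1] by simp_all
lemma mu_degree: "mu H a b c \<noteq> 0 \<Longrightarrow> dg c = dg a + dg b"
  and one_degree: "one_vec H c \<noteq> 0 \<Longrightarrow> dg c = 0"
  and delta_degree: "delta H a (x, y) \<noteq> 0 \<Longrightarrow> dg x + dg y = dg a"
  and counit_degree: "counit H a \<noteq> 0 \<Longrightarrow> dg a = 0"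
  using gch_degree[THEN conjunct1] gch_degree[THEN conjunct2, THEN conjunct1] gch_degree[THEN conjunct2, THEN
      conjunct2, THEN conjunct1] gch_degree[THEN conjunct2, THEN conjunct2, THEN conjunct2, THEN conjunct1] by simp_all

lemma hmul_assoc: "hmul H (hmul H (bas a) (bas b)) (bas c) = hmul H (bas a) (hmul H (bas b) (bas c))"
  and hmul_one: "hmul H (one_vec H) (bas a) = bas a" "hmul H (bas a) (one_vec H) = bas a"
  and delta_coassoc: "lin (tmap (delta H) bas) (delta H a) ((x, y), z) = lin (tmap bas (delta H)) (delta H a) (x, (y, z))"
  and delta_counit: "lin (\<lambda>(x, y). scaleF (counit H x) (bas y)) (delta H a) = bas a"
    "lin (\<lambda>(x, y). scaleF (counit H y) (bas x)) (delta H a) = bas a"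
  using gch_algebra[THEN conjunct1] gch_algebra[THEN conjunct2, THEN conjunct1] gch_algebra[THEN conjunct2, THEN
      conjunct2, THEN conjunct1] gch_algebra[THEN conjunct2, THEN conjunct2, THEN conjunct2, THEN conjunct1]
      by (simp_all only:)
lemma hDelta_hmul: "hDelta H (hmul H (bas a) (bas b)) = tmul H (delta H a) (delta H b)"
  and hDelta_one: "hDelta H (one_vec H) = tens (one_vec H) (one_vec H)"
  and hcounit_one: "hcounit H (one_vec H) = 1"
  using gch_compat[THEN conjunct1] gch_compat[THEN conjunct2, THEN conjunct1] gch_compat[THEN conjunct2, THEN
      conjunct2,THEN conjunct2, THEN conjunct1] by (simp_all only:)

lemma mu_lookup: "mu H a b = lookup (Mu H (bs (a, b)))"
  by (simp add: Mu_def lookup_pm[OF fsupp_mu])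

lemma delta_lookup: "delta H a = lookup (Dl H (bs a))"
  by (simp add: Dl_def lookup_pm[OF fsupp_delta])

lemma one_lookup: "one_vec H = lookup (unt H)"
  by (simp add: unt_def lookup_pm[OF fsupp_one])

lemma hmul_lookup: "hmul H (lookup u) (lookup v) = lookup (mul H u v)"
  unfolding hmul_def mul_def Mu_def tens_lookup
  by (rule lin_lookup') (auto simp: lookup_pm[OF fsupp_mu])

lemma hDelta_lookup: "hDelta H (lookup v) = lookup (Dl H v)"
  unfolding hDelta_def Dl_def
  by (rule lin_lookup') (auto simp: lookup_pm[OF fsupp_delta])

lemma tmul_lookup: "tmul H (lookup s) (lookup t) = lookup (tmulP H s t)"
  unfolding tmul_def tmulP_def tens_lookup
  by (rule lin_lookup') (auto simp: mu_lookup mul_def tens_lookup)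

lemma mul_assoc_bs: "mul H (mul H (bs a) (bs b)) (bs c) = mul H (bs a) (mul H (bs b) (bs c))"
  using hmul_assoc[of a b c] by (simp add: bas_lookup hmul_lookup lookup_inj)

lemma mul_assoc: "mul H (mul H u v) w = mul H u (mul H v w)"
proof -
  have 1: "mul H (mul H u v) (bs c) = mul H u (mul H v (bs c))" for c
  proof (rule bilinear_eqI[of "\<lambda>u v. mul H (mul H u v) (bs c)" "\<lambda>u v. mul H u (mul H v (bs c))"])
    show "plin (\<lambda>u. mul H (mul H u v) (bs c))" for v
      by (rule plin_comp[OF plin_mul_left plin_mul_left])
    show "plin (\<lambda>v. mul H (mul H u v) (bs c))" for u
      by (rule plin_comp[OF plin_mul_left plin_mul_right])
    show "plin (\<lambda>v. mul H u (mul H v (bs c)))" for u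
      by (rule plin_comp[OF plin_mul_right plin_mul_left])
  qed (auto simp: mul_assoc_bs)
  show ?thesis
    by (rule plin_eqI[of "\<lambda>w. mul H (mul H u v) w" "\<lambda>w. mul H u (mul H v w)"])
       (auto simp: 1 intro: plin_comp[OF plin_mul_right plin_mul_right])
qed

lemma mul_unt [simp]: "mul H (unt H) v = v" "mul H v (unt H) = v"
proof -
  have "mul H (unt H) (bs a) = bs a" "mul H (bs a) (unt H) = bs a" for a
    using hmul_one[of a] by (simp_all add: bas_lookup one_lookup hmul_lookup lookup_inj)
  then show "mul H (unt H) v = v" "mul H v (unt H) = v"
    using plin_eqI[OF plin_mul_right plin_id(1), of v H "unt H"]
      plin_eqI[OF plin_mul_left plin_id(1), of v H "unt H"] by simp_all
qed

lemma Mu_bs_hm: "Mu H (bs (a, b)) \<in> hm dg (dg a + dg b)"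
  using mu_degree by (auto simp: hm_def in_keys_iff mu_lookup[symmetric])

lemma Mu_pair_hm: "hd2 p = n \<Longrightarrow> Mu H (bs p) \<in> hm dg n"
  by (cases p) (use Mu_bs_hm in auto)

lemma mul_hm:
  assumes "u \<in> hm dg i" "v \<in> hm dg j" shows "mul H u v \<in> hm dg (i + j)"
  unfolding mul_def
  by (rule plin_hm[OF plin_Mu tns_hm[OF assms] Mu_pair_hm])

lemma unt_hm [simp]: "unt H \<in> hm dg 0"
  using one_degree by (auto simp: hm_def in_keys_iff one_lookup[symmetric])

lemma Dl_bs_hm: "Dl H (bs a) \<in> hm hd2 (dg a)"
  using delta_degree by (auto simp: hm_def in_keys_iff delta_lookup[symmetric])

lemma Dl_hm: "v \<in> hm dg n \<Longrightarrow> Dl H v \<in> hm hd2 n"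
  by (rule plin_hm[OF plin_Dl, of v dg n]) (use Dl_bs_hm in auto)

lemma Rd_hm: "t \<in> hm hd2 n \<Longrightarrow> Rd dg t \<in> hm hd2 n"
  by (auto simp: Rd_def hm_def keys_pres)

lemma Dr_hm: "v \<in> hm dg n \<Longrightarrow> Dr H v \<in> hm hd2 n"
  unfolding Dr_def by (intro Rd_hm Dl_hm)

lemma Dl_unt: "Dl H (unt H) = tns (unt H) (unt H)"
  using hDelta_one by (simp add: one_lookup hDelta_lookup tens_lookup lookup_inj)

lemma Dl_mul: "Dl H (mul H u v) = tmulP H (Dl H u) (Dl H v)"
proof (rule bilinear_eqI[of "\<lambda>u v. Dl H (mul H u v)" "\<lambda>u v. tmulP H (Dl H u) (Dl H v)"])
  fix a b
  show "Dl H (mul H (bs a) (bs b)) = tmulP H (Dl H (bs a)) (Dl H (bs b))"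
    using hDelta_hmul[of a b] by (simp add: bas_lookup hmul_lookup hDelta_lookup delta_lookup tmul_lookup lookup_inj)
qed (auto intro: plin_comp[OF plin_Dl plin_mul_left] plin_comp[OF plin_Dl plin_mul_right]
      plin_comp[OF plin_tmulP_left plin_Dl] plin_comp[OF plin_tmulP_right plin_Dl])

lemma Dl_coassoc: "asc (tm (Dl H) (\<lambda>x. x) (Dl H v)) = tm (\<lambda>x. x) (Dl H) (Dl H v)"
proof (rule plin_eqI[of "\<lambda>v. asc (tm (Dl H) (\<lambda>x. x) (Dl H v))" "\<lambda>v. tm (\<lambda>x. x) (Dl H) (Dl H v)"])
  fix a
  have 1: "tmap (delta H) bas = (\<lambda>p. lookup (case p of (a, b) \<Rightarrow> tns (Dl H (bs a)) (bs b)))"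
    "tmap bas (delta H) = (\<lambda>p. lookup (case p of (a, b) \<Rightarrow> tns (bs a) (Dl H (bs b))))"
    by (auto simp: tmap_def delta_lookup bas_lookup tens_lookup fun_eq_iff)
  show "asc (tm (Dl H) (\<lambda>x. x) (Dl H (bs a))) = tm (\<lambda>x. x) (Dl H) (Dl H (bs a))"
  proof (rule poly_mapping_eqI)
    fix p :: "'b \<times> 'b \<times> 'b"
    obtain x y z where p: "p = (x, y, z)" by (metis surj_pair)
    show "lookup (asc (tm (Dl H) (\<lambda>x. x) (Dl H (bs a)))) p = lookup (tm (\<lambda>x. x) (Dl H) (Dl H (bs a))) p"
      using delta_coassoc[of a x y z]
      unfolding p 1 delta_lookup lin_lookup by (simp add: lookup_asc tm_def)
  qed
qed (auto intro: plin_comp[OF plin_asc plin_comp[OF plin_tm plin_Dl]] plin_comp[OF plin_tm plin_Dl])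

lemma degree_0: obtains b0 where "\<And>b. dg b = 0 \<longleftrightarrow> b = b0"
  using card_degree_0 by (auto simp: card_1_singleton_iff set_eq_iff)

text \<open>The chosen basis is arbitrary, so its only vector of degree 0 need not be the unit. It
  is a scalar multiple of it, and the normalisation of the counit at the unit determines the
  scalar.\<close>

lemma unit_coordinate:
  assumes b0: "\<And>b. dg b = 0 \<longleftrightarrow> b = b0"
  shows "counit H b0 * lookup (unt H) b0 = 1" "unt H = psc (lookup (unt H) b0) (bs b0)"
proof -
  note d = b0
  have k: "keys (unt H) \<subseteq> {b0}" using hmD[OF unt_hm] d by blast
  have "1 = (\<Sum>b\<in>keys (unt H). lookup (unt H) b * counit H b)"
    using hcounit_one by (simp add: hcounit_def lfun_def one_lookup supp_lookup)
  also have "\<dots> = (\<Sum>b\<in>{b0}. lookup (unt H) b * counit H b)"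
    by (rule sum.mono_neutral_left) (use k in \<open>auto simp: in_keys_iff\<close>)
  finally show "counit H b0 * lookup (unt H) b0 = 1" by (simp add: mult.commute)
  show "unt H = psc (lookup (unt H) b0) (bs b0)"
    by (rule poly_mapping_eqI) (use k in \<open>auto simp: lookup_single in_keys_iff when_def\<close>)
qed

lemma bs_degree_0: assumes "dg b = 0" shows "bs b = psc (counit H b) (unt H)"
proof -
  obtain b0 where b0: "\<And>b. dg b = 0 \<longleftrightarrow> b = b0" using degree_0 by metis
  have "bs b0 = psc (counit H b0) (unt H)"
    by (subst unit_coordinate(2)[OF b0]) (simp add: unit_coordinate(1)[OF b0])
  then show ?thesis using b0 assms by auto
qed

lemma hm_0: assumes "v \<in> hm dg 0" shows "\<exists>c. v = psc c (unt H)"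
proof -
  have "pv.subspace (range (\<lambda>c. psc c (unt H)))"
    unfolding pv.span_singleton[symmetric] by (rule pv.subspace_span)
  then have "v \<in> range (\<lambda>c. psc c (unt H))"
    by (rule mem_subspace_of_bs) (use hmD[OF assms] bs_degree_0 in blast)
  then show ?thesis by blast
qed

lemma unt_neq_0: "unt H \<noteq> 0"
proof
  assume 0: "unt H = 0"
  obtain b0 where b0: "\<And>b. dg b = 0 \<longleftrightarrow> b = b0" using degree_0 by metis
  show False using unit_coordinate(1)[OF b0] 0 by simp
qed

text \<open>The two counit axioms determine the coefficients of the coproduct at pairs with one
  factor in degree 0, because the counit vanishes on all basis vectors other than \<open>b0\<close>.
  The coefficient at \<open>(b0, b0)\<close> is 0, since \<open>a\<close> differs from
  \<open>b0\<close>.\<close>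

lemma Dl_split_bs:
  assumes a: "0 < dg a"
  shows "Dl H (bs a) = tns (bs a) (unt H) + tns (unt H) (bs a) + Dr H (bs a)"
proof -
  obtain b0 where b0: "\<And>b. dg b = 0 \<longleftrightarrow> b = b0" using degree_0 by metis
  note d = b0
  have ab: "a \<noteq> b0" using a d[of a] by simp
  define T where "T = Dl H (bs a)"
  have c: "counit H x \<noteq> 0 \<Longrightarrow> x = b0" for x
    using counit_degree[of x] d[of x] by auto
  have 1: "bas a = lookup (pext (\<lambda>(x, y). psc (counit H x) (bs y)) T)"
    using lin_lookup'[of "\<lambda>(x, y). scaleF (counit H x) (bas y)" "\<lambda>(x, y). psc (counit H x) (bs y)" T]
      delta_counit(1)[of a] by (auto simp: T_def delta_lookup scaleF_lookup bas_lookup)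
  have 2: "bas a = lookup (pext (\<lambda>(x, y). psc (counit H y) (bs x)) T)"
    using lin_lookup'[of "\<lambda>(x, y). scaleF (counit H y) (bas x)" "\<lambda>(x, y). psc (counit H y) (bs x)" T]
      delta_counit(2)[of a] by (auto simp: T_def delta_lookup scaleF_lookup bas_lookup)
  have "lookup (pext (\<lambda>(x, y). psc (counit H x) (bs y)) T) y
      = (\<Sum>p\<in>keys T. if p = (b0, y) then lookup T p * counit H b0 else 0)" for y
    unfolding pext_def lookup_sum
    by (intro sum.cong) (auto simp: lookup_single when_def split: if_splits dest: c)
  then have l: "lookup (bs a) y = lookup T (b0, y) * counit H b0" for y
    using 1 by (auto simp: bas_lookup in_keys_iff)
  have "lookup (pext (\<lambda>(x, y). psc (counit H y) (bs x)) T) x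
      = (\<Sum>p\<in>keys T. if p = (x, b0) then lookup T p * counit H b0 else 0)" for x
    unfolding pext_def lookup_sum
    by (intro sum.cong) (auto simp: lookup_single when_def split: if_splits dest: c)
  then have r: "lookup (bs a) x = lookup T (x, b0) * counit H b0" for x
    using 2 by (auto simp: bas_lookup in_keys_iff)
  define k0 where "k0 = lookup (unt H) b0"
  have k0: "lookup (unt H) x = (if x = b0 then k0 else 0)" for x
    using hmD[OF unt_hm, of x] d by (auto simp: k0_def in_keys_iff)
  have co: "counit H b0 * k0 = 1" using unit_coordinate(1)[OF b0] by (simp add: k0_def)
  \<comment> \<open>\<open>k0\<close> is inverse to the counit of \<open>b0\<close>; this solves
    \<open>l\<close> and \<open>r\<close> for the coefficients of \<open>T\<close>.\<close>
  have kc: "k0 * (t * counit H b0) = t" for t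
  proof -
    have "k0 * (t * counit H b0) = t * (counit H b0 * k0)" by (simp add: ac_simps)
    then show ?thesis by (simp add: co)
  qed
  have l': "lookup T (b0, y) = k0 * lookup (bs a) y" for y by (simp only: l kc)
  have r': "lookup T (x, b0) = k0 * lookup (bs a) x" for x by (simp only: r kc)
  show ?thesis
  proof (rule poly_mapping_eqI)
    fix p :: "'b \<times> 'b"
    obtain x y where p: "p = (x, y)" by (cases p)
    have "lookup T (x, y) = lookup (bs a) x * lookup (unt H) y + lookup (unt H) x * lookup (bs a) y
       + (if 0 < dg x \<and> 0 < dg y then lookup T (x, y) else 0)"
      using d[of x] d[of y] l'[of y] r'[of x] ab
      by (cases "x = b0"; cases "y = b0") (auto simp: k0 lookup_single_not_eq mult.commute)
    then show "lookup (Dl H (bs a)) p = lookup (tns (bs a) (unt H) + tns (unt H) (bs a) + Dr H (bs a)) p"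
      by (simp add: p lookup_add lookup_tns Dr_def Rd_def lookup_pres flip: T_def)
  qed
qed

lemma Dl_split:
  assumes "v \<in> hm dg n" "0 < n"
  shows "Dl H v = tns v (unt H) + tns (unt H) v + Dr H v"
proof (rule plin_eq_hm[OF _ _ assms(1), of "Dl H" "\<lambda>v. tns v (unt H) + tns (unt H) v + Dr H v"])
  show "plin (\<lambda>v. tns v (unt H) + tns (unt H) v + Dr H v)"
    by (rule plin_add[OF plin_add[OF plin_tns_left plin_tns_right] plin_Dr])
qed (use assms(2) Dl_split_bs in simp_all)

text \<open>Coassociativity of \<open>Dl\<close>, projected to triples of positive degree.\<close>

lemma Dr_coassoc: "asc (tm (Dr H) (\<lambda>x. x) (Dr H v)) = tm (\<lambda>x. x) (Dr H) (Dr H v)"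
proof -
  define S where "S = {((x, y), z). 0 < dg x \<and> 0 < dg y \<and> 0 < dg z}"
  define S' where "S' = {(x, y, z). 0 < dg x \<and> 0 < dg y \<and> 0 < dg z}"
  \<comment> \<open>The coproduct of a degree 0 vector has no component of positive degree. Hence
    projecting the outer factors beforehand gives the same as projecting all three factors at the
    end.\<close>
  have zero: "dg x = 0 \<Longrightarrow> 0 < dg a \<Longrightarrow> lookup (Dl H (bs x)) (a, b) = 0" for a b x
    using hmD[OF Dl_bs_hm[of x], of "(a, b)"] by (auto simp: in_keys_iff)
  have 1: "tm (Dr H) (\<lambda>x. x) (Rd dg T) = pres S (tm (Dl H) (\<lambda>x. x) T)" for T
  proof (rule plin_eqI[of "\<lambda>T. tm (Dr H) (\<lambda>x. x) (Rd dg T)" "\<lambda>T. pres S (tm (Dl H) (\<lambda>x. x) T)"])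
    fix p :: "'b \<times> 'b"
    obtain x y where p: "p = (x, y)" by (cases p)
    have "lookup (tm (Dr H) (\<lambda>x. x) (Rd dg (bs (x, y)))) q = lookup (pres S (tns (Dl H (bs x)) (bs y))) q" for q
      by (cases q) (auto simp: zero Rd_bs lookup_pres lookup_tns Dr_def lookup_Rd S_def lookup_single when_def
          pp.linear_0[OF plin_tm] split: if_splits)
    then show "tm (Dr H) (\<lambda>x. x) (Rd dg (bs p)) = pres S (tm (Dl H) (\<lambda>x. x) (bs p))"
      by (simp add: p poly_mapping_eqI)
  qed (auto intro: plin_comp)
  have 2: "tm (\<lambda>x. x) (Dr H) (Rd dg T) = pres S' (tm (\<lambda>x. x) (Dl H) T)" for T
  proof (rule plin_eqI[of "\<lambda>T. tm (\<lambda>x. x) (Dr H) (Rd dg T)" "\<lambda>T. pres S' (tm (\<lambda>x. x) (Dl H) T)"])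
    fix p :: "'b \<times> 'b"
    obtain x y where p: "p = (x, y)" by (cases p)
    have "lookup (tm (\<lambda>x. x) (Dr H) (Rd dg (bs (x, y)))) q = lookup (pres S' (tns (bs x) (Dl H (bs y)))) q" for q
      by (cases q) (auto simp: zero Rd_bs lookup_pres lookup_tns Dr_def lookup_Rd S'_def lookup_single when_def
          pp.linear_0[OF plin_tm] split: if_splits)
    then show "tm (\<lambda>x. x) (Dr H) (Rd dg (bs p)) = pres S' (tm (\<lambda>x. x) (Dl H) (bs p))"
      by (simp add: p poly_mapping_eqI)
  qed (auto intro: plin_comp)
  have 3: "asc (pres S t) = pres S' (asc t)" for t :: "('b \<times> 'b) \<times> 'b \<Rightarrow>\<^sub>0 'k"
    by (rule poly_mapping_eqI) (auto simp: lookup_pres lookup_asc S_def S'_def split: if_splits)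
  show ?thesis
    unfolding Dr_def[of H v] 1 2 3 Dl_coassoc ..
qed

end

section \<open>Freeness and cofreeness\<close>

text \<open>Bases are defined as families, while the vector space library speaks of sets;
  injectivity of the family makes up the difference.\<close>

lemma basis_fam_pm:
  fixes e :: "'i \<Rightarrow> 'b \<Rightarrow> 'k::field" and p :: "'i \<Rightarrow> ('b \<Rightarrow>\<^sub>0 'k)"
  assumes bas: "basis_fam e I" and e: "\<And>i. i \<in> I \<Longrightarrow> e i = lookup (p i)"
  shows basis_fam_inj: "inj_on p I" and basis_fam_independent: "pv.independent (p ` I)"
    and basis_fam_span: "pv.span (p ` I) = UNIV"
proof -
  have conv: "(\<Sum>i\<in>F. scaleF (c i) (e i)) = lookup (\<Sum>i\<in>F. psc (c i) (p i))" if "F \<subseteq> I" for F c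
  proof -
    have "(\<Sum>i\<in>F. scaleF (c i) (e i)) = (\<Sum>i\<in>F. lookup (psc (c i) (p i)))"
      by (rule sum.cong) (use that e in \<open>auto simp: scaleF_lookup\<close>)
    then show ?thesis by (simp add: sum_lookup)
  qed
  have ind: "c i = 0" if "finite F" "F \<subseteq> I" "(\<Sum>i\<in>F. psc (c i) (p i)) = 0" "i \<in> F" for F c i
  proof -
    have "(\<Sum>i\<in>F. scaleF (c i) (e i)) = 0"
      unfolding conv[OF that(2)] that(3) by (simp add: zero_lookup)
    then show ?thesis
      using bas that unfolding basis_fam_def lin_indep_fam_def by blast
  qed
  show inj: "inj_on p I"
  proof (rule inj_onI, rule ccontr)
    fix i j assume ij: "i \<in> I" "j \<in> I" "p i = p j" "i \<noteq> j"
    \<comment> \<open>Two equal members would satisfy a relation with coefficients 1 and -1.\<close>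
    have "(1::'k) = 0"
      using ind[of "{i, j}" "\<lambda>k. if k = i then 1 else - 1" i] ij by simp
    then show False by simp
  qed
  show "pv.independent (p ` I)"
    unfolding pv.dependent_explicit
  proof safe
    fix t u v assume t: "finite t" "t \<subseteq> p ` I" "(\<Sum>v\<in>t. psc (u v) v) = 0" "v \<in> t" "u v \<noteq> 0"
    obtain F where F: "F \<subseteq> I" "t = p ` F" using t(2) by (meson subset_image_iff)
    have injF: "inj_on p F" using inj F(1) inj_on_subset by blast
    obtain i where i: "i \<in> F" "v = p i" using t(4) F by blast
    have "finite F" using t(1) F injF finite_image_iff by blast
    moreover have "(\<Sum>i\<in>F. psc (u (p i)) (p i)) = 0"
      using t(3) unfolding F(2) sum.reindex[OF injF] by simp
    ultimately show False using ind[of F "\<lambda>i. u (p i)" i] F i t(5) by auto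
  qed
  show "pv.span (p ` I) = UNIV"
  proof (intro equalityI subsetI UNIV_I)
    fix v :: "'b \<Rightarrow>\<^sub>0 'k"
    have "fsupp (lookup v)" by simp
    then obtain F c where F: "finite F" "F \<subseteq> I" "lookup v = (\<Sum>i\<in>F. scaleF (c i) (e i))"
      using bas unfolding basis_fam_def spans_H_def by blast
    then have "v = (\<Sum>i\<in>F. psc (c i) (p i))" unfolding conv[OF F(2)] by (simp add: lookup_inj)
    then show "v \<in> pv.span (p ` I)"
      using F(2) by (simp only:) (intro pv.span_sum pv.span_scale pv.span_base, auto)
  qed
qed

lemma indexed_basis_extend:
  fixes p :: "'i \<Rightarrow> ('b \<Rightarrow>\<^sub>0 'k::field)" and g :: "'i \<Rightarrow> ('c \<Rightarrow>\<^sub>0 'k)"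
  assumes "inj_on p I" "pv.independent (p ` I)"
  shows "\<exists>f. plin f \<and> (\<forall>i\<in>I. f (p i) = g i)"
  using pp.linear_independent_extend[OF assms(2), of "\<lambda>x. g (inv_into I p x)"] assms(1) by auto

text \<open>The projection to degree n fixes \<open>v\<close> and either fixes or kills each basis
  vector.\<close>

lemma homogeneous_span:
  fixes p :: "'i \<Rightarrow> ('b \<Rightarrow>\<^sub>0 'k::field)"
  assumes "pv.span (p ` I) = UNIV" "\<And>i. i \<in> I \<Longrightarrow> p i \<in> hm d (\<delta> i)" "v \<in> hm d n"
  shows "v \<in> pv.span (p ` {i\<in>I. \<delta> i = n})"
proof -
  have "hpart d n v \<in> pv.span (hpart d n ` p ` I)"
    unfolding pp.linear_span_image[OF plin_hpart] assms(1) by blast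
  moreover have "hpart d n ` p ` I \<subseteq> pv.span (p ` {i\<in>I. \<delta> i = n})"
  proof safe
    fix i assume "i \<in> I"
    then show "hpart d n (p i) \<in> pv.span (p ` {i\<in>I. \<delta> i = n})"
      by (cases "\<delta> i = n") (simp_all add: hpart_of_hm[OF assms(2)] pv.span_zero pv.span_base)
  qed
  ultimately have "hpart d n v \<in> pv.span (p ` {i\<in>I. \<delta> i = n})"
    using pv.span_minimal[OF _ pv.subspace_span] by blast
  then show ?thesis using hpart_of_hm[OF assms(3)] by simp
qed

lemma tns_span:
  assumes "x \<in> pv.span A" "y \<in> pv.span B"
  shows "tns x y \<in> pv.span {tns a b |a b. a \<in> A \<and> b \<in> B}"
proof -
  let ?T = "{tns a b |a b. a \<in> A \<and> b \<in> B}"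
  have 1: "tns a y \<in> pv.span ?T" if "a \<in> A" for a
  proof -
    have "tns a y \<in> pv.span (tns a ` B)"
      unfolding pp.linear_span_image[OF plin_tns_right] using assms(2) by blast
    also have "pv.span (tns a ` B) \<subseteq> pv.span ?T" by (rule pv.span_mono) (use that in auto)
    finally show ?thesis .
  qed
  have "tns x y \<in> pv.span ((\<lambda>x. tns x y) ` A)"
    unfolding pp.linear_span_image[OF plin_tns_left] using assms(1) by blast
  also have "\<dots> \<subseteq> pv.span ?T"
    by (rule pv.span_minimal) (use 1 in auto)
  finally show ?thesis .
qed

lemma hom_lookup: "lookup v \<in> hom H n \<longleftrightarrow> v \<in> hm (deg H) n"
  by (auto simp: hom_def hm_def in_keys_iff)

definition asc' :: "('a \<times> 'b \<times> 'c \<Rightarrow>\<^sub>0 'k::field) \<Rightarrow> (('a \<times> 'b) \<times> 'c \<Rightarrow>\<^sub>0 'k)" where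
  "asc' = pext (\<lambda>(a, b, c). bs ((a, b), c))"

lemma plin_asc' [simp, intro]: "plin asc'"
  by (simp add: asc'_def)

lemma asc'_asc: "asc' (asc t) = t"
  by (rule plin_eqI[of "\<lambda>t. asc' (asc t)" "\<lambda>t. t"])
     (auto simp: asc'_def asc_def intro: plin_comp[OF plin_pext plin_pext])

lemma asc'_tns [simp]: "asc' (tns u (tns v w)) = tns (tns u v) w"
  using asc'_asc[of "tns (tns u v) w"] by simp

lemma Rd_tns:
  assumes "u \<in> hm d i" "v \<in> hm d j"
  shows "Rd d (tns u v) = (if 0 < i \<and> 0 < j then tns u v else 0)"
  using assms by (auto simp: Rd_def keys_tns hm_def intro!: pres_ident pres_zero)

context gcb
begin

lemma balanced_homogeneous:
  fixes \<beta> :: "('b \<times> 'b \<Rightarrow>\<^sub>0 'k) \<Rightarrow> ('c \<Rightarrow>\<^sub>0 'k)"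
  assumes \<beta>: "plin \<beta>"
    and bal: "\<And>a b c. \<lbrakk>0 < dg a; 0 < dg b; 0 < dg c; dg a + dg b + dg c = n\<rbrakk>
       \<Longrightarrow> \<beta> (tns (mul H (bs a) (bs b)) (bs c)) = \<beta> (tns (bs a) (mul H (bs b) (bs c)))"
    and h: "u \<in> hm dg i" "v \<in> hm dg j" "w \<in> hm dg k" "0 < i" "0 < j" "0 < k" "i + j + k = n"
  shows "\<beta> (tns (mul H u v) w) = \<beta> (tns u (mul H v w))"
proof -
  have l: "plin (\<lambda>w. \<beta> (tns (mul H u v) w))" "plin (\<lambda>w. \<beta> (tns u (mul H v w)))"
    "plin (\<lambda>u. \<beta> (tns (mul H u v) w))" "plin (\<lambda>u. \<beta> (tns u (mul H v w)))"
    "plin (\<lambda>v. \<beta> (tns (mul H u v) w))" "plin (\<lambda>v. \<beta> (tns u (mul H v w)))" for u v w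
    by (rule plin_comp[OF \<beta>], (rule plin_tns_right plin_tns_left plin_comp[OF plin_tns_right] plin_comp[OF plin_tns_left]
       plin_mul_left plin_mul_right)+)+
  have "\<beta> (tns (mul H u v) (bs c)) = \<beta> (tns u (mul H v (bs c)))" if c: "c \<in> keys w" for c
  proof (rule bilinear_eqI[of "\<lambda>u v. \<beta> (tns (mul H u v) (bs c))" "\<lambda>u v. \<beta> (tns u (mul H v (bs c)))"])
    fix a b assume "a \<in> keys u" "b \<in> keys v"
    then have "dg a = i" "dg b = j" "dg c = k" using h c hmD by auto
    then show "\<beta> (tns (mul H (bs a) (bs b)) (bs c)) = \<beta> (tns (bs a) (mul H (bs b) (bs c)))"
      using bal[of a b c] h by simp
  qed (rule l)+
  then show ?thesis
    by (rule plin_eqI[OF l(1,2)])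
qed

end

section \<open>Free algebras: balanced maps\<close>

locale free_gcb = gcb H for H :: "('b, 'k::field) hopf_data" +
  assumes free: "free_hopf H"
begin

lemma free_generators:
  obtains X and \<delta> :: "('b \<Rightarrow> 'k) \<Rightarrow> nat" and P :: "('b \<Rightarrow> 'k) list \<Rightarrow> ('b \<Rightarrow>\<^sub>0 'k)" where
    "\<And>w. P w = foldr (mul H) (map pm w) (unt H)"
    "\<And>x. x \<in> X \<Longrightarrow> pm x \<in> hm dg (\<delta> x)" "\<And>x. x \<in> X \<Longrightarrow> 0 < \<delta> x"
    "inj_on P (lists X)" "pv.independent (P ` lists X)" "pv.span (P ` lists X) = UNIV"
proof -
  obtain X where X: "\<forall>x\<in>X. \<exists>n. x \<in> hom H n" "basis_fam (\<lambda>w. foldr (hmul H) w (one_vec H)) (lists X)"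
    using free unfolding free_hopf_def by blast
  then obtain \<delta> where \<delta>: "\<And>x. x \<in> X \<Longrightarrow> x \<in> hom H (\<delta> x)" by metis
  have lpm: "lookup (pm x) = x" if "x \<in> X" for x
    using \<delta>[OF that] by (intro lookup_pm) (simp add: hom_def)
  have hpm: "pm x \<in> hm dg (\<delta> x)" if "x \<in> X" for x
    using \<delta>[OF that] lpm[OF that] hom_lookup by metis
  define P where "P w = foldr (mul H) (map pm w) (unt H)" for w :: "('b \<Rightarrow> 'k) list"
  have eP: "foldr (hmul H) w (one_vec H) = lookup (P w)" if "w \<in> lists X" for w
    using that
  proof (induction w)
    case (Cons x w)
    then show ?case using hmul_lookup[of "pm x" "P w"] lpm by (simp add: P_def)
  qed (simp add: P_def one_lookup)
  note B = basis_fam_inj[OF X(2) eP] basis_fam_independent[OF X(2) eP] basis_fam_span[OF X(2) eP]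
  \<comment> \<open>Freeness as defined does not by itself exclude generators of degree 0. Such a
    generator would be a multiple of the unit, so the words \<open>[x]\<close> and \<open>[]\<close>
    would have dependent products.\<close>
  have pos: "0 < \<delta> x" if x: "x \<in> X" for x
  proof (rule ccontr)
    assume "\<not> 0 < \<delta> x"
    then obtain c where c: "pm x = psc c (unt H)" using hm_0 hpm[OF x] by auto
    obtain f where f: "plin f" "\<forall>w\<in>lists X. f (P w) = (if w = [x] then unt H else 0)"
      using indexed_basis_extend[OF B(1,2), of "\<lambda>w. if w = [x] then unt H else 0"] by blast
    have "f (P [x]) = psc c (f (P []))" by (simp add: P_def c pp.linear_scale[OF f(1)])
    then show False using f(2) x unt_neq_0 by auto
  qed
  show ?thesis by (rule that[OF P_def hpm pos B])
qed

text \<open>The augmentation ideal of a free algebra is a free module, so a balanced map on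
  \<open>H\<^sup>+ \<otimes> H\<^sup>+\<close> factors through the multiplication.\<close>

lemma balanced_factors_through_mul:
  fixes \<beta> :: "('b \<times> 'b \<Rightarrow>\<^sub>0 'k) \<Rightarrow> ('c \<Rightarrow>\<^sub>0 'k)"
  assumes \<beta>: "plin \<beta>"
    and bal: "\<And>a b c. \<lbrakk>0 < dg a; 0 < dg b; 0 < dg c; dg a + dg b + dg c = n\<rbrakk>
       \<Longrightarrow> \<beta> (tns (mul H (bs a) (bs b)) (bs c)) = \<beta> (tns (bs a) (mul H (bs b) (bs c)))"
  shows "\<exists>f. plin f \<and> (\<forall>a b. 0 < dg a \<longrightarrow> 0 < dg b \<longrightarrow> dg a + dg b = n \<longrightarrow> f (mul H (bs a) (bs b)) = \<beta> (bs (a, b)))"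
proof -
  obtain X and \<delta> :: "('b \<Rightarrow> 'k) \<Rightarrow> nat" and P :: "('b \<Rightarrow> 'k) list \<Rightarrow> ('b \<Rightarrow>\<^sub>0 'k)" where
    P: "\<And>w. P w = foldr (mul H) (map pm w) (unt H)"
    and X: "\<And>x. x \<in> X \<Longrightarrow> pm x \<in> hm dg (\<delta> x)" "\<And>x. x \<in> X \<Longrightarrow> 0 < \<delta> x"
    and B: "inj_on P (lists X)" "pv.independent (P ` lists X)" "pv.span (P ` lists X) = UNIV"
    using free_generators by metis
  have P_simps: "P [] = unt H" "P (x # w) = mul H (pm x) (P w)" "P [x] = pm x" for x w
    by (simp_all add: P)
  have P_app: "P (u @ v) = mul H (P u) (P v)" for u v
    by (induction u) (simp_all add: P_simps mul_assoc)
  define D where "D w = sum_list (map \<delta> w)" for w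
  have P_hm: "P w \<in> hm dg (D w)" if "w \<in> lists X" for w
    using that by (induction w) (auto simp: P_simps D_def intro!: mul_hm X)
  have D_pos: "0 < D w" if "w \<in> lists X" "w \<noteq> []" for w
    using that X(2) by (cases w) (auto simp: D_def)
  \<comment> \<open>A word is cut after its first letter. Words with fewer than two letters get the
    value 0, as they admit no cut into two nonempty parts.\<close>
  obtain f where f: "plin f"
    "\<And>w. w \<in> lists X \<Longrightarrow> f (P w) = (if 2 \<le> length w then \<beta> (tns (pm (hd w)) (P (tl w))) else 0)"
    using indexed_basis_extend[OF B(1,2), of "\<lambda>w. if 2 \<le> length w then \<beta> (tns (pm (hd w)) (P (tl w))) else 0"]
    by blast
  have word: "f (mul H (P u) (P v)) = \<beta> (tns (P u) (P v))"
    if uv: "u \<in> lists X" "v \<in> lists X" "u \<noteq> []" "v \<noteq> []" "D u + D v = n" for u v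
  proof -
    obtain x u' where u: "u = x # u'" using uv by (cases u) auto
    have x: "x \<in> X" "u' \<in> lists X" using uv u by auto
    have "f (mul H (P u) (P v)) = f (P (x # u' @ v))" by (simp add: u P_app[symmetric])
    also have "\<dots> = \<beta> (tns (pm x) (P (u' @ v)))"
      using uv x by (subst f(2)) (auto simp: Suc_le_eq)
    also have "\<dots> = \<beta> (tns (P u) (P v))"
    proof (cases "u' = []")
      case True
      then show ?thesis by (simp add: u P_simps)
    next
      case False
      \<comment> \<open>Balancedness moves the cut between \<open>u\<close> and \<open>v\<close>
        back to the first letter, so the position of the cut is immaterial.\<close>
      have "\<beta> (tns (mul H (pm x) (P u')) (P v)) = \<beta> (tns (pm x) (mul H (P u') (P v)))"
        by (rule balanced_homogeneous[OF \<beta> bal X(1)[OF x(1)] P_hm[OF x(2)] P_hm[OF uv(2)]])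
           (use x uv X(2) D_pos False in \<open>auto simp: u D_def\<close>)
      then show ?thesis by (simp add: u P_simps P_app)
    qed
    finally show ?thesis .
  qed
  have "f (mul H (bs a) (bs b)) = \<beta> (bs (a, b))" if ab: "0 < dg a" "0 < dg b" "dg a + dg b = n" for a b
  proof -
    \<comment> \<open>Only words of the degree of \<open>c\<close> are used: this keeps the total
      degree at \<open>n\<close>, where balancedness is known, and excludes the empty word.\<close>
    have sp: "bs c \<in> pv.span (P ` {w\<in>lists X. D w = dg c})" for c :: 'b
      by (rule homogeneous_span[OF B(3), of dg]) (use P_hm in auto)
    have 1: "f (mul H (bs a) (P v)) = \<beta> (tns (bs a) (P v))" if v: "v \<in> lists X" "D v = dg b" for v
    proof (rule pp.linear_eq_on[OF _ _ sp[of a], of "\<lambda>a. f (mul H a (P v))" "\<lambda>a. \<beta> (tns a (P v))"])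
      fix p assume "p \<in> P ` {w\<in>lists X. D w = dg a}"
      then obtain u where u: "p = P u" "u \<in> lists X" "D u = dg a" by auto
      have "u \<noteq> []" "v \<noteq> []" using u v ab by (auto simp: D_def)
      then show "f (mul H p (P v)) = \<beta> (tns p (P v))" using word[of u v] u v ab by simp
    qed (auto intro: plin_comp[OF f(1) plin_mul_left] plin_comp[OF \<beta> plin_tns_left])
    have "f (mul H (bs a) (bs b)) = \<beta> (tns (bs a) (bs b))"
    proof (rule pp.linear_eq_on[OF _ _ sp[of b], of "\<lambda>b. f (mul H (bs a) b)" "\<lambda>b. \<beta> (tns (bs a) b)"])
      fix p assume "p \<in> P ` {w\<in>lists X. D w = dg b}"
      then show "f (mul H (bs a) p) = \<beta> (tns (bs a) p)" using 1 by blast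
    qed (auto intro: plin_comp[OF f(1) plin_mul_right] plin_comp[OF \<beta> plin_tns_right])
    then show ?thesis by simp
  qed
  then show ?thesis using f(1) by blast
qed

end

section \<open>Cofree coalgebras: cobalanced elements\<close>

locale cofree_gcb = gcb H for H :: "('b, 'k::field) hopf_data" +
  assumes cofree: "cofree_hopf H"
begin

text \<open>Letters have positive degree, so exactly the empty word has degree 0; reducing the
  coproduct thus means dropping the two trivial cuts of a word.\<close>

lemma cofree_basis:
  obtains A :: "nat set" and \<delta> :: "nat list \<Rightarrow> nat" and Q :: "nat list \<Rightarrow> ('b \<Rightarrow>\<^sub>0 'k)" where
    "\<forall>w\<in>lists A. Q w \<in> hm dg (\<delta> w)" "\<forall>w\<in>lists A. 0 < \<delta> w \<longleftrightarrow> w \<noteq> []"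
    "inj_on Q (lists A)" "pv.independent (Q ` lists A)" "pv.span (Q ` lists A) = UNIV"
    "\<forall>w\<in>lists A. Dr H (Q w) = (\<Sum>i\<in>{1..<length w}. tns (Q (take i w)) (Q (drop i w)))"
proof -
  obtain A :: "nat set" and d E where A: "\<forall>a\<in>A. d a \<ge> 1" "\<forall>w\<in>lists A. E w \<in> hom H (sum_list (map d w))"
    "basis_fam E (lists A)"
    "\<forall>w\<in>lists A. hDelta H (E w) = (\<Sum>i\<le>length w. tens (E (take i w)) (E (drop i w)))"
    using cofree unfolding cofree_hopf_def by blast
  define \<delta> where "\<delta> w = sum_list (map d w)" for w
  define Q where "Q w = pm (E w)" for w
  have EQ: "E w = lookup (Q w)" if "w \<in> lists A" for w
    using A(2) that by (auto simp: Q_def hom_def intro!: lookup_pm[symmetric])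
  have Q_hm: "Q w \<in> hm dg (\<delta> w)" if "w \<in> lists A" for w
    using A(2) that unfolding \<delta>_def hom_lookup[symmetric] EQ[OF that, symmetric] by blast
  have \<delta>_pos: "0 < \<delta> w \<longleftrightarrow> w \<noteq> []" if "w \<in> lists A" for w
    using that A(1) by (cases w) (auto simp: \<delta>_def Suc_le_eq)
  have sub: "take i w \<in> lists A" "drop i w \<in> lists A" if "w \<in> lists A" for i w
    using that by (auto simp: lists_eq_set dest: in_set_takeD in_set_dropD)
  have Dr_Q: "Dr H (Q w) = (\<Sum>i\<in>{1..<length w}. tns (Q (take i w)) (Q (drop i w)))" if w: "w \<in> lists A" for w
  proof -
    have "lookup (Dl H (Q w)) = (\<Sum>i\<le>length w. lookup (tns (Q (take i w)) (Q (drop i w))))"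
      using A(4) w by (simp add: EQ sub hDelta_lookup tens_lookup)
    then have "Dl H (Q w) = (\<Sum>i\<le>length w. tns (Q (take i w)) (Q (drop i w)))"
      by (simp add: sum_lookup lookup_inj)
    then have "Dr H (Q w) = (\<Sum>i\<le>length w. Rd dg (tns (Q (take i w)) (Q (drop i w))))"
      by (simp add: Dr_def pp.linear_sum[OF plin_Rd])
    also have "\<dots> = (\<Sum>i\<le>length w. if i \<in> {1..<length w} then tns (Q (take i w)) (Q (drop i w)) else 0)"
      using Rd_tns[OF Q_hm[OF sub(1)[OF w]] Q_hm[OF sub(2)[OF w]]] \<delta>_pos[OF sub(1)[OF w]] \<delta>_pos[OF sub(2)[OF w]]
      by (intro sum.cong) (auto simp: not_le)
    also have "\<dots> = (\<Sum>i\<in>{1..<length w}. tns (Q (take i w)) (Q (drop i w)))"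
      by (rule sum.mono_neutral_cong_right) auto
    finally show ?thesis .
  qed
  show ?thesis
    by (rule that[of A Q \<delta>]) (use Q_hm \<delta>_pos basis_fam_inj[OF A(3) EQ] basis_fam_independent[OF A(3) EQ]
      basis_fam_span[OF A(3) EQ] Dr_Q in \<open>auto simp del: in_lists_conv_set\<close>)
qed

text \<open>The second cohomology of the cobar complex vanishes. The contracting homotopy is the map
  \<open>\<Lambda>\<close> below, which concatenates a letter and a word and kills all other pairs of words.\<close>

lemma cobalanced_in_range_Dr:
  assumes t: "t \<in> hm hd2 n" "Rd dg t = t" and bal: "asc (tm (Dr H) (\<lambda>x. x) t) = tm (\<lambda>x. x) (Dr H) t"
  shows "\<exists>h\<in>hm dg n. Dr H h = t"
proof -
  obtain A :: "nat set" and \<delta> :: "nat list \<Rightarrow> nat" and Q :: "nat list \<Rightarrow> ('b \<Rightarrow>\<^sub>0 'k)" where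
    Q': "\<forall>w\<in>lists A. Q w \<in> hm dg (\<delta> w)" "\<forall>w\<in>lists A. 0 < \<delta> w \<longleftrightarrow> w \<noteq> []"
    and B: "inj_on Q (lists A)" "pv.independent (Q ` lists A)" "pv.span (Q ` lists A) = UNIV"
    and Dr_Q': "\<forall>w\<in>lists A. Dr H (Q w) = (\<Sum>i\<in>{1..<length w}. tns (Q (take i w)) (Q (drop i w)))"
    by (rule cofree_basis)
  note Q = bspec[OF Q'(1)] and \<delta> = bspec[OF Q'(2)] and Dr_Q = bspec[OF Dr_Q']
  have sub: "take i w \<in> lists A" "drop i w \<in> lists A" if "w \<in> lists A" for i w
    using that by (auto simp: lists_eq_set dest: in_set_takeD in_set_dropD)
  obtain R :: "('b \<Rightarrow>\<^sub>0 'k) \<Rightarrow> (nat list \<Rightarrow>\<^sub>0 'k)" where R: "plin R" "\<And>w. w \<in> lists A \<Longrightarrow> R (Q w) = bs w"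
    using indexed_basis_extend[OF B(1,2), of bs] by blast
  \<comment> \<open>The projection onto the span of the letters, which in \<open>coT(W)\<close> are
    the primitives of positive degree.\<close>
  obtain s :: "('b \<Rightarrow>\<^sub>0 'k) \<Rightarrow> ('b \<Rightarrow>\<^sub>0 'k)"
    where s: "plin s" "\<And>w. w \<in> lists A \<Longrightarrow> s (Q w) = (if length w = 1 then Q w else 0)"
    using indexed_basis_extend[OF B(1,2), of "\<lambda>w. if length w = 1 then Q w else 0"] by blast
  define \<Lambda> where "\<Lambda> t = pext (\<lambda>(u, v). if length u = 1 \<and> v \<noteq> [] then Q (u @ v) else 0) (tm R R t)" for t
  have \<Lambda>: "plin \<Lambda>" unfolding \<Lambda>_def by (rule plin_comp[OF plin_pext plin_tm])
  have \<Lambda>_Q: "\<Lambda> (tns (Q u) (Q v)) = (if length u = 1 \<and> v \<noteq> [] then Q (u @ v) else 0)"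
    if "u \<in> lists A" "v \<in> lists A" for u v
    using that by (simp add: \<Lambda>_def R)
  define W where "W = Q ` {w\<in>lists A. w \<noteq> []}"
  have W_span: "bs b \<in> pv.span W" if "0 < dg b" for b
  proof -
    have "bs b \<in> pv.span (Q ` {w\<in>lists A. \<delta> w = dg b})"
      by (rule homogeneous_span[OF B(3), of dg]) (use Q in auto)
    also have "\<dots> \<subseteq> pv.span W"
      by (rule pv.span_mono) (use \<delta> that in \<open>force simp: W_def\<close>)
    finally show ?thesis .
  qed
  have pos: "0 < dg x" "0 < dg y" if "(x, y) \<in> keys t" for x y
  proof -
    have "(x, y) \<in> keys (Rd dg t)" using that t(2) by simp
    then show "0 < dg x" "0 < dg y" by (auto simp: Rd_def keys_pres)
  qed
  have t_span: "t \<in> pv.span {tns a b |a b. a \<in> W \<and> b \<in> W}"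
  proof (rule mem_subspace_of_bs)
    fix p assume "p \<in> keys t"
    then show "bs p \<in> pv.span {tns a b |a b. a \<in> W \<and> b \<in> W}"
      using tns_span[OF W_span W_span, of "fst p" "snd p"] pos[of "fst p" "snd p"] by simp
  qed simp
  \<comment> \<open>One half of the homotopy formula. Among the cuts of a letter followed by
    \<open>v\<close>, the first separates the letter from \<open>v\<close>, and all later ones are
    cuts of \<open>v\<close>.\<close>
  have 1: "Dr H (\<Lambda> t) = tm s (\<lambda>x. x) t + tm \<Lambda> (\<lambda>x. x) (asc' (tm (\<lambda>x. x) (Dr H) t))"
  proof (rule pp.linear_eq_on[OF _ _ t_span,
      of "\<lambda>t. Dr H (\<Lambda> t)" "\<lambda>t. tm s (\<lambda>x. x) t + tm \<Lambda> (\<lambda>x. x) (asc' (tm (\<lambda>x. x) (Dr H) t))"])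
    show "plin (\<lambda>t. Dr H (\<Lambda> t))" by (rule plin_comp[OF plin_Dr \<Lambda>])
    show "plin (\<lambda>t. tm s (\<lambda>x. x) t + tm \<Lambda> (\<lambda>x. x) (asc' (tm (\<lambda>x. x) (Dr H) t)))"
      by (rule plin_add[OF plin_tm plin_comp[OF plin_tm plin_comp[OF plin_asc' plin_tm]]])
    fix p assume "p \<in> {tns a b |a b. a \<in> W \<and> b \<in> W}"
    then obtain u v where p: "p = tns (Q u) (Q v)" and uv: "u \<in> lists A" "v \<in> lists A" "u \<noteq> []" "v \<noteq> []"
      by (auto simp: W_def)
    have r: "tm \<Lambda> (\<lambda>x. x) (asc' (tm (\<lambda>x. x) (Dr H) p))
        = (\<Sum>j\<in>{1..<length v}. tns (\<Lambda> (tns (Q u) (Q (take j v)))) (Q (drop j v)))"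
      by (simp add: p Dr_Q uv pp.linear_sum[OF plin_tns_right] pp.linear_sum[OF plin_asc']
          pp.linear_sum[OF plin_tm] \<Lambda>)
    show "Dr H (\<Lambda> p) = tm s (\<lambda>x. x) p + tm \<Lambda> (\<lambda>x. x) (asc' (tm (\<lambda>x. x) (Dr H) p))"
    proof (cases "length u = 1")
      case False
      then show ?thesis
        unfolding r by (simp add: p \<Lambda>_Q uv s sub pp.linear_0[OF plin_Dr] pp.linear_0[OF plin_tns_left])
    next
      case True
      then obtain x where u: "u = [x]" by (cases u) auto
      have "Dr H (\<Lambda> p) = Dr H (Q (u @ v))" using True uv by (simp add: p \<Lambda>_Q)
      also have "\<dots> = (\<Sum>i\<in>{1..<Suc (length v)}. tns (Q (take i (u @ v))) (Q (drop i (u @ v))))"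
        using uv by (subst Dr_Q) (simp_all add: u)
      also have "\<dots> = tns (Q u) (Q v) + (\<Sum>i\<in>{Suc 1..<Suc (length v)}. tns (Q (take i (u @ v))) (Q (drop i (u @ v))))"
        using uv(4) by (subst sum.atLeast_Suc_lessThan) (auto simp: u)
      also have "(\<Sum>i\<in>{Suc 1..<Suc (length v)}. tns (Q (take i (u @ v))) (Q (drop i (u @ v))))
          = (\<Sum>j\<in>{1..<length v}. tns (Q (u @ take j v)) (Q (drop j v)))"
        by (subst sum.shift_bounds_Suc_ivl) (simp add: u)
      also have "\<dots> = (\<Sum>j\<in>{1..<length v}. tns (\<Lambda> (tns (Q u) (Q (take j v)))) (Q (drop j v)))"
        by (rule sum.cong) (use True uv sub in \<open>auto simp: \<Lambda>_Q\<close>)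
      finally show ?thesis
        unfolding r using True uv by (simp add: p s)
    qed
  qed
  \<comment> \<open>The other half: after \<open>Dr\<close>, only the cut behind the first letter
    survives \<open>\<Lambda>\<close> and rebuilds the word; a single letter has no such cut and is
    supplied by \<open>s\<close>.\<close>
  have 2: "s v + \<Lambda> (Dr H v) = v" if v: "v \<in> pv.span W" for v
  proof (rule pp.linear_eq_on[OF _ _ v, of "\<lambda>v. s v + \<Lambda> (Dr H v)" "\<lambda>v. v"])
    fix p assume "p \<in> W"
    then obtain w where w: "p = Q w" "w \<in> lists A" "w \<noteq> []" by (auto simp: W_def)
    have "\<Lambda> (Dr H p) = (\<Sum>i\<in>{1..<length w}. if i = 1 then Q w else 0)"
      unfolding w(1) Dr_Q[OF w(2)] pp.linear_sum[OF \<Lambda>]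
      by (rule sum.cong) (use w sub in \<open>auto simp: \<Lambda>_Q\<close>)
    also have "\<dots> = (if 1 < length w then Q w else 0)" by simp
    finally show "s p + \<Lambda> (Dr H p) = p"
      using w by (cases w) (auto simp: s)
  qed (auto intro: plin_add[OF s(1) plin_comp[OF \<Lambda> plin_Dr]])
  \<comment> \<open>Cobalancedness turns formula 1 into formula 2 applied to the left tensor factor
    of \<open>t\<close>.\<close>
  have "Dr H (\<Lambda> t) = tm s (\<lambda>x. x) t + tm \<Lambda> (\<lambda>x. x) (tm (Dr H) (\<lambda>x. x) t)"
    unfolding 1 bal[symmetric] asc'_asc ..
  also have "\<dots> = t"
  proof (rule plin_eqI[of "\<lambda>t. tm s (\<lambda>x. x) t + tm \<Lambda> (\<lambda>x. x) (tm (Dr H) (\<lambda>x. x) t)" "\<lambda>t. t"])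
    fix p assume "p \<in> keys t"
    then have "0 < dg (fst p)" using pos[of "fst p" "snd p"] by simp
    then have "s (bs (fst p)) + \<Lambda> (Dr H (bs (fst p))) = bs (fst p)" using 2 W_span by blast
    then have "tns (s (bs (fst p)) + \<Lambda> (Dr H (bs (fst p)))) (bs (snd p)) = bs p" by simp
    then show "tm s (\<lambda>x. x) (bs p) + tm \<Lambda> (\<lambda>x. x) (tm (Dr H) (\<lambda>x. x) (bs p)) = bs p"
      by (cases p) (simp add: \<Lambda> pp.linear_add[OF plin_tns_left])
  qed (auto intro: plin_add[OF plin_tm plin_comp[OF plin_tm plin_tm]])
  finally have "Dr H (\<Lambda> t) = t" .
  \<comment> \<open>Passing to the component of degree n makes the preimage homogeneous;
    \<open>Dr\<close> preserves degrees and \<open>t\<close> already has degree n.\<close>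
  then have "Dr H (hpart dg n (\<Lambda> t)) = t"
    using hpart_commute[OF plin_Dr, of H hd2 dg n "\<Lambda> t"] Dr_hm hpart_of_hm[OF t(1), of n] by simp
  then show ?thesis using hpart_hm by blast
qed

end

section \<open>Truncated isomorphisms\<close>

text \<open>By connectedness, the primitive elements of positive degree form the kernel of the reduced coproduct.\<close>

definition prims_in :: "('b, 'k::field) hopf_data \<Rightarrow> nat \<Rightarrow> ('b \<Rightarrow>\<^sub>0 'k) set" where
  "prims_in H n = {x \<in> hm (deg H) n. Dr H x = 0}"

text \<open>The degree n part of \<open>H\<^sup>+\<^sup>2\<close>, with generators whose factors
  have degree below n and so lie in the range of a truncated map; \<open>decomps_in_iff\<close>
  links it to the ungraded version.\<close>

definition decomps_in :: "('b, 'k::field) hopf_data \<Rightarrow> nat \<Rightarrow> ('b \<Rightarrow>\<^sub>0 'k) set" where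
  "decomps_in H n = pv.span {mul H (bs a) (bs b) |a b. 0 < deg H a \<and> 0 < deg H b \<and> deg H a + deg H b = n}"

text \<open>A truncated morphism is extended by zero, so that \<open>\<phi> \<otimes> \<phi>\<close> kills the two components of a
  coproduct in degree \<open>n\<close> that are not covered by lower degrees.\<close>

definition truncated_hom_axiom :: "('b, 'k::field) hopf_data \<Rightarrow> ('c, 'k) hopf_data \<Rightarrow> nat \<Rightarrow> (('b \<Rightarrow>\<^sub>0 'k) \<Rightarrow> ('c \<Rightarrow>\<^sub>0
    'k)) \<Rightarrow> bool" where
  "truncated_hom_axiom H H' n \<phi> \<longleftrightarrow> plin \<phi> \<and> (\<forall>b. deg H b < n \<longrightarrow> \<phi> (bs b) \<in> hm (deg H') (deg H b)) \<and>
     (\<forall>b. n \<le> deg H b \<longrightarrow> \<phi> (bs b) = 0) \<and>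
     (\<forall>a b. deg H a + deg H b < n \<longrightarrow> \<phi> (mul H (bs a) (bs b)) = mul H' (\<phi> (bs a)) (\<phi> (bs b))) \<and>
     (\<forall>a. deg H a < n \<longrightarrow> Dl H' (\<phi> (bs a)) = tm \<phi> \<phi> (Dl H (bs a))) \<and> \<phi> (unt H) = unt H'"

definition truncated_iso :: "('b, 'k::field) hopf_data \<Rightarrow> ('c, 'k) hopf_data \<Rightarrow> nat
    \<Rightarrow> (('b \<Rightarrow>\<^sub>0 'k) \<Rightarrow> ('c \<Rightarrow>\<^sub>0 'k)) \<Rightarrow> (('c \<Rightarrow>\<^sub>0 'k) \<Rightarrow> ('b \<Rightarrow>\<^sub>0 'k)) \<Rightarrow> bool" where
  "truncated_iso H H' n \<phi> \<psi> \<longleftrightarrow> truncated_hom_axiom H H' n \<phi> \<and> plin \<psi> \<and>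
     (\<forall>c. deg H' c < n \<longrightarrow> \<psi> (bs c) \<in> hm (deg H) (deg H' c)) \<and>
     (\<forall>c. n \<le> deg H' c \<longrightarrow> \<psi> (bs c) = 0) \<and>
     (\<forall>b. deg H b < n \<longrightarrow> \<psi> (\<phi> (bs b)) = bs b) \<and> (\<forall>c. deg H' c < n \<longrightarrow> \<phi> (\<psi> (bs c)) = bs c)"

lemma (in gcb) decomps_in_hm: "decomps_in H n \<subseteq> hm dg n"
  unfolding decomps_in_def by (rule pv.span_minimal) (auto intro!: mul_hm)

lemma (in gcb) mul_mem_decomps_in:
  assumes "u \<in> hm dg i" "v \<in> hm dg j" "0 < i" "0 < j" "i + j = n"
  shows "mul H u v \<in> decomps_in H n"
proof (rule plin_mem[OF plin_mul_left])
  fix a assume "a \<in> keys u"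
  then have a: "dg a = i" using hmD[OF assms(1)] by simp
  show "mul H (bs a) v \<in> decomps_in H n"
  proof (rule plin_mem[OF plin_mul_right])
    fix b assume "b \<in> keys v"
    then have "dg b = j" using hmD[OF assms(2)] by simp
    then show "mul H (bs a) (bs b) \<in> decomps_in H n"
      unfolding decomps_in_def using a assms by (intro pv.span_base) auto
  qed (simp add: decomps_in_def)
qed (simp add: decomps_in_def)

text \<open>The strict bounds drive the induction: in degree n the reduced coproduct sees only
  smaller degrees.\<close>

lemma (in gcb) keys_Dr:
  assumes "v \<in> hm dg n" "(x, y) \<in> keys (Dr H v)"
  shows "0 < dg x" "0 < dg y" "dg x < n" "dg y < n" "dg x + dg y = n"
proof -
  show pos: "0 < dg x" "0 < dg y" using assms(2) by (auto simp: Dr_def Rd_def keys_pres)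
  show sum: "dg x + dg y = n" using hmD[OF Dr_hm[OF assms(1)] assms(2)] by simp
  show "dg x < n" "dg y < n" using pos sum by auto
qed

lemma (in gcb) keys_Dl:
  assumes "v \<in> hm dg n" "(x, y) \<in> keys (Dl H v)"
  shows "dg x \<le> n" "dg y \<le> n"
  using hmD[OF Dl_hm[OF assms(1)] assms(2)] by auto

section \<open>Transport of products and coproducts from degrees below n to degree n\<close>

locale truncated_hom = H: gcb H + H': gcb H'
  for H :: "('b, 'k::field) hopf_data" and H' :: "('c, 'k) hopf_data" +
  fixes n :: nat and \<phi> :: "('b \<Rightarrow>\<^sub>0 'k) \<Rightarrow> ('c \<Rightarrow>\<^sub>0 'k)"
  assumes truncated_hom_axiom: "truncated_hom_axiom H H' n \<phi>"
begin

lemma plin_phi: "plin \<phi>"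
  and phi_zero: "n \<le> H.dg b \<Longrightarrow> \<phi> (bs b) = 0"
  and phi_unt: "\<phi> (unt H) = unt H'"
  using truncated_hom_axiom by (auto simp: truncated_hom_axiom_def)

text \<open>No bound on the degree appears, because the value 0 taken from degree n on is
  homogeneous of every degree.\<close>

lemma phi_bs_hm: "\<phi> (bs b) \<in> hm H'.dg (H.dg b)"
  using truncated_hom_axiom by (cases "H.dg b < n") (auto simp: truncated_hom_axiom_def)

lemma phi_hm_zero: "v \<in> hm H.dg k \<Longrightarrow> n \<le> k \<Longrightarrow> \<phi> v = 0"
  using plin_mem[OF plin_phi pv.subspace_single_0, of v] phi_zero by (auto dest: hmD)

lemma phi_mul:
  assumes "u \<in> hm H.dg i" "v \<in> hm H.dg j" "i + j < n"
  shows "\<phi> (mul H u v) = mul H' (\<phi> u) (\<phi> v)"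
proof (rule bilinear_eqI[of "\<lambda>u v. \<phi> (mul H u v)" "\<lambda>u v. mul H' (\<phi> u) (\<phi> v)"])
  fix a b assume "a \<in> keys u" "b \<in> keys v"
  then have "H.dg a = i" "H.dg b = j" using hmD[OF assms(1)] hmD[OF assms(2)] by simp_all
  then show "\<phi> (mul H (bs a) (bs b)) = mul H' (\<phi> (bs a)) (\<phi> (bs b))"
    using truncated_hom_axiom assms by (auto simp: truncated_hom_axiom_def)
qed (rule plin_comp[OF plin_phi plin_mul_left] plin_comp[OF plin_phi plin_mul_right]
   plin_comp[OF plin_mul_left plin_phi] plin_comp[OF plin_mul_right plin_phi])+

lemma phi_Dl:
  assumes "v \<in> hm H.dg k" "k < n"
  shows "Dl H' (\<phi> v) = tm \<phi> \<phi> (Dl H v)"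
  by (rule plin_eq_hm[OF plin_comp[OF plin_Dl plin_phi] plin_comp[OF plin_tm plin_Dl] assms(1)])
     (use truncated_hom_axiom assms in \<open>auto simp: truncated_hom_axiom_def\<close>)

lemma tm_phi_hm: "t \<in> hm H.hd2 k \<Longrightarrow> tm \<phi> \<phi> t \<in> hm H'.hd2 k"
proof (rule plin_hm[OF plin_tm, of t H.hd2 k])
  fix p assume "H.hd2 p = k"
  then show "tm \<phi> \<phi> (bs p) \<in> hm H'.hd2 k"
    using tns_hm[OF phi_bs_hm[of "fst p"] phi_bs_hm[of "snd p"]] by (cases p) auto
qed auto

lemma Rd_tm_phi: "Rd H'.dg (tm \<phi> \<phi> t) = tm \<phi> \<phi> (Rd H.dg t)"
proof (rule plin_eqI[OF plin_comp[OF plin_Rd plin_tm] plin_comp[OF plin_tm plin_Rd]])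
  fix p
  show "Rd H'.dg (tm \<phi> \<phi> (bs p)) = tm \<phi> \<phi> (Rd H.dg (bs p))"
    using Rd_tns[OF phi_bs_hm[of "fst p"] phi_bs_hm[of "snd p"]]
    by (cases p) (auto simp: Rd_bs pp.linear_0[OF plin_tm])
qed

lemma phi_Dr:
  assumes "v \<in> hm H.dg k" "k < n"
  shows "Dr H' (\<phi> v) = tm \<phi> \<phi> (Dr H v)"
  unfolding Dr_def phi_Dl[OF assms] Rd_tm_phi ..

text \<open>The map sending a tensor to the product of its images under \<open>\<phi>\<close> is
  balanced by associativity in \<open>H'\<close>: in a triple of positive degrees with sum n, any
  two factors have total degree below n, where \<open>\<phi>\<close> is multiplicative.\<close>

lemma ex_mul_extension:
  assumes "free_hopf H"
  shows "\<exists>f. plin f \<and> (\<forall>a b. 0 < H.dg a \<longrightarrow> 0 < H.dg b \<longrightarrow> H.dg a + H.dg b = n \<longrightarrow>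
    f (mul H (bs a) (bs b)) = mul H' (\<phi> (bs a)) (\<phi> (bs b)))"
proof -
  interpret free_gcb H by unfold_locales (rule assms)
  have "\<exists>f. plin f \<and> (\<forall>a b. 0 < H.dg a \<longrightarrow> 0 < H.dg b \<longrightarrow> H.dg a + H.dg b = n \<longrightarrow>
      f (mul H (bs a) (bs b)) = Mu H' (tm \<phi> \<phi> (bs (a, b))))"
  proof (rule balanced_factors_through_mul[OF plin_comp[OF plin_Mu plin_tm]])
    fix a b c assume d: "0 < H.dg a" "0 < H.dg b" "0 < H.dg c" "H.dg a + H.dg b + H.dg c = n"
    have "\<phi> (mul H (bs a) (bs b)) = mul H' (\<phi> (bs a)) (\<phi> (bs b))"
      "\<phi> (mul H (bs b) (bs c)) = mul H' (\<phi> (bs b)) (\<phi> (bs c))"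
      using d by (auto intro!: phi_mul)
    then show "Mu H' (tm \<phi> \<phi> (tns (mul H (bs a) (bs b)) (bs c))) = Mu H' (tm \<phi> \<phi> (tns (bs a) (mul H (bs b) (bs c))))"
      using H'.mul_assoc[of "\<phi> (bs a)" "\<phi> (bs b)" "\<phi> (bs c)"] by (simp add: plin_phi mul_def)
  qed
  then show ?thesis by (simp add: mul_def)
qed

text \<open>The two products formed on the tensor factors have degrees with sum n. If both degrees
  are positive, both are below n and \<open>\<phi>\<close> is multiplicative there; otherwise one
  product would have degree n, but \<open>Rd\<close> removes this term.\<close>

lemma Rd_tmulP_phi:
  assumes s: "s \<in> hm H.hd2 i" and t: "t \<in> hm H.hd2 j" and ij: "i + j = n"
  shows "Rd H'.dg (tmulP H' (tm \<phi> \<phi> s) (tm \<phi> \<phi> t)) = tm \<phi> \<phi> (Rd H.dg (tmulP H s t))"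
proof (rule bilinear_eqI[of "\<lambda>s t. Rd H'.dg (tmulP H' (tm \<phi> \<phi> s) (tm \<phi> \<phi> t))" "\<lambda>s t. tm \<phi> \<phi> (Rd H.dg (tmulP H s t))"])
  fix p q assume pq: "p \<in> keys s" "q \<in> keys t"
  obtain x y x' y' where xy: "p = (x, y)" "q = (x', y')" by (metis surj_pair)
  let ?k = "H.dg x + H.dg x'" and ?l = "H.dg y + H.dg y'"
  have kl: "?k + ?l = n" using hmD[OF s pq(1)] hmD[OF t pq(2)] ij xy by simp
  have hx: "mul H (bs x) (bs x') \<in> hm H.dg ?k" "mul H (bs y) (bs y') \<in> hm H.dg ?l"
    by (auto intro: H.mul_hm)
  have hx': "mul H' (\<phi> (bs x)) (\<phi> (bs x')) \<in> hm H'.dg ?k" "mul H' (\<phi> (bs y)) (\<phi> (bs y')) \<in> hm H'.dg ?l"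
    by (auto intro: H'.mul_hm phi_bs_hm)
  have l: "tmulP H' (tm \<phi> \<phi> (bs p)) (tm \<phi> \<phi> (bs q)) = tns (mul H' (\<phi> (bs x)) (\<phi> (bs x'))) (mul H' (\<phi> (bs y)) (\<phi> (bs y')))"
    by (simp add: xy tmulP_tns)
  have r: "tmulP H (bs p) (bs q) = tns (mul H (bs x) (bs x')) (mul H (bs y) (bs y'))"
    by (simp add: xy tmulP_bs)
  show "Rd H'.dg (tmulP H' (tm \<phi> \<phi> (bs p)) (tm \<phi> \<phi> (bs q))) = tm \<phi> \<phi> (Rd H.dg (tmulP H (bs p) (bs q)))"
  proof (cases "0 < ?k \<and> 0 < ?l")
    case True
    have "\<phi> (mul H (bs x) (bs x')) = mul H' (\<phi> (bs x)) (\<phi> (bs x'))"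
      "\<phi> (mul H (bs y) (bs y')) = mul H' (\<phi> (bs y)) (\<phi> (bs y'))"
      using True kl by (auto intro!: phi_mul)
    then show ?thesis
      unfolding l r Rd_tns[OF hx'] Rd_tns[OF hx] using True by (simp add: plin_phi)
  next
    case False
    then show ?thesis
      unfolding l r Rd_tns[OF hx'] Rd_tns[OF hx] by (simp only: if_False pp.linear_0[OF plin_tm])
  qed
qed (rule plin_comp[OF plin_Rd plin_comp[OF plin_tmulP_left plin_tm]] plin_comp[OF plin_Rd plin_comp[OF
    plin_tmulP_right plin_tm]]
    plin_comp[OF plin_tm plin_comp[OF plin_Rd plin_tmulP_left]] plin_comp[OF plin_tm plin_comp[OF plin_Rd
        plin_tmulP_right]])+

text \<open>Multiplicativity of the coproduct reduces the claim to the factors, which have degree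
  below n. This makes the prescription on decomposables compatible with the one from the
  coproduct.\<close>

lemma Dr_mul_phi:
  assumes "0 < H.dg a" "0 < H.dg b" "H.dg a + H.dg b = n"
  shows "Dr H' (mul H' (\<phi> (bs a)) (\<phi> (bs b))) = tm \<phi> \<phi> (Dr H (mul H (bs a) (bs b)))"
proof -
  have "Dl H' (\<phi> (bs a)) = tm \<phi> \<phi> (Dl H (bs a))" "Dl H' (\<phi> (bs b)) = tm \<phi> \<phi> (Dl H (bs b))"
    using assms by (auto intro!: phi_Dl)
  then show ?thesis
    unfolding Dr_def H.Dl_mul H'.Dl_mul using Rd_tmulP_phi[OF H.Dl_bs_hm H.Dl_bs_hm assms(3)] by simp
qed

text \<open>Coassociativity of \<open>Dr H\<close> carries over to the transported element, since
  \<open>\<phi>\<close> respects \<open>Dr\<close> on the tensor factors; cofreeness of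
  \<open>H'\<close> then supplies a preimage.\<close>

lemma ex_Dr_lift:
  assumes "cofree_hopf H'" and a: "a \<in> hm H.dg n"
  shows "\<exists>a'\<in>hm H'.dg n. Dr H' a' = tm \<phi> \<phi> (Dr H a)"
proof -
  interpret cofree_gcb H' by unfold_locales (rule assms)
  have l: "plin (tm \<phi> \<phi>)" "plin (\<lambda>x. x)" by auto
  show ?thesis
  proof (rule cobalanced_in_range_Dr)
    show "tm \<phi> \<phi> (Dr H a) \<in> hm H'.hd2 n" by (intro tm_phi_hm H.Dr_hm a)
    show "Rd H'.dg (tm \<phi> \<phi> (Dr H a)) = tm \<phi> \<phi> (Dr H a)"
      unfolding Rd_tm_phi by (simp add: Dr_def Rd_def pres_pres)
    have c: "tm (\<lambda>x. Dr H' (\<phi> x)) \<phi> (Dr H a) = tm (\<lambda>x. tm \<phi> \<phi> (Dr H x)) \<phi> (Dr H a)"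
      "tm \<phi> (\<lambda>x. Dr H' (\<phi> x)) (Dr H a) = tm \<phi> (\<lambda>x. tm \<phi> \<phi> (Dr H x)) (Dr H a)"
      by (auto intro!: tm_cong phi_Dr dest: H.keys_Dr[OF a])
    have "asc (tm (Dr H') (\<lambda>x. x) (tm \<phi> \<phi> (Dr H a))) = asc (tm (\<lambda>x. Dr H' (\<phi> x)) \<phi> (Dr H a))"
      by (simp add: tm_tm)
    also have "\<dots> = asc (tm (tm \<phi> \<phi>) \<phi> (tm (Dr H) (\<lambda>x. x) (Dr H a)))"
      unfolding c by (simp add: tm_tm plin_phi)
    also have "\<dots> = tm \<phi> (tm \<phi> \<phi>) (asc (tm (Dr H) (\<lambda>x. x) (Dr H a)))"
      by (rule asc_natural) (rule plin_phi)+
    also have "\<dots> = tm \<phi> (\<lambda>x. tm \<phi> \<phi> (Dr H x)) (Dr H a)"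
      unfolding H.Dr_coassoc by (simp add: tm_tm plin_phi)
    also have "\<dots> = tm (\<lambda>x. x) (Dr H') (tm \<phi> \<phi> (Dr H a))"
      unfolding c[symmetric] by (simp add: tm_tm)
    finally show "asc (tm (Dr H') (\<lambda>x. x) (tm \<phi> \<phi> (Dr H a))) = tm (\<lambda>x. x) (Dr H') (tm \<phi> \<phi> (Dr H a))" .
  qed
qed

end

text \<open>Compatibility with the structure is demanded of \<open>\<phi>\<close> only; that of its
  inverse follows by applying \<open>\<psi>\<close> to the identities for \<open>\<phi>\<close>.
  Positive \<open>n\<close> brings the unit into range.\<close>

lemma truncated_iso_sym:
  assumes "gcb H" "gcb H'" and st: "truncated_iso H H' n \<phi> \<psi>" and n: "0 < n"
  shows "truncated_iso H' H n \<psi> \<phi>"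
proof -
  interpret H: gcb H by fact
  interpret H': gcb H' by fact
  interpret truncated_hom H H' n \<phi> by unfold_locales (use st in \<open>simp add: truncated_iso_def\<close>)
  have psi: "plin \<psi>" "\<And>c. H'.dg c < n \<Longrightarrow> \<psi> (bs c) \<in> hm H.dg (H'.dg c)" "\<And>c. n \<le> H'.dg c \<Longrightarrow> \<psi> (bs c) = 0"
    "\<And>b. H.dg b < n \<Longrightarrow> \<psi> (\<phi> (bs b)) = bs b" "\<And>c. H'.dg c < n \<Longrightarrow> \<phi> (\<psi> (bs c)) = bs c"
    using st by (auto simp: truncated_iso_def)
  have psi_phi: "\<psi> (\<phi> v) = v" if "v \<in> hm H.dg k" "k < n" for v k
    by (rule plin_eq_hm[OF plin_comp[OF psi(1) plin_phi] plin_id(1) that(1)]) (use that psi in auto)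
  have 1: "\<psi> (mul H' (bs c) (bs d)) = mul H (\<psi> (bs c)) (\<psi> (bs d))" if cd: "H'.dg c + H'.dg d < n" for c d
  proof -
    have h: "\<psi> (bs c) \<in> hm H.dg (H'.dg c)" "\<psi> (bs d) \<in> hm H.dg (H'.dg d)" using cd psi(2) by auto
    have "mul H' (bs c) (bs d) = \<phi> (mul H (\<psi> (bs c)) (\<psi> (bs d)))"
      using phi_mul[OF h cd] psi(5) cd by simp
    then show ?thesis using psi_phi[OF H.mul_hm[OF h] cd] by simp
  qed
  have 2: "Dl H (\<psi> (bs c)) = tm \<psi> \<psi> (Dl H' (bs c))" if c: "H'.dg c < n" for c
  proof -
    have h: "\<psi> (bs c) \<in> hm H.dg (H'.dg c)" using c psi(2) by auto
    have "tm \<psi> \<psi> (Dl H' (bs c)) = tm \<psi> \<psi> (tm \<phi> \<phi> (Dl H (\<psi> (bs c))))"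
      using phi_Dl[OF h c] psi(5)[OF c] by simp
    also have "\<dots> = tm (\<lambda>x. x) (\<lambda>x. x) (Dl H (\<psi> (bs c)))"
      unfolding tm_tm[OF psi(1) psi(1)]
    proof (rule tm_cong)
      fix x y assume "(x, y) \<in> keys (Dl H (\<psi> (bs c)))"
      then show "\<psi> (\<phi> (bs x)) = bs x" "\<psi> (\<phi> (bs y)) = bs y"
        using H.keys_Dl[OF h] c psi(4) by (meson le_less_trans)+
    qed
    also have "\<dots> = Dl H (\<psi> (bs c))"
      by (rule plin_eqI[OF plin_tm plin_id(1)]) (auto split: prod.splits)
    finally show ?thesis ..
  qed
  have 3: "\<psi> (unt H') = unt H"
    using psi_phi[OF H.unt_hm n] phi_unt by simp
  show ?thesis
    unfolding truncated_iso_def truncated_hom_axiom_def using psi 1 2 3 plin_phi phi_bs_hm phi_zero by auto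
qed

lemma tm_ident: "tm (\<lambda>x. x) (\<lambda>x. x) t = t"
  by (rule plin_eqI[OF plin_tm plin_id(1)]) (auto split: prod.splits)

lemma (in gcb) hm_span: "hm dg n = pv.span (bs ` {b. dg b = n})"
proof
  show "hm dg n \<subseteq> pv.span (bs ` {b. dg b = n})"
  proof
    fix v assume v: "v \<in> hm dg n"
    show "v \<in> pv.span (bs ` {b. dg b = n})"
      by (rule mem_subspace_of_bs) (use hmD[OF v] in \<open>auto intro: pv.span_base\<close>)
  qed
  show "pv.span (bs ` {b. dg b = n}) \<subseteq> hm dg n"
    by (rule pv.span_minimal) auto
qed

lemma independent_bs:
  assumes "finite S" shows "pv.independent (bs ` S :: ('b \<Rightarrow>\<^sub>0 'k::field) set)"
proof (rule pv.independent_if_scalars_zero)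
  show "finite (bs ` S :: ('b \<Rightarrow>\<^sub>0 'k) set)" using assms by simp
  fix f :: "('b \<Rightarrow>\<^sub>0 'k) \<Rightarrow> 'k" and x :: "'b \<Rightarrow>\<^sub>0 'k" assume f: "(\<Sum>x\<in>bs ` S. psc (f x) x) = 0" "x \<in> bs ` S"
  then obtain b where b: "b \<in> S" "x = bs b" by auto
  have inj: "inj_on (bs :: 'b \<Rightarrow> ('b \<Rightarrow>\<^sub>0 'k)) S"
    by (rule inj_onI) (metis keys_single singleton_inject zero_neq_one)
  have "lookup (\<Sum>a\<in>S. psc (f (bs a)) (bs a)) b = 0"
    using f(1) unfolding sum.reindex[OF inj] by simp
  moreover have "lookup (\<Sum>a\<in>S. psc (f (bs a)) (bs a)) b = (\<Sum>a\<in>S. if a = b then f (bs a) else 0)"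
    unfolding lookup_sum by (intro sum.cong) (auto simp: lookup_single when_def)
  ultimately show "f x = 0" using b assms by simp
qed

lemma (in gcb) dim_hm: "pv.dim (hm dg n :: ('b \<Rightarrow>\<^sub>0 'k) set) = dimH H n"
proof -
  have inj: "inj_on (bs :: 'b \<Rightarrow> ('b \<Rightarrow>\<^sub>0 'k)) {b. dg b = n}"
    by (rule inj_onI) (metis keys_single singleton_inject zero_neq_one)
  have "pv.dim (hm dg n :: ('b \<Rightarrow>\<^sub>0 'k) set) = card (bs ` {b. dg b = n} :: ('b \<Rightarrow>\<^sub>0 'k) set)"
    unfolding hm_span pv.dim_span by (rule pv.dim_eq_card_independent[OF independent_bs[OF finite_degree]])
  then show ?thesis by (simp add: card_image[OF inj] dimH_def)
qed

text \<open>The degree n form of \<open>prim_quot_isomorphic\<close>. Additivity and homogeneity are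
  required on primitives only, because the given map is constrained only there.\<close>

definition quotient_iso :: "('b, 'k::field) hopf_data \<Rightarrow> ('c, 'k) hopf_data \<Rightarrow> nat \<Rightarrow> (('b \<Rightarrow>\<^sub>0 'k) \<Rightarrow> ('c \<Rightarrow>\<^sub>0 'k)) \<Rightarrow>
    bool" where
  "quotient_iso H H' n \<theta> \<longleftrightarrow> (\<forall>x\<in>prims_in H n. \<theta> x \<in> prims_in H' n) \<and>
     (\<forall>x\<in>prims_in H n. \<forall>y\<in>prims_in H n. \<theta> (x + y) = \<theta> x + \<theta> y) \<and> (\<forall>c. \<forall>x\<in>prims_in H n. \<theta> (psc c x) = psc c (\<theta> x)) \<and>
     (\<forall>x\<in>prims_in H n. \<theta> x \<in> decomps_in H' n \<longleftrightarrow> x \<in> decomps_in H n)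
         \<and> (\<forall>y\<in>prims_in H' n. \<exists>x\<in>prims_in H n. y - \<theta> x \<in> decomps_in H' n)"

section \<open>The inductive step: from degrees below n to degree n\<close>

locale extension_step = H: gcb H + H': gcb H'
  for H :: "('b, 'k::field) hopf_data" and H' :: "('c, 'k) hopf_data" +
  fixes n :: nat and \<phi> :: "('b \<Rightarrow>\<^sub>0 'k) \<Rightarrow> ('c \<Rightarrow>\<^sub>0 'k)" and \<psi> :: "('c \<Rightarrow>\<^sub>0 'k) \<Rightarrow> ('b \<Rightarrow>\<^sub>0 'k)"
  assumes st: "truncated_iso H H' n \<phi> \<psi>" and n: "0 < n"
    and free: "free_hopf H" "free_hopf H'" and cofree: "cofree_hopf H" "cofree_hopf H'"
begin

sublocale A: truncated_hom H H' n \<phi>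
  by unfold_locales (use st in \<open>simp add: truncated_iso_def\<close>)

sublocale B: truncated_hom H' H n \<psi>
  by unfold_locales
     (use truncated_iso_sym[OF H.gcb_axioms H'.gcb_axioms st n] in \<open>simp add: truncated_iso_def\<close>)

lemma psi_phi: "H.dg b < n \<Longrightarrow> \<psi> (\<phi> (bs b)) = bs b"
  and phi_psi: "H'.dg c < n \<Longrightarrow> \<phi> (\<psi> (bs c)) = bs c"
  using st by (auto simp: truncated_iso_def)

lemma tm_psi_phi:
  assumes "x \<in> hm H.dg n" shows "tm \<psi> \<psi> (tm \<phi> \<phi> (Dr H x)) = Dr H x"
proof -
  have "tm \<psi> \<psi> (tm \<phi> \<phi> (Dr H x)) = tm (\<lambda>x. x) (\<lambda>x. x) (Dr H x)"
    unfolding tm_tm[OF B.plin_phi B.plin_phi]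
    by (rule tm_cong) (auto intro!: psi_phi dest: H.keys_Dr[OF assms])
  then show ?thesis by (simp add: tm_ident)
qed

lemma tm_phi_psi:
  assumes "x \<in> hm H'.dg n" shows "tm \<phi> \<phi> (tm \<psi> \<psi> (Dr H' x)) = Dr H' x"
proof -
  have "tm \<phi> \<phi> (tm \<psi> \<psi> (Dr H' x)) = tm (\<lambda>x. x) (\<lambda>x. x) (Dr H' x)"
    unfolding tm_tm[OF A.plin_phi A.plin_phi]
    by (rule tm_cong) (auto intro!: phi_psi dest: H'.keys_Dr[OF assms])
  then show ?thesis by (simp add: tm_ident)
qed

text \<open>Each hypothesis is used on both sides: freeness of \<open>H\<close> and of
  \<open>H'\<close> gives \<open>f\<close> and its inverse on decomposables, while cofreeness of
  \<open>H'\<close> and of \<open>H\<close> gives the two inclusions between the images of the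
  reduced coproducts.\<close>

lemma ex_problem:
  "\<exists>f. extension_problem (hm H.dg n) (decomps_in H n) (hm H'.dg n) (decomps_in H' n) f (\<lambda>x. tm \<phi> \<phi> (Dr H x)) (Dr
      H') (prims_in H n) (prims_in H' n)
    \<and> (\<forall>a b. 0 < H.dg a \<longrightarrow> 0 < H.dg b \<longrightarrow> H.dg a + H.dg b = n \<longrightarrow> f (mul H (bs a) (bs b)) = mul H' (\<phi> (bs a)) (\<phi> (bs b)))"
proof -
  obtain f where f: "plin f" and f_bs: "\<And>a b. 0 < H.dg a \<Longrightarrow> 0 < H.dg b \<Longrightarrow> H.dg a + H.dg b = n
      \<Longrightarrow> f (mul H (bs a) (bs b)) = mul H' (\<phi> (bs a)) (\<phi> (bs b))"
    using A.ex_mul_extension[OF free(1)] by blast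
  obtain f' where f': "plin f'" and f'_bs: "\<And>a b. 0 < H'.dg a \<Longrightarrow> 0 < H'.dg b \<Longrightarrow> H'.dg a + H'.dg b = n
      \<Longrightarrow> f' (mul H' (bs a) (bs b)) = mul H (\<psi> (bs a)) (\<psi> (bs b))"
    using B.ex_mul_extension[OF free(2)] by blast
  have f_mul: "f (mul H u v) = mul H' (\<phi> u) (\<phi> v)"
    if "u \<in> hm H.dg i" "v \<in> hm H.dg j" "0 < i" "0 < j" "i + j = n" for u v i j
  proof (rule bilinear_eqI[of "\<lambda>u v. f (mul H u v)" "\<lambda>u v. mul H' (\<phi> u) (\<phi> v)"])
    fix a b assume "a \<in> keys u" "b \<in> keys v"
    then show "f (mul H (bs a) (bs b)) = mul H' (\<phi> (bs a)) (\<phi> (bs b))"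
      using hmD[OF that(1)] hmD[OF that(2)] that by (intro f_bs) auto
  qed (rule plin_comp[OF f plin_mul_left] plin_comp[OF f plin_mul_right]
     plin_comp[OF plin_mul_left A.plin_phi] plin_comp[OF plin_mul_right A.plin_phi])+
  have f'_mul: "f' (mul H' u v) = mul H (\<psi> u) (\<psi> v)"
    if "u \<in> hm H'.dg i" "v \<in> hm H'.dg j" "0 < i" "0 < j" "i + j = n" for u v i j
  proof (rule bilinear_eqI[of "\<lambda>u v. f' (mul H' u v)" "\<lambda>u v. mul H (\<psi> u) (\<psi> v)"])
    fix a b assume "a \<in> keys u" "b \<in> keys v"
    then show "f' (mul H' (bs a) (bs b)) = mul H (\<psi> (bs a)) (\<psi> (bs b))"
      using hmD[OF that(1)] hmD[OF that(2)] that by (intro f'_bs) auto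
  qed (rule plin_comp[OF f' plin_mul_left] plin_comp[OF f' plin_mul_right]
     plin_comp[OF plin_mul_left B.plin_phi] plin_comp[OF plin_mul_right B.plin_phi])+
  have f_PP: "f x \<in> decomps_in H' n" if "x \<in> decomps_in H n" for x
  proof -
    let ?S = "{mul H (bs a) (bs b) |a b. 0 < H.dg a \<and> 0 < H.dg b \<and> H.dg a + H.dg b = n}"
    have "f ` ?S \<subseteq> decomps_in H' n"
    proof safe
      fix a b assume ab: "0 < H.dg a" "0 < H.dg b" "n = H.dg a + H.dg b"
      show "f (mul H (bs a) (bs b)) \<in> decomps_in H' (H.dg a + H.dg b)"
        using f_bs[of a b] H'.mul_mem_decomps_in[OF A.phi_bs_hm A.phi_bs_hm ab(1,2) refl] ab by simp
    qed
    then have "pv.span (f ` ?S) \<subseteq> decomps_in H' n"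
      by (rule pv.span_minimal) (simp add: decomps_in_def)
    then show ?thesis using that unfolding pp.linear_span_image[OF f] decomps_in_def[of H] by blast
  qed
  have f'_PP: "f' x \<in> decomps_in H n" if "x \<in> decomps_in H' n" for x
  proof -
    let ?S = "{mul H' (bs a) (bs b) |a b. 0 < H'.dg a \<and> 0 < H'.dg b \<and> H'.dg a + H'.dg b = n}"
    have "f' ` ?S \<subseteq> decomps_in H n"
    proof safe
      fix a b assume ab: "0 < H'.dg a" "0 < H'.dg b" "n = H'.dg a + H'.dg b"
      show "f' (mul H' (bs a) (bs b)) \<in> decomps_in H (H'.dg a + H'.dg b)"
        using f'_bs[of a b] H.mul_mem_decomps_in[OF B.phi_bs_hm B.phi_bs_hm ab(1,2) refl] ab by simp
    qed
    then have "pv.span (f' ` ?S) \<subseteq> decomps_in H n"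
      by (rule pv.span_minimal) (simp add: decomps_in_def)
    then show ?thesis using that unfolding pp.linear_span_image[OF f'] decomps_in_def[of H'] by blast
  qed
  have f'f: "f' (f x) = x" if "x \<in> decomps_in H n" for x
  proof (rule pp.linear_eq_on[OF plin_comp[OF f' f] plin_id(1) that[unfolded decomps_in_def]])
    fix p assume "p \<in> {mul H (bs a) (bs b) |a b. 0 < H.dg a \<and> 0 < H.dg b \<and> H.dg a + H.dg b = n}"
    then obtain a b where ab: "p = mul H (bs a) (bs b)" "0 < H.dg a" "0 < H.dg b" "H.dg a + H.dg b = n" by blast
    show "f' (f p) = p"
      using f_bs[OF ab(2,3,4)] f'_mul[OF A.phi_bs_hm A.phi_bs_hm ab(2,3,4)] psi_phi[of a] psi_phi[of b] ab by simp
  qed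
  have ff': "f (f' x) = x" if "x \<in> decomps_in H' n" for x
  proof (rule pp.linear_eq_on[OF plin_comp[OF f f'] plin_id(1) that[unfolded decomps_in_def]])
    fix p assume "p \<in> {mul H' (bs a) (bs b) |a b. 0 < H'.dg a \<and> 0 < H'.dg b \<and> H'.dg a + H'.dg b = n}"
    then obtain a b where ab: "p = mul H' (bs a) (bs b)" "0 < H'.dg a" "0 < H'.dg b" "H'.dg a + H'.dg b = n" by blast
    show "f (f' p) = p"
      using f'_bs[OF ab(2,3,4)] f_mul[OF B.phi_bs_hm B.phi_bs_hm ab(2,3,4)] phi_psi[of a] phi_psi[of b] ab by simp
  qed
  have "extension_problem (hm H.dg n) (decomps_in H n) (hm H'.dg n) (decomps_in H' n) f (\<lambda>x. tm \<phi> \<phi> (Dr H x)) (Dr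
      H') (prims_in H n) (prims_in H' n)"
  proof (rule extension_problem.intro)
    show "pv.subspace (decomps_in H n)" "pv.subspace (decomps_in H' n)" by (simp_all add: decomps_in_def)
    show "decomps_in H n \<subseteq> hm H.dg n" "decomps_in H' n \<subseteq> hm H'.dg n" by (rule H.decomps_in_hm H'.decomps_in_hm)+
    show "plin (\<lambda>x. tm \<phi> \<phi> (Dr H x))" by (rule plin_comp[OF plin_tm plin_Dr])
    show "f ` decomps_in H n = decomps_in H' n"
      using f_PP f'_PP ff' by (auto intro!: image_eqI[of _ f "f' _"])
    show "x = 0" if "x \<in> decomps_in H n" "f x = 0" for x
      using f'f[OF that(1)] that(2) by (simp add: pp.linear_0[OF f'])
    show "Dr H' (f x) = tm \<phi> \<phi> (Dr H x)" if "x \<in> decomps_in H n" for x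
    proof (rule pp.linear_eq_on[OF plin_comp[OF plin_Dr f] plin_comp[OF plin_tm plin_Dr] that[unfolded decomps_in_def]])
      fix p assume "p \<in> {mul H (bs a) (bs b) |a b. 0 < H.dg a \<and> 0 < H.dg b \<and> H.dg a + H.dg b = n}"
      then obtain a b where ab: "p = mul H (bs a) (bs b)" "0 < H.dg a" "0 < H.dg b" "H.dg a + H.dg b = n" by blast
      show "Dr H' (f p) = tm \<phi> \<phi> (Dr H p)"
        using A.Dr_mul_phi[OF ab(2,3,4)] f_bs[OF ab(2,3,4)] ab(1) by simp
    qed
    show "(\<lambda>x. tm \<phi> \<phi> (Dr H x)) ` hm H.dg n = Dr H' ` hm H'.dg n"
    proof (intro equalityI subsetI)
      fix t assume "t \<in> (\<lambda>x. tm \<phi> \<phi> (Dr H x)) ` hm H.dg n"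
      then obtain x where x: "x \<in> hm H.dg n" "t = tm \<phi> \<phi> (Dr H x)" by blast
      show "t \<in> Dr H' ` hm H'.dg n" using A.ex_Dr_lift[OF cofree(2) x(1)] x(2) by force
    next
      fix t assume "t \<in> Dr H' ` hm H'.dg n"
      then obtain y where y: "y \<in> hm H'.dg n" "t = Dr H' y" by blast
      obtain x where x: "x \<in> hm H.dg n" "Dr H x = tm \<psi> \<psi> (Dr H' y)"
        using B.ex_Dr_lift[OF cofree(1) y(1)] by blast
      then have "t = tm \<phi> \<phi> (Dr H x)" using tm_phi_psi[OF y(1)] y(2) by simp
      then show "t \<in> (\<lambda>x. tm \<phi> \<phi> (Dr H x)) ` hm H.dg n" using x(1) by blast
    qed
    \<comment> \<open>\<open>\<psi> \<otimes> \<psi>\<close> undoes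
      \<open>\<phi> \<otimes> \<phi>\<close> on reduced coproducts, so transporting them does not
      enlarge the kernel.\<close>
    show "prims_in H n = {x \<in> hm H.dg n. tm \<phi> \<phi> (Dr H x) = 0}"
      using tm_psi_phi by (force simp: prims_in_def pp.linear_0[OF plin_tm])
  qed (auto simp: prims_in_def f)
  then show ?thesis using f_bs by blast
qed

lemma quotient_iso_of_dim:
  assumes "dimH H n = dimH H' n"
  shows "\<exists>\<theta>. quotient_iso H H' n \<theta>"
proof -
  obtain f where "extension_problem (hm H.dg n) (decomps_in H n) (hm H'.dg n) (decomps_in H' n) f (\<lambda>x. tm \<phi> \<phi> (Dr H
      x)) (Dr H') (prims_in H n) (prims_in H' n)"
    using ex_problem by blast
  then interpret extension_problem "hm H.dg n" "decomps_in H n" "hm H'.dg n"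
      "decomps_in H' n" f "\<lambda>x. tm \<phi> \<phi> (Dr H x)" "Dr H'" "prims_in H n" "prims_in H' n" .
  have "\<exists>\<theta>. plin \<theta> \<and> (\<forall>x\<in>prims_in H n. \<theta> x \<in> prims_in H' n)
      \<and> (\<forall>x\<in>prims_in H n. \<theta> x \<in> decomps_in H' n \<longleftrightarrow> x \<in> decomps_in H n)
      \<and> (\<forall>y\<in>prims_in H' n. \<exists>x\<in>prims_in H n. y - \<theta> x \<in> decomps_in H' n)"
    by (rule ex_quotient_iso[of "bs ` {b. H.dg b = n}" "bs ` {b. H'.dg b = n}"])
       (use assms in \<open>auto simp: H.finite_degree H'.finite_degree H.dim_hm H'.dim_hm H.hm_span[symmetric]
           H'.hm_span[symmetric]\<close>)
  then show ?thesis unfolding quotient_iso_def by (auto simp: plin_iff)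
qed

text \<open>In degree n, products of positive factors are decomposable and all others involve a
  scalar; the coproduct is its reduced part plus two terms with the unit. So agreement of
  \<open>\<chi>\<close> with \<open>f\<close> and compatibility with \<open>Dr\<close> are all that
  must be checked. Agreement in degrees below \<open>n\<close> is recorded for the gluing.\<close>

lemma truncated_iso_Suc:
  assumes "quotient_iso H H' n \<theta>"
  shows "\<exists>\<phi>' \<psi>'. truncated_iso H H' (Suc n) \<phi>' \<psi>' \<and> (\<forall>b. H.dg b < n \<longrightarrow> \<phi>' (bs b) = \<phi> (bs b)) \<and> (\<forall>c. H'.dg c < n
      \<longrightarrow> \<psi>' (bs c) = \<psi> (bs c))"
proof -
  obtain f where ep: "extension_problem (hm H.dg n) (decomps_in H n) (hm H'.dg n) (decomps_in H' n) f (\<lambda>x. tm \<phi> \<phi>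
      (Dr H x)) (Dr H') (prims_in H n) (prims_in H' n)"
    and f_bs: "\<And>a b. 0 < H.dg a \<Longrightarrow> 0 < H.dg b \<Longrightarrow> H.dg a + H.dg b = n \<Longrightarrow> f (mul H (bs a) (bs b))
        = mul H' (\<phi> (bs a)) (\<phi> (bs b))"
    using ex_problem by blast
  interpret extension_problem "hm H.dg n" "decomps_in H n" "hm H'.dg n"
      "decomps_in H' n" f "\<lambda>x. tm \<phi> \<phi> (Dr H x)" "Dr H'" "prims_in H n" "prims_in H' n"
    by (rule ep)
  obtain \<chi> where chi: "plin \<chi>" "\<forall>x\<in>decomps_in H n. \<chi> x = f x" "\<chi> ` hm H.dg n = hm H'.dg n" "inj_on \<chi> (hm H.dg n)"
    "\<forall>x\<in>hm H.dg n. Dr H' (\<chi> x) = tm \<phi> \<phi> (Dr H x)"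
    using extend[of \<theta>] assms unfolding quotient_iso_def by blast
  obtain \<kappa> where "range \<kappa> \<subseteq> hm H.dg n \<and> plin \<kappa> \<and> (\<forall>v\<in>hm H.dg n. \<kappa> (\<chi> v) = v)"
    using pp.linear_exists_left_inverse_on[OF chi(1) subspace_hm chi(4)] ..
  then have kap: "range \<kappa> \<subseteq> hm H.dg n" "plin \<kappa>" "\<forall>v\<in>hm H.dg n. \<kappa> (\<chi> v) = v" by simp_all
  have chi_kap: "\<chi> (\<kappa> w) = w" if "w \<in> hm H'.dg n" for w
  proof -
    have "w \<in> \<chi> ` hm H.dg n" using that by (simp only: chi(3))
    then obtain v where "v \<in> hm H.dg n" "w = \<chi> v" by (elim imageE)
    then show ?thesis using kap(3) by simp
  qed
  \<comment> \<open>The two summands never overlap: \<open>\<phi>\<close> vanishes from degree n on,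
    and the second term outside degree n.\<close>
  define \<phi>' where "\<phi>' v = \<phi> v + \<chi> (hpart H.dg n v)" for v
  define \<psi>' where "\<psi>' w = \<psi> w + \<kappa> (hpart H'.dg n w)" for w
  have lin': "plin \<phi>'" "plin \<psi>'"
    unfolding \<phi>'_def \<psi>'_def
    by (rule plin_add[OF A.plin_phi plin_comp[OF chi(1) plin_hpart]] plin_add[OF B.plin_phi plin_comp[OF kap(2)
        plin_hpart]])+
  have p_hm: "\<phi>' v = (if k = n then \<chi> v else \<phi> v)" if "v \<in> hm H.dg k" for v k
    using hpart_of_hm[OF that, of n] A.phi_hm_zero[OF that] by (simp add: \<phi>'_def pp.linear_0[OF chi(1)])
  have q_hm: "\<psi>' v = (if k = n then \<kappa> v else \<psi> v)" if "v \<in> hm H'.dg k" for v k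
    using hpart_of_hm[OF that, of n] B.phi_hm_zero[OF that] by (simp add: \<psi>'_def pp.linear_0[OF kap(2)])
  have p_bs: "\<phi>' (bs b) = (if H.dg b = n then \<chi> (bs b) else \<phi> (bs b))" for b
    by (rule p_hm) simp
  have q_bs: "\<psi>' (bs b) = (if H'.dg b = n then \<kappa> (bs b) else \<psi> (bs b))" for b
    by (rule q_hm) simp
  have p_unt: "\<phi>' (unt H) = unt H'"
    using p_hm[OF H.unt_hm] n A.phi_unt by simp
  have chi_hm: "\<chi> v \<in> hm H'.dg n" if "v \<in> hm H.dg n" for v using imageI[OF that, of \<chi>] by (simp only: chi(3))
  have p_mul: "\<phi>' (mul H (bs a) (bs b)) = mul H' (\<phi>' (bs a)) (\<phi>' (bs b))" if ab: "H.dg a + H.dg b < Suc n" for a b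
  proof -
    consider "H.dg a + H.dg b < n" | "H.dg a = 0" | "H.dg b = 0" | "0 < H.dg a" "0 < H.dg b" "H.dg a + H.dg b = n"
      using ab by linarith
    then show ?thesis
    proof cases
      case 1
      have "\<phi>' (mul H (bs a) (bs b)) = \<phi> (mul H (bs a) (bs b))"
        using p_hm[OF H.mul_hm[of "bs a" "H.dg a" "bs b" "H.dg b"]] 1 by simp
      then show ?thesis using 1 A.phi_mul[of "bs a" "H.dg a" "bs b" "H.dg b"] by (simp add: p_bs)
    next
      case 2
      then show ?thesis
        by (simp add: H.bs_degree_0 pp.linear_scale[OF plin_mul_left] pp.linear_scale[OF lin'(1)] p_unt)
    next
      case 3
      then show ?thesis
        by (simp add: H.bs_degree_0[of b] pp.linear_scale[OF plin_mul_right] pp.linear_scale[OF lin'(1)] p_unt)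
    next
      case 4
      have m: "mul H (bs a) (bs b) \<in> hm H.dg n" using H.mul_hm[of "bs a" "H.dg a" "bs b" "H.dg b"] 4 by simp
      have "mul H (bs a) (bs b) \<in> decomps_in H n" using H.mul_mem_decomps_in[of "bs a" "H.dg a" "bs b" "H.dg b"] 4 by simp
      then have "\<phi>' (mul H (bs a) (bs b)) = mul H' (\<phi> (bs a)) (\<phi> (bs b))"
        using p_hm[OF m] chi(2) f_bs[OF 4] by simp
      then show ?thesis using 4 by (simp add: p_bs)
    qed
  qed
  have p_Dl: "Dl H' (\<phi>' (bs a)) = tm \<phi>' \<phi>' (Dl H (bs a))" if a: "H.dg a < Suc n" for a
  proof (cases "H.dg a = n")
    case False
    then have an: "H.dg a < n" using a by simp
    have "tm \<phi>' \<phi>' (Dl H (bs a)) = tm \<phi> \<phi> (Dl H (bs a))"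
      by (rule tm_cong) (use H.keys_Dl[of "bs a" "H.dg a"] an in \<open>fastforce simp: p_bs\<close>)+
    then show ?thesis using A.phi_Dl[of "bs a" "H.dg a"] an by (simp add: p_bs)
  next
    case True
    \<comment> \<open>Only the two unit terms contain a factor of degree n, where
      \<open>\<phi>'\<close> differs from \<open>\<phi>\<close>; the reduced part still sees
      \<open>\<phi>\<close>.\<close>
    have h: "bs a \<in> hm H.dg n" using True by simp
    have "tm \<phi>' \<phi>' (Dr H (bs a)) = tm \<phi> \<phi> (Dr H (bs a))"
      by (rule tm_cong) (use H.keys_Dr[OF h] in \<open>fastforce simp: p_bs\<close>)+
    then have "tm \<phi>' \<phi>' (Dl H (bs a)) = tns (\<phi>' (bs a)) (unt H') + tns (unt H') (\<phi>' (bs a)) + tm \<phi> \<phi> (Dr H (bs a))"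
      using H.Dl_split[OF h n] by (simp add: pp.linear_add[OF plin_tm] lin' p_unt)
    also have "\<dots> = Dl H' (\<phi>' (bs a))"
      using H'.Dl_split[OF chi_hm[OF h] n] chi(5) h True by (simp add: p_bs)
    finally show ?thesis ..
  qed
  have "truncated_iso H H' (Suc n) \<phi>' \<psi>'"
    unfolding truncated_iso_def truncated_hom_axiom_def
  proof (intro conjI allI impI lin' p_mul p_Dl p_unt)
    fix b assume "H.dg b < Suc n"
    then show "\<phi>' (bs b) \<in> hm H'.dg (H.dg b)"
      using chi_hm[of "bs b"] A.phi_bs_hm[of b] by (simp add: p_bs)
    show "\<psi>' (\<phi>' (bs b)) = bs b"
    proof (cases "H.dg b = n")
      case True
      then show ?thesis using q_hm[OF chi_hm[of "bs b"]] kap(3) by (simp add: p_bs)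
    next
      case False
      then show ?thesis using q_hm[OF A.phi_bs_hm[of b]] psi_phi[of b] \<open>H.dg b < Suc n\<close> by (simp add: p_bs)
    qed
  next
    fix c assume "H'.dg c < Suc n"
    then show "\<psi>' (bs c) \<in> hm H.dg (H'.dg c)"
      using kap(1) B.phi_bs_hm[of c] by (auto simp: q_bs)
    show "\<phi>' (\<psi>' (bs c)) = bs c"
    proof (cases "H'.dg c = n")
      case True
      then show ?thesis using p_hm[of "\<kappa> (bs c)" n] kap(1) chi_kap[of "bs c"] by (auto simp: q_bs)
    next
      case False
      then show ?thesis using p_hm[OF B.phi_bs_hm[of c]] phi_psi[of c] \<open>H'.dg c < Suc n\<close> by (simp add: q_bs)
    qed
  next
    fix b assume "Suc n \<le> H.dg b"
    then show "\<phi>' (bs b) = 0" using A.phi_zero[of b] by (simp add: p_bs)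
  next
    fix c assume "Suc n \<le> H'.dg c"
    then show "\<psi>' (bs c) = 0" using B.phi_zero[of c] by (simp add: q_bs)
  qed
  then show ?thesis using p_bs q_bs by (metis less_irrefl)
qed

end

text \<open>In degree 0 both algebras are spanned by their units. The counit gives the coordinate
  with respect to the unit, so it describes the map sending unit to unit.\<close>

lemma ex_truncated_iso_1:
  fixes H :: "('b, 'k::field) hopf_data" and H' :: "('c, 'k) hopf_data"
  assumes "gcb H" "gcb H'"
  shows "\<exists>\<phi> \<psi>. truncated_iso H H' 1 \<phi> \<psi>"
proof -
  interpret H: gcb H by fact
  interpret H': gcb H' by fact
  define \<phi> :: "('b \<Rightarrow>\<^sub>0 'k) \<Rightarrow> ('c \<Rightarrow>\<^sub>0 'k)"
    where "\<phi> = pext (\<lambda>b. if H.dg b = 0 then psc (counit H b) (unt H') else 0)"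
  define \<psi> :: "('c \<Rightarrow>\<^sub>0 'k) \<Rightarrow> ('b \<Rightarrow>\<^sub>0 'k)"
    where "\<psi> = pext (\<lambda>c. if H'.dg c = 0 then psc (counit H' c) (unt H) else 0)"
  have lin: "plin \<phi>" "plin \<psi>" by (simp_all add: \<phi>_def \<psi>_def)
  have bs: "\<phi> (bs b) = psc (counit H b) (unt H')" "\<psi> (bs c) = psc (counit H' c) (unt H)"
    if "H.dg b = 0" "H'.dg c = 0" for b c using that by (simp_all add: \<phi>_def \<psi>_def)
  obtain b0 where b0: "\<And>b. H.dg b = 0 \<longleftrightarrow> b = b0" using H.degree_0 by metis
  obtain c0 where c0: "\<And>c. H'.dg c = 0 \<longleftrightarrow> c = c0" using H'.degree_0 by metis
  have d0: "H.dg b0 = 0" "H'.dg c0 = 0" using b0 c0 by auto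
  have unt: "\<phi> (unt H) = unt H'" "\<psi> (unt H') = unt H"
    using H.unit_coordinate[OF b0] H'.unit_coordinate[OF c0] bs[OF d0]
    by (metis mult.commute pp.linear_scale[OF lin(1)] pv.scale_scale pv.scale_one)
       (metis H.unit_coordinate[OF b0] H'.unit_coordinate[OF c0] bs[OF d0] mult.commute pp.linear_scale[OF lin(2)]
           pv.scale_scale pv.scale_one)
  have B: "bs b = psc (counit H b) (unt H)" if "H.dg b = 0" for b by (rule H.bs_degree_0[OF that])
  have C: "bs c = psc (counit H' c) (unt H')" if "H'.dg c = 0" for c by (rule H'.bs_degree_0[OF that])
  have "truncated_iso H H' 1 \<phi> \<psi>"
    unfolding truncated_iso_def truncated_hom_axiom_def
  proof (intro conjI allI impI lin unt)
    show "\<phi> (bs b) \<in> hm H'.dg (H.dg b)" if "H.dg b < 1" for b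
      using that d0 by (simp add: bs pv.subspace_scale[OF subspace_hm])
    show "\<psi> (bs b) \<in> hm H.dg (H'.dg b)" if "H'.dg b < 1" for b
      using that d0 by (simp add: bs pv.subspace_scale[OF subspace_hm])
    show "\<phi> (mul H (bs a) (bs b)) = mul H' (\<phi> (bs a)) (\<phi> (bs b))" if "H.dg a + H.dg b < 1" for a b
      using that by (simp add: B pp.linear_scale[OF plin_mul_left] pp.linear_scale[OF plin_mul_right]
          pp.linear_scale[OF lin(1)] unt)
    show "Dl H' (\<phi> (bs a)) = tm \<phi> \<phi> (Dl H (bs a))" if "H.dg a < 1" for a
      using that by (simp add: B pp.linear_scale[OF plin_Dl] pp.linear_scale[OF plin_tm] pp.linear_scale[OF lin(1)]
          unt H.Dl_unt H'.Dl_unt lin)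
    show "\<psi> (\<phi> (bs b)) = bs b" if "H.dg b < 1" for b
      using that by (simp add: B pp.linear_scale[OF lin(1)] pp.linear_scale[OF lin(2)] unt)
    show "\<phi> (\<psi> (bs c)) = bs c" if "H'.dg c < 1" for c
      using that by (simp add: C pp.linear_scale[OF lin(1)] pp.linear_scale[OF lin(2)] unt)
    show "\<phi> (bs b) = 0" if "1 \<le> H.dg b" for b using that by (simp add: \<phi>_def)
    show "\<psi> (bs b) = 0" if "1 \<le> H'.dg b" for b using that by (simp add: \<psi>_def)
  qed
  then show ?thesis by blast
qed

section \<open>Gluing\<close>

text \<open>Compatibility with the counits is a consequence: they vanish in positive degrees and are
  normalised on the units. The structural properties of \<open>\<Psi>\<close> are derived in
  \<open>bialg_iso_sym\<close>.\<close>

definition bialg_iso :: "('b, 'k::field) hopf_data \<Rightarrow> ('c, 'k) hopf_data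
    \<Rightarrow> (('b \<Rightarrow>\<^sub>0 'k) \<Rightarrow> ('c \<Rightarrow>\<^sub>0 'k)) \<Rightarrow> (('c \<Rightarrow>\<^sub>0 'k) \<Rightarrow> ('b \<Rightarrow>\<^sub>0 'k)) \<Rightarrow> bool" where
  "bialg_iso H H' \<Phi> \<Psi> \<longleftrightarrow> plin \<Phi> \<and> plin \<Psi> \<and> (\<forall>b. \<Phi> (bs b) \<in> hm (deg H') (deg H b)) \<and>
     (\<forall>v. \<Psi> (\<Phi> v) = v) \<and> (\<forall>w. \<Phi> (\<Psi> w) = w) \<and>
     (\<forall>a b. \<Phi> (mul H (bs a) (bs b)) = mul H' (\<Phi> (bs a)) (\<Phi> (bs b))) \<and> \<Phi> (unt H) = unt H' \<and>
     (\<forall>a. Dl H' (\<Phi> (bs a)) = tm \<Phi> \<Phi> (Dl H (bs a)))"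

text \<open>\<open>quot\<close> must accept every truncated isomorphism, since the one reached at a
  given stage results from choices. Each stage keeps the previous degrees, so the limit can be read
  off degree by degree.\<close>

lemma ex_bialg_iso:
  fixes H :: "('b, 'k::field) hopf_data" and H' :: "('c, 'k) hopf_data"
  assumes "gcb H" "gcb H'" and free: "free_hopf H" "free_hopf H'" and cofree: "cofree_hopf H" "cofree_hopf H'"
    and quot: "\<And>n \<phi> \<psi>. 0 < n \<Longrightarrow> truncated_iso H H' n \<phi> \<psi> \<Longrightarrow> \<exists>\<theta>. quotient_iso H H' n \<theta>"
  shows "\<exists>\<Phi> \<Psi>. bialg_iso H H' \<Phi> \<Psi>"
proof -
  interpret H: gcb H by fact
  interpret H': gcb H' by fact
  \<comment> \<open>Stage n covers the degrees up to and including n, whence \<open>Suc n\<close>;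
    stage 0 matches the units.\<close>
  define S where "S n x = truncated_iso H H' (Suc n) (fst x) (snd x)"
    for n and x :: "(('b \<Rightarrow>\<^sub>0 'k) \<Rightarrow> ('c \<Rightarrow>\<^sub>0 'k)) \<times> (('c \<Rightarrow>\<^sub>0 'k) \<Rightarrow> ('b \<Rightarrow>\<^sub>0 'k))"
  define Q where "Q n x y \<longleftrightarrow> (\<forall>b. H.dg b < Suc n \<longrightarrow> fst y (bs b) = fst x (bs b)) \<and> (\<forall>c. H'.dg c < Suc n
      \<longrightarrow> snd y (bs c) = snd x (bs c))"
    for n and x y :: "(('b \<Rightarrow>\<^sub>0 'k) \<Rightarrow> ('c \<Rightarrow>\<^sub>0 'k)) \<times> (('c \<Rightarrow>\<^sub>0 'k) \<Rightarrow> ('b \<Rightarrow>\<^sub>0 'k))"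
  have "\<exists>f. \<forall>n. S n (f n) \<and> Q n (f n) (f (Suc n))"
  proof (rule dependent_nat_choice)
    show "\<exists>x. S 0 x" using ex_truncated_iso_1[OF assms(1,2)] by (auto simp: S_def)
    fix x n assume x: "S n x"
    then have st: "truncated_iso H H' (Suc n) (fst x) (snd x)" by (simp add: S_def)
    interpret extension_step H H' "Suc n" "fst x" "snd x"
      by unfold_locales (use st free cofree in auto)
    obtain \<theta> where "quotient_iso H H' (Suc n) \<theta>" using quot[OF _ st] by blast
    from truncated_iso_Suc[OF this] obtain \<phi>' \<psi>' where *: "truncated_iso H H' (Suc (Suc n)) \<phi>' \<psi>'"
      "\<forall>b. H.dg b < Suc n \<longrightarrow> \<phi>' (bs b) = fst x (bs b)" "\<forall>c. H'.dg c < Suc n \<longrightarrow> \<psi>' (bs c) = snd x (bs c)"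
      by blast
    show "\<exists>y. S (Suc n) y \<and> Q n x y"
      by (rule exI[of _ "(\<phi>', \<psi>')"]) (use * in \<open>simp add: S_def Q_def\<close>)
  qed
  then obtain f where f: "\<And>n. S n (f n)" "\<And>n. Q n (f n) (f (Suc n))" by blast
  define p where "p n = fst (f n)" for n
  define q where "q n = snd (f n)" for n
  have st: "truncated_iso H H' (Suc n) (p n) (q n)" for n using f(1) by (simp add: S_def p_def q_def)
  have st': "truncated_iso H' H (Suc n) (q n) (p n)" for n
    by (rule truncated_iso_sym[OF assms(1,2) st]) simp
  have T: "truncated_hom H H' (Suc n) (p n)" "truncated_hom H' H (Suc n) (q n)" for n
    by (intro truncated_hom.intro truncated_hom_axioms.intro assms(1,2); use st st' in \<open>simp add: truncated_iso_def\<close>)+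
  note lin = truncated_hom.plin_phi[OF T(1)] truncated_hom.plin_phi[OF T(2)]
  have agree: "p (n + k) (bs b) = p n (bs b)" "q (n + k) (bs c) = q n (bs c)" if "H.dg b \<le> n" "H'.dg c \<le> n" for n k b c
    by (induction k) (use f(2)[of "n + k" for k] that in \<open>auto simp: Q_def p_def q_def less_Suc_eq_le trans_le_add1\<close>)
  \<comment> \<open>\<open>agree\<close> treats both sides at once; vectors of degree 0 fill the
    side that is not of interest.\<close>
  obtain b0 c0 where b0: "H.dg b0 = 0" "H'.dg c0 = 0"
    using H.degree_0 H'.degree_0 by metis
  \<comment> \<open>A basis vector of degree d takes its value from stage d, the first stage that
    covers it.\<close>
  define \<Phi> where "\<Phi> = pext (\<lambda>b. p (H.dg b) (bs b))"
  define \<Psi> where "\<Psi> = pext (\<lambda>c. q (H'.dg c) (bs c))"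
  have lin': "plin \<Phi>" "plin \<Psi>" by (simp_all add: \<Phi>_def \<Psi>_def)
  have P_bs: "\<Phi> (bs b) = p N (bs b)" if "H.dg b \<le> N" for b N
    using agree(1)[of b "H.dg b" c0 "N - H.dg b"] that b0 by (simp add: \<Phi>_def)
  have Q_bs: "\<Psi> (bs c) = q N (bs c)" if "H'.dg c \<le> N" for c N
    using agree(2)[of b0 "H'.dg c" c "N - H'.dg c"] that b0 by (simp add: \<Psi>_def)
  have P_hm: "\<Phi> v = p N v" if "v \<in> hm H.dg N" for v N
    by (rule plin_eq_hm[OF lin'(1) lin(1) that]) (simp add: P_bs)
  have Q_hm: "\<Psi> v = q N v" if "v \<in> hm H'.dg N" for v N
    by (rule plin_eq_hm[OF lin'(2) lin(2) that]) (simp add: Q_bs)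
  have "bialg_iso H H' \<Phi> \<Psi>"
    unfolding bialg_iso_def
  proof (intro conjI allI lin')
    show "\<Phi> (bs b) \<in> hm H'.dg (H.dg b)" for b
      using truncated_hom.phi_bs_hm[OF T(1)] P_bs[of b "H.dg b"] by simp
    show "\<Psi> (\<Phi> v) = v" for v
    proof (rule plin_eqI[OF plin_comp[OF lin'(2) lin'(1)] plin_id(1)])
      fix b
      have "\<Psi> (\<Phi> (bs b)) = q (H.dg b) (p (H.dg b) (bs b))"
        using Q_hm[OF truncated_hom.phi_bs_hm[OF T(1)[of "H.dg b"], of b]] P_bs[of b "H.dg b"] by simp
      then show "\<Psi> (\<Phi> (bs b)) = bs b" using st[of "H.dg b"] by (simp add: truncated_iso_def)
    qed
    show "\<Phi> (\<Psi> w) = w" for w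
    proof (rule plin_eqI[OF plin_comp[OF lin'(1) lin'(2)] plin_id(1)])
      fix c
      have "\<Phi> (\<Psi> (bs c)) = p (H'.dg c) (q (H'.dg c) (bs c))"
        using P_hm[OF truncated_hom.phi_bs_hm[OF T(2)[of "H'.dg c"], of c]] Q_bs[of c "H'.dg c"] by simp
      then show "\<Phi> (\<Psi> (bs c)) = bs c" using st[of "H'.dg c"] by (simp add: truncated_iso_def)
    qed
    show "\<Phi> (mul H (bs a) (bs b)) = mul H' (\<Phi> (bs a)) (\<Phi> (bs b))" for a b
      using truncated_hom.phi_mul[OF T(1)[of "H.dg a + H.dg b"], of "bs a" "H.dg a" "bs b" "H.dg b"]
        P_hm[OF H.mul_hm[of "bs a" "H.dg a" "bs b" "H.dg b"]] P_bs[of a "H.dg a + H.dg b"] P_bs[of b "H.dg a + H.dg b"]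
      by simp
    show "\<Phi> (unt H) = unt H'"
      using P_hm[OF H.unt_hm] truncated_hom.phi_unt[OF T(1)] by simp
    show "Dl H' (\<Phi> (bs a)) = tm \<Phi> \<Phi> (Dl H (bs a))" for a
    proof -
      have "tm \<Phi> \<Phi> (Dl H (bs a)) = tm (p (H.dg a)) (p (H.dg a)) (Dl H (bs a))"
        by (rule tm_cong) (auto intro!: P_bs dest: H.keys_Dl[of "bs a" "H.dg a", rotated])
      then show ?thesis
        using truncated_hom.phi_Dl[OF T(1)[of "H.dg a"], of "bs a" "H.dg a"] P_bs[of a "H.dg a"] by simp
    qed
  qed
  then show ?thesis by blast
qed

section \<open>Consequences of a bialgebra isomorphism and its translation to structure
  constants\<close>

lemma bialg_isoD:
  assumes "bialg_iso H H' \<Phi> \<Psi>"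
  shows "plin \<Phi>" "plin \<Psi>" "\<And>v. \<Psi> (\<Phi> v) = v" "\<And>w. \<Phi> (\<Psi> w) = w" "\<Phi> (unt H) = unt H'"
    "\<And>b. \<Phi> (bs b) \<in> hm (deg H') (deg H b)"
    "\<And>u v. \<Phi> (mul H u v) = mul H' (\<Phi> u) (\<Phi> v)" "\<And>v. Dl H' (\<Phi> v) = tm \<Phi> \<Phi> (Dl H v)"
    "\<And>v n. v \<in> hm (deg H) n \<Longrightarrow> \<Phi> v \<in> hm (deg H') n"
proof -
  show lin: "plin \<Phi>" "plin \<Psi>" and "\<And>v. \<Psi> (\<Phi> v) = v" "\<And>w. \<Phi> (\<Psi> w) = w" "\<Phi> (unt H) = unt H'"
    and hm: "\<And>b. \<Phi> (bs b) \<in> hm (deg H') (deg H b)"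
    using assms by (simp_all add: bialg_iso_def)
  show "\<Phi> (mul H u v) = mul H' (\<Phi> u) (\<Phi> v)" for u v
    by (rule bilinear_eqI[of "\<lambda>u v. \<Phi> (mul H u v)" "\<lambda>u v. mul H' (\<Phi> u) (\<Phi> v)"])
       (use assms in \<open>auto simp: bialg_iso_def
           intro: plin_comp[OF lin(1) plin_mul_left] plin_comp[OF lin(1) plin_mul_right]
         plin_comp[OF plin_mul_left lin(1)] plin_comp[OF plin_mul_right lin(1)]\<close>)
  show "Dl H' (\<Phi> v) = tm \<Phi> \<Phi> (Dl H v)" for v
    by (rule plin_eqI[OF plin_comp[OF plin_Dl lin(1)] plin_comp[OF plin_tm plin_Dl]])
       (use assms in \<open>simp add: bialg_iso_def\<close>)
  show "\<Phi> v \<in> hm (deg H') n" if "v \<in> hm (deg H) n" for v n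
    by (rule plin_hm[OF lin(1) that]) (use hm in auto)
qed

lemma bialg_iso_sym:
  assumes "bialg_iso H H' \<Phi> \<Psi>"
  shows "bialg_iso H' H \<Psi> \<Phi>"
proof -
  note P = bialg_isoD[OF assms]
  have hm: "\<Psi> (bs c) \<in> hm (deg H) (deg H' c)" for c
  proof -
    \<comment> \<open>Gradedness of the inverse: \<open>\<Phi>\<close> commutes with homogeneous
      components, so projecting the preimage of a homogeneous vector does not change it.\<close>
    have "hpart (deg H) (deg H' c) (\<Psi> (bs c)) = \<Psi> (\<Phi> (hpart (deg H) (deg H' c) (\<Psi> (bs c))))" by (simp add: P)
    also have "\<dots> = \<Psi> (hpart (deg H') (deg H' c) (\<Phi> (\<Psi> (bs c))))"
      using hpart_commute[OF P(1) P(6)] by simp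
    also have "\<dots> = \<Psi> (bs c)" by (simp add: P hpart_bs)
    finally show ?thesis using hpart_hm by metis
  qed
  have mul: "\<Psi> (mul H' u v) = mul H (\<Psi> u) (\<Psi> v)" for u v
    using P(7)[of "\<Psi> u" "\<Psi> v"] P(3)[of "mul H (\<Psi> u) (\<Psi> v)"] by (simp add: P(4))
  have "\<Psi> (unt H') = unt H" using P(3)[of "unt H"] P(5) by simp
  moreover have "Dl H (\<Psi> w) = tm \<Psi> \<Psi> (Dl H' w)" for w
  proof -
    have "tm \<Psi> \<Psi> (Dl H' w) = tm \<Psi> \<Psi> (tm \<Phi> \<Phi> (Dl H (\<Psi> w)))" using P(8)[of "\<Psi> w"] by (simp add: P(4))
    also have "\<dots> = Dl H (\<Psi> w)" by (simp add: tm_tm P tm_ident)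
    finally show ?thesis ..
  qed
  ultimately show ?thesis using P hm mul by (simp add: bialg_iso_def)
qed

lemma hopf_isomorphic_of_bialg_iso:
  assumes "gcb H" "gcb H'" and iso: "bialg_iso H H' \<Phi> \<Psi>"
  shows "hopf_isomorphic H H'"
proof -
  interpret H: gcb H by fact
  interpret H': gcb H' by fact
  note P = bialg_isoD[OF iso]
  have l: "lin (\<lambda>a. lookup (\<Phi> (bs a))) (lookup v) = lookup (\<Phi> v)"
    "lin (\<lambda>c. lookup (\<Psi> (bs c))) (lookup w) = lookup (\<Psi> w)" for v w
    using plin_expand[OF P(1), of v] plin_expand[OF P(2), of w] by (simp_all add: lin_lookup)
  \<comment> \<open>In degree 0 the basis vector is its counit times the unit, which
    \<open>\<Phi>\<close> preserves; in other degrees both sides vanish.\<close>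
  have c: "hcounit H' (lookup (\<Phi> (bs a))) = counit H a" for a
  proof (cases "H.dg a = 0")
    case True
    have "\<Phi> (bs a) = psc (counit H a) (unt H')"
      using H.bs_degree_0[OF True] by (simp add: pp.linear_scale[OF P(1)] P(5))
    then have "hcounit H' (lookup (\<Phi> (bs a))) = (\<Sum>b\<in>keys (unt H'). counit H a * lookup (unt H') b * counit H' b)"
      unfolding hcounit_def lfun_def supp_lookup
      by (simp only: lookup_psc) (rule sum.mono_neutral_left, auto simp: in_keys_iff)
    also have "\<dots> = counit H a * hcounit H' (one_vec H')"
      by (simp add: hcounit_def lfun_def supp_lookup H'.one_lookup sum_distrib_left mult.assoc)
    finally show ?thesis by (simp add: H'.hcounit_one)
  next
    case False
    have "counit H' b = 0" if "b \<in> keys (\<Phi> (bs a))" for b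
      using H'.counit_degree[of b] hmD[OF P(6) that] False by auto
    then have "hcounit H' (lookup (\<Phi> (bs a))) = 0"
      by (simp add: hcounit_def lfun_def supp_lookup)
    then show ?thesis using H.counit_degree[of a] False by auto
  qed
  have "hopf_iso H H' (\<lambda>a. lookup (\<Phi> (bs a)))"
    unfolding hopf_iso_def
  proof (intro conjI allI impI c)
    show "H'.dg c = H.dg a" if "lookup (\<Phi> (bs a)) c \<noteq> 0" for a c
      using hmD[OF P(6)[of a], of c] that by (simp add: in_keys_iff)
    show "\<exists>G. (\<forall>c. fsupp (G c)) \<and> (\<forall>a. lin G (lookup (\<Phi> (bs a))) = bas a)
        \<and> (\<forall>c. lin (\<lambda>a. lookup (\<Phi> (bs a))) (G c) = bas c)"
      by (rule exI[of _ "\<lambda>c. lookup (\<Psi> (bs c))"]) (simp add: l P bas_lookup)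
    show "lin (\<lambda>a. lookup (\<Phi> (bs a))) (hmul H (bas a) (bas b)) = hmul H' (lookup (\<Phi> (bs a))) (lookup (\<Phi> (bs b)))" for a b
      by (simp add: bas_lookup H.hmul_lookup H'.hmul_lookup l P(7))
    show "lin (\<lambda>a. lookup (\<Phi> (bs a))) (one_vec H) = one_vec H'"
      by (simp add: H.one_lookup H'.one_lookup l P(5))
    show "hDelta H' (lookup (\<Phi> (bs a))) = lin (tmap (\<lambda>a. lookup (\<Phi> (bs a))) (\<lambda>a. lookup (\<Phi> (bs a)))) (delta H a)" for a
    proof -
      have "tmap (\<lambda>a. lookup (\<Phi> (bs a))) (\<lambda>a. lookup (\<Phi> (bs a)))
          = (\<lambda>p. lookup (case p of (x, y) \<Rightarrow> tns (\<Phi> (bs x)) (\<Phi> (bs y))))"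
        by (auto simp: tmap_def tens_lookup)
      then show ?thesis
        by (simp add: H'.hDelta_lookup P(8) H.delta_lookup lin_lookup tm_def)
    qed
  qed simp
  then show ?thesis unfolding hopf_isomorphic_def by blast
qed

lemma bialg_iso_of_hopf_iso:
  fixes H :: "('b, 'k::field) hopf_data" and H' :: "('c, 'k) hopf_data"
  assumes "gcb H" "gcb H'" and iso: "hopf_iso H H' F"
  shows "\<exists>\<Phi> \<Psi>. bialg_iso H H' \<Phi> \<Psi>"
proof -
  interpret H: gcb H by fact
  interpret H': gcb H' by fact
  obtain G where G: "\<forall>c. fsupp (G c)" "\<forall>a. lin G (F a) = bas a" "\<forall>c. lin F (G c) = bas c"
    using iso unfolding hopf_iso_def by blast
  have F: "\<forall>a. fsupp (F a)" "\<forall>a c. F a c \<noteq> 0 \<longrightarrow> H'.dg c = H.dg a"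
    "\<forall>a b. lin F (hmul H (bas a) (bas b)) = hmul H' (F a) (F b)" "lin F (one_vec H) = one_vec H'"
    "\<forall>a. hDelta H' (F a) = lin (tmap F F) (delta H a)"
    using iso unfolding hopf_iso_def by blast+
  define \<Phi> where "\<Phi> = pext (\<lambda>a. pm (F a))"
  define \<Psi> where "\<Psi> = pext (\<lambda>c. pm (G c))"
  have lin: "plin \<Phi>" "plin \<Psi>" by (simp_all add: \<Phi>_def \<Psi>_def)
  have Fa: "F a = lookup (\<Phi> (bs a))" and Gc: "G c = lookup (\<Psi> (bs c))" for a c
    using F(1) G(1) by (simp_all add: \<Phi>_def \<Psi>_def lookup_pm)
  have l: "lin F (lookup v) = lookup (\<Phi> v)" "lin G (lookup w) = lookup (\<Psi> w)" for v w
    unfolding \<Phi>_def \<Psi>_def by (rule lin_lookup', simp add: lookup_pm F(1) G(1))+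
  have "bialg_iso H H' \<Phi> \<Psi>"
    unfolding bialg_iso_def
  proof (intro conjI allI lin)
    show "\<Phi> (bs b) \<in> hm H'.dg (H.dg b)" for b
      using F(2) by (auto simp: hm_def in_keys_iff Fa[symmetric])
    show "\<Psi> (\<Phi> v) = v" for v
      by (rule plin_eqI[OF plin_comp[OF lin(2) lin(1)] plin_id(1)])
         (use G(2) in \<open>simp add: Fa l bas_lookup lookup_inj\<close>)
    show "\<Phi> (\<Psi> w) = w" for w
      by (rule plin_eqI[OF plin_comp[OF lin(1) lin(2)] plin_id(1)])
         (use G(3) in \<open>simp add: Gc l bas_lookup lookup_inj\<close>)
    show "\<Phi> (mul H (bs a) (bs b)) = mul H' (\<Phi> (bs a)) (\<Phi> (bs b))" for a b
      using F(3) by (simp add: Fa bas_lookup H.hmul_lookup H'.hmul_lookup l lookup_inj)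
    show "\<Phi> (unt H) = unt H'"
      using F(4) by (simp add: H.one_lookup H'.one_lookup l lookup_inj)
    show "Dl H' (\<Phi> (bs a)) = tm \<Phi> \<Phi> (Dl H (bs a))" for a
    proof -
      have "tmap F F = (\<lambda>p. lookup (case p of (x, y) \<Rightarrow> tns (\<Phi> (bs x)) (\<Phi> (bs y))))"
        by (auto simp: tmap_def tens_lookup Fa fun_eq_iff)
      then have "lookup (Dl H' (\<Phi> (bs a))) = lookup (tm \<Phi> \<Phi> (Dl H (bs a)))"
        using F(5) by (simp add: Fa H'.hDelta_lookup H.delta_lookup lin_lookup tm_def)
      then show ?thesis by (simp only: lookup_inj)
    qed
  qed
  then show ?thesis by blast
qed

lemma bialg_iso_dimH:
  fixes H :: "('b, 'k::field) hopf_data" and H' :: "('c, 'k) hopf_data"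
  assumes "gcb H" "gcb H'" and iso: "bialg_iso H H' \<Phi> \<Psi>"
  shows "dimH H n = dimH H' n"
proof -
  interpret H: gcb H by fact
  interpret H': gcb H' by fact
  note P = bialg_isoD[OF iso]
  let ?B = "bs ` {b. H.dg b = n} :: ('b \<Rightarrow>\<^sub>0 'k) set"
  have inj: "inj \<Phi>" by (rule inj_on_inverseI[of _ \<Psi>]) (simp add: P)
  have "hm H'.dg n = \<Phi> ` hm H.dg n"
  proof (intro equalityI subsetI)
    fix w :: "'c \<Rightarrow>\<^sub>0 'k" assume "w \<in> hm H'.dg n"
    then have "\<Psi> w \<in> hm H.dg n" by (rule bialg_isoD(9)[OF bialg_iso_sym[OF iso]])
    then show "w \<in> \<Phi> ` hm H.dg n" using P(4)[of w] by (metis imageI)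
  qed (use P(9) in auto)
  then have sp: "hm H'.dg n = pv.span (\<Phi> ` ?B)"
    unfolding H.hm_span pp.linear_span_image[OF P(1)] .
  have ind: "pv.independent (\<Phi> ` ?B)"
    by (rule pp.linear_independent_injective_image[OF P(1) independent_bs[OF H.finite_degree]])
       (rule inj_on_subset[OF inj subset_UNIV])
  have "dimH H' n = card (\<Phi> ` ?B)"
    unfolding H'.dim_hm[symmetric] sp pv.dim_span by (rule pv.dim_eq_card_independent[OF ind])
  also have "\<dots> = card ?B" by (rule card_image[OF inj_on_subset[OF inj subset_UNIV]])
  also have "\<dots> = dimH H n"
    unfolding H.dim_hm[symmetric] H.hm_span pv.dim_span
    by (rule pv.dim_eq_card_independent[OF independent_bs[OF H.finite_degree], symmetric])
  finally show ?thesis ..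
qed

section \<open>Primitive elements modulo decomposables\<close>

definition decomps :: "('b, 'k::field) hopf_data \<Rightarrow> ('b \<Rightarrow>\<^sub>0 'k) set" where
  "decomps H = pv.span {mul H (bs a) (bs b) |a b. 0 < deg H a \<and> 0 < deg H b}"

definition prims :: "('b, 'k::field) hopf_data \<Rightarrow> ('b \<Rightarrow>\<^sub>0 'k) set" where
  "prims H = {p. Dl H p = tns p (unt H) + tns (unt H) p}"

context gcb
begin

lemma mul_mem_decomps:
  assumes "\<And>a. a \<in> keys u \<Longrightarrow> 0 < dg a" "\<And>b. b \<in> keys v \<Longrightarrow> 0 < dg b"
  shows "mul H u v \<in> decomps H"
proof (rule plin_mem[OF plin_mul_left])
  fix a assume a: "a \<in> keys u"
  show "mul H (bs a) v \<in> decomps H"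
  proof (rule plin_mem[OF plin_mul_right])
    fix b assume "b \<in> keys v"
    then show "mul H (bs a) (bs b) \<in> decomps H"
      unfolding decomps_def using a assms by (intro pv.span_base) auto
  qed (simp add: decomps_def)
qed (simp add: decomps_def)

lemma Hplus_lookup: "lookup u \<in> Hplus H \<longleftrightarrow> (\<forall>a\<in>keys u. 0 < dg a)"
  by (auto simp: Hplus_def in_keys_iff Suc_le_eq)

text \<open>One direction expands each product bilinearly over the basis. In the other, the scalars
  of a linear combination are absorbed into the first factors, and the combination is enumerated by
  an initial segment of the naturals.\<close>

lemma Hplus2_lookup: "lookup p \<in> Hplus2 H \<longleftrightarrow> p \<in> decomps H"
proof
  assume "lookup p \<in> Hplus2 H"
  then obtain m :: nat and u w where uw: "lookup p = (\<Sum>i<m. hmul H (u i) (w i))" "\<forall>i<m. u i \<in> Hplus H \<and> w i \<in> Hplus H"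
    unfolding Hplus2_def by blast
  have fs: "lookup (pm (u i)) = u i" "lookup (pm (w i)) = w i" if "i < m" for i
    using uw(2) that by (auto simp: Hplus_def intro!: lookup_pm)
  have "lookup p = (\<Sum>i<m. lookup (mul H (pm (u i)) (pm (w i))))"
    unfolding uw(1) by (rule sum.cong) (simp_all add: hmul_lookup[symmetric] fs)
  then have "p = (\<Sum>i<m. mul H (pm (u i)) (pm (w i)))" by (simp only: sum_lookup lookup_inj)
  moreover have "mul H (pm (u i)) (pm (w i)) \<in> decomps H" if "i < m" for i
    using uw(2) that Hplus_lookup[of "pm (u i)"] Hplus_lookup[of "pm (w i)"] fs[OF that] by (intro mul_mem_decomps) auto
  ultimately show "p \<in> decomps H" by (auto simp: decomps_def intro!: pv.span_sum)
next
  assume "p \<in> decomps H"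
  then obtain t r where t: "finite t" "t \<subseteq> {mul H (bs a) (bs b) |a b. 0 < dg a \<and> 0 < dg b}" "p = (\<Sum>x\<in>t. psc (r x) x)"
    unfolding decomps_def pv.span_explicit by blast
  obtain h where h: "bij_betw h {0..<card t} t" using ex_bij_betw_nat_finite[OF t(1)] by blast
  have "\<forall>i<card t. \<exists>a b. h i = mul H (bs a) (bs b) \<and> 0 < dg a \<and> 0 < dg b"
  proof (intro allI impI)
    fix i assume "i < card t"
    then have "h i \<in> t" using h by (auto simp: bij_betw_def)
    then show "\<exists>a b. h i = mul H (bs a) (bs b) \<and> 0 < dg a \<and> 0 < dg b" using t(2) by blast
  qed
  then obtain a b where ab: "\<And>i. i < card t \<Longrightarrow> h i = mul H (bs (a i)) (bs (b i))"
    "\<And>i. i < card t \<Longrightarrow> 0 < dg (a i)" "\<And>i. i < card t \<Longrightarrow> 0 < dg (b i)" by metis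
  have "p = (\<Sum>i\<in>{0..<card t}. psc (r (h i)) (h i))"
    unfolding t(3) by (rule sum.reindex_bij_betw[OF h, symmetric])
  also have "\<dots> = (\<Sum>i<card t. mul H (psc (r (h i)) (bs (a i))) (bs (b i)))"
    by (rule sum.cong) (auto simp: ab(1) pp.linear_scale[OF plin_mul_left])
  finally have "lookup p = (\<Sum>i<card t. hmul H (lookup (psc (r (h i)) (bs (a i)))) (lookup (bs (b i))))"
    by (simp add: hmul_lookup sum_lookup)
  moreover have "\<forall>i<card t. lookup (psc (r (h i)) (bs (a i))) \<in> Hplus H \<and> lookup (bs (b i)) \<in> Hplus H"
    unfolding Hplus_lookup using ab(2,3) by (auto simp: in_keys_iff lookup_single when_def split: if_splits)
  ultimately show "lookup p \<in> Hplus2 H"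
    unfolding Hplus2_def mem_Collect_eq by (intro exI conjI)
qed

text \<open>\<open>H\<^sup>+\<^sup>2\<close> is a graded subspace, since its generators are
  homogeneous.\<close>

lemma hpart_decomps:
  assumes "p \<in> decomps H" shows "hpart dg n p \<in> decomps_in H n"
proof -
  let ?S = "{mul H (bs a) (bs b) |a b. 0 < dg a \<and> 0 < dg b}"
  have "hpart dg n ` ?S \<subseteq> decomps_in H n"
  proof safe
    fix a b assume ab: "0 < dg a" "0 < dg b"
    have m: "mul H (bs a) (bs b) \<in> hm dg (dg a + dg b)" by (rule mul_hm) auto
    show "hpart dg n (mul H (bs a) (bs b)) \<in> decomps_in H n"
      using mul_mem_decomps_in[of "bs a" "dg a" "bs b" "dg b" n] ab
      by (simp add: hpart_of_hm[OF m]) (simp add: decomps_in_def pv.span_zero)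
  qed
  then have "pv.span (hpart dg n ` ?S) \<subseteq> decomps_in H n"
    by (rule pv.span_minimal) (simp add: decomps_in_def)
  then show ?thesis using assms unfolding pp.linear_span_image[OF plin_hpart] decomps_def by blast
qed

lemma decomps_in_iff:
  assumes "p \<in> hm dg n" shows "p \<in> decomps_in H n \<longleftrightarrow> p \<in> decomps H"
proof
  have "decomps_in H n \<subseteq> decomps H" unfolding decomps_in_def decomps_def by (rule pv.span_mono) auto
  then show "p \<in> decomps_in H n \<Longrightarrow> p \<in> decomps H" by blast
  show "p \<in> decomps H \<Longrightarrow> p \<in> decomps_in H n" using hpart_decomps[of p n] hpart_of_hm[OF assms] by simp
qed

lemma Prim_lookup: "lookup p \<in> Prim H \<longleftrightarrow> p \<in> prims H"
  by (simp add: Prim_def prims_def hDelta_lookup one_lookup tens_lookup add_lookup lookup_inj)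

lemma Prim_eq_lookup: "x \<in> Prim H \<Longrightarrow> \<exists>p. x = lookup p \<and> p \<in> prims H"
  by (rule exI[of _ "pm x"]) (use Prim_lookup[of "pm x"] lookup_pm[of x] in \<open>auto simp: Prim_def\<close>)

lemma prims_in_iff: "0 < n \<Longrightarrow> p \<in> prims_in H n \<longleftrightarrow> p \<in> hm dg n \<and> p \<in> prims H"
  by (auto simp: prims_in_def prims_def Dl_split)

text \<open>Primitives form a graded subspace: the coproduct and tensoring with the unit both
  preserve degrees.\<close>

lemma hpart_prims:
  assumes "p \<in> prims H" shows "hpart dg n p \<in> prims H"
proof -
  have t: "hpart hd2 n (tns p (unt H)) = tns (hpart dg n p) (unt H)" "hpart hd2 n (tns (unt H) p)
      = tns (unt H) (hpart dg n p)"
    by (rule hpart_commute; use tns_hm[OF _ unt_hm] tns_hm[OF unt_hm] in force)+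
  have "Dl H (hpart dg n p) = hpart hd2 n (Dl H p)"
    by (rule hpart_commute[symmetric]) (auto intro: Dl_bs_hm)
  then show ?thesis using assms by (simp add: prims_def pp.linear_add[OF plin_hpart] t)
qed

lemma subspace_prims: "pv.subspace (prims H)"
  unfolding prims_def
  by (rule pv.subspaceI) (auto simp: pp.linear_0[OF plin_Dl] pp.linear_add[OF plin_Dl] pp.linear_scale[OF plin_Dl]
      pp.linear_0[OF plin_tns_left] pp.linear_0[OF plin_tns_right] pp.linear_add[OF plin_tns_left] pp.linear_add[OF
          plin_tns_right]
      pp.linear_scale[OF plin_tns_left] pp.linear_scale[OF plin_tns_right] pv.scale_right_distrib algebra_simps)

end

lemma bialg_iso_decomps:
  assumes "gcb H" "gcb H'" and iso: "bialg_iso H H' \<Phi> \<Psi>" and p: "p \<in> decomps H"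
  shows "\<Phi> p \<in> decomps H'"
proof -
  interpret H: gcb H by fact
  interpret H': gcb H' by fact
  note P = bialg_isoD[OF iso]
  let ?S = "{mul H (bs a) (bs b) |a b. 0 < H.dg a \<and> 0 < H.dg b}"
  have "\<Phi> ` ?S \<subseteq> decomps H'"
    using hmD[OF P(6)] by (auto simp: P(7) intro!: H'.mul_mem_decomps)
  then have "pv.span (\<Phi> ` ?S) \<subseteq> decomps H'"
    by (rule pv.span_minimal) (simp add: decomps_def)
  then show ?thesis using p unfolding pp.linear_span_image[OF P(1)] decomps_def by blast
qed

lemma prim_quot_isomorphic_of_bialg_iso:
  fixes H :: "('b, 'k::field) hopf_data" and H' :: "('c, 'k) hopf_data"
  assumes gc: "gcb H" "gcb H'" and iso: "bialg_iso H H' \<Phi> \<Psi>"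
  shows "prim_quot_isomorphic H H'"
proof -
  interpret H: gcb H by fact
  interpret H': gcb H' by fact
  note P = bialg_isoD[OF iso] and P' = bialg_isoD[OF bialg_iso_sym[OF iso]]
  have prim: "\<Phi> p \<in> prims H'" if "p \<in> prims H" for p
    using that by (simp add: prims_def P(8) pp.linear_add[OF plin_tm] P(1) P(5))
  have prim': "\<Psi> p \<in> prims H" if "p \<in> prims H'" for p
    using that by (simp add: prims_def P'(8) pp.linear_add[OF plin_tm] P'(1) P'(5))
  note ex = H.Prim_eq_lookup and ex' = H'.Prim_eq_lookup
  have decomps: "\<Phi> p \<in> decomps H' \<longleftrightarrow> p \<in> decomps H" for p
    using bialg_iso_decomps[OF gc iso, of p] bialg_iso_decomps[OF gc(2,1) bialg_iso_sym[OF iso], of "\<Phi> p"]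
        by (auto simp: P(3))
  show ?thesis
    unfolding prim_quot_isomorphic_def
  proof (intro exI[of _ "\<lambda>x. lookup (\<Phi> (pm x))"] conjI ballI allI)
    fix x assume "x \<in> Prim H"
    then obtain p where p: "x = lookup p" "p \<in> prims H" using ex by blast
    show "lookup (\<Phi> (pm x)) \<in> Prim H'" using p prim by (simp add: H'.Prim_lookup)
    show "lookup (\<Phi> (pm (scaleF c x))) = scaleF c (lookup (\<Phi> (pm x)))" for c
      by (simp add: p scaleF_lookup pp.linear_scale[OF P(1)])
    show "lookup (\<Phi> (pm x)) \<in> Hplus2 H' \<longleftrightarrow> x \<in> Hplus2 H"
      by (simp add: p H.Hplus2_lookup H'.Hplus2_lookup decomps)
    fix y assume "y \<in> Prim H"
    then obtain q where "y = lookup q" using ex by blast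
    then show "lookup (\<Phi> (pm (x + y))) = lookup (\<Phi> (pm x)) + lookup (\<Phi> (pm y))"
      by (simp add: p add_lookup pp.linear_add[OF P(1)])
  next
    fix n x assume x: "x \<in> Prim H \<inter> hom H n"
    then obtain p where p: "x = lookup p" using ex by blast
    then show "lookup (\<Phi> (pm x)) \<in> hom H' n" using x P(9) by (simp add: hom_lookup)
  next
    fix y assume "y \<in> Prim H'"
    then obtain q where q: "y = lookup q" "q \<in> prims H'" using ex' by blast
    have "y - lookup (\<Phi> (pm (lookup (\<Psi> q)))) = lookup 0" by (simp add: q P zero_lookup)
    also have "\<dots> \<in> Hplus2 H'" unfolding H'.Hplus2_lookup decomps_def by (rule pv.span_zero)
    finally show "\<exists>x\<in>Prim H. y - lookup (\<Phi> (pm x)) \<in> Hplus2 H'"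
      using prim'[OF q(2)] H.Prim_lookup by blast
  qed
qed

text \<open>The delicate point is surjectivity: the global condition may return an inhomogeneous
  primitive, and its degree n component must be shown to do the same job.\<close>

lemma quotient_iso_of_prim_quot_isomorphic:
  fixes H :: "('b, 'k::field) hopf_data" and H' :: "('c, 'k) hopf_data"
  assumes gc: "gcb H" "gcb H'" and iso: "prim_quot_isomorphic H H'" and n: "0 < n"
  shows "\<exists>\<theta>. quotient_iso H H' n \<theta>"
proof -
  interpret H: gcb H by fact
  interpret H': gcb H' by fact
  obtain f where f: "\<forall>x\<in>Prim H. f x \<in> Prim H'" "\<forall>x\<in>Prim H. \<forall>y\<in>Prim H. f (x + y) = f x + f y"
    "\<forall>c. \<forall>x\<in>Prim H. f (scaleF c x) = scaleF c (f x)" "\<forall>n. \<forall>x\<in>Prim H \<inter> hom H n. f x \<in> hom H' n"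
    "\<forall>x\<in>Prim H. f x \<in> Hplus2 H' \<longleftrightarrow> x \<in> Hplus2 H" "\<forall>y\<in>Prim H'. \<exists>x\<in>Prim H. y - f x \<in> Hplus2 H'"
    using iso unfolding prim_quot_isomorphic_def by blast
  define \<theta> where "\<theta> p = pm (f (lookup p))" for p
  have L: "lookup (\<theta> p) = f (lookup p)" if "p \<in> prims H" for p
  proof -
    have "f (lookup p) \<in> Prim H'" using f(1) that H.Prim_lookup by blast
    then show ?thesis unfolding \<theta>_def by (intro lookup_pm) (simp add: Prim_def)
  qed
  have th_prim: "\<theta> p \<in> prims H'" if "p \<in> prims H" for p
    using f(1) that H.Prim_lookup[of p] H'.Prim_lookup[of "\<theta> p"] L[OF that] by auto
  have th_add: "\<theta> (p + q) = \<theta> p + \<theta> q" if "p \<in> prims H" "q \<in> prims H" for p q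
  proof -
    have "lookup (\<theta> (p + q)) = lookup (\<theta> p + \<theta> q)"
      using f(2) that H.Prim_lookup pv.subspace_add[OF H.subspace_prims that]
      by (simp add: L add_lookup[symmetric])
    then show ?thesis by (simp only: lookup_inj)
  qed
  have th_scale: "\<theta> (psc c p) = psc c (\<theta> p)" if "p \<in> prims H" for c p
  proof -
    have "lookup (\<theta> (psc c p)) = lookup (psc c (\<theta> p))"
      using f(3) that H.Prim_lookup pv.subspace_scale[OF H.subspace_prims that, of c]
      by (simp add: L scaleF_lookup[symmetric])
    then show ?thesis by (simp only: lookup_inj)
  qed
  have th_hm: "\<theta> p \<in> hm H'.dg k" if "p \<in> prims H" "p \<in> hm H.dg k" for p k
    using f(4) that H.Prim_lookup[of p] hom_lookup[of p H k] hom_lookup[of "\<theta> p" H' k] L[OF that(1)] by auto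
  have th_P2: "\<theta> p \<in> decomps H' \<longleftrightarrow> p \<in> decomps H" if "p \<in> prims H" for p
    using f(5) that H.Prim_lookup[of p] H.Hplus2_lookup[of p] H'.Hplus2_lookup[of "\<theta> p"] L[OF that] by auto
  have th_0: "\<theta> 0 = 0"
    using th_scale[of 0 0] pv.subspace_0[OF H.subspace_prims] by simp
  \<comment> \<open>\<open>\<theta>\<close> is linear on primitives only, so \<open>p\<close> is
    decomposed into homogeneous components, each again primitive, instead of into basis
    vectors.\<close>
  have th_hpart: "hpart H'.dg n (\<theta> p) = \<theta> (hpart H.dg n p)" if p: "p \<in> prims H" for p
  proof -
    obtain N where N: "\<forall>b\<in>keys p. H.dg b \<le> N"
      using finite_nat_set_iff_bounded_le[of "H.dg ` keys p"] by auto
    have sum: "\<theta> (\<Sum>k\<in>K. hpart H.dg k p) = (\<Sum>k\<in>K. \<theta> (hpart H.dg k p))" if "finite K" for K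
      using that
    proof (induction K)
      case (insert k K)
      have "(\<Sum>k\<in>K. hpart H.dg k p) \<in> prims H"
        by (intro pv.subspace_sum[OF H.subspace_prims] H.hpart_prims p)
      then show ?case using insert by (simp add: th_add H.hpart_prims[OF p])
    qed (simp add: th_0)
    have "\<theta> p = (\<Sum>k\<le>N + n. \<theta> (hpart H.dg k p))"
      using sum[of "{..N + n}"] sum_hpart[of p H.dg "N + n"] N by (simp add: trans_le_add1)
    then have "hpart H'.dg n (\<theta> p) = (\<Sum>k\<le>N + n. hpart H'.dg n (\<theta> (hpart H.dg k p)))"
      by (simp add: pp.linear_sum[OF plin_hpart])
    also have "\<dots> = (\<Sum>k\<le>N + n. if k = n then \<theta> (hpart H.dg k p) else 0)"
      by (rule sum.cong) (simp_all add: hpart_of_hm[OF th_hm[OF H.hpart_prims[OF p] hpart_hm]])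
    also have "\<dots> = \<theta> (hpart H.dg n p)" by simp
    finally show ?thesis .
  qed
  note gi = H.prims_in_iff[OF n] H'.prims_in_iff[OF n]
  have "quotient_iso H H' n \<theta>"
    unfolding quotient_iso_def
  proof (intro conjI ballI allI)
    fix x assume "x \<in> prims_in H n"
    then have x: "x \<in> hm H.dg n" "x \<in> prims H" by (simp_all add: gi)
    show "\<theta> x \<in> prims_in H' n" using x th_prim th_hm by (simp add: gi)
    show "\<theta> (psc c x) = psc c (\<theta> x)" for c by (rule th_scale[OF x(2)])
    show "\<theta> x \<in> decomps_in H' n \<longleftrightarrow> x \<in> decomps_in H n"
      using H.decomps_in_iff[OF x(1)] H'.decomps_in_iff[OF th_hm[OF x(2,1)]] th_P2[OF x(2)] by simp
    fix y assume "y \<in> prims_in H n"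
    then show "\<theta> (x + y) = \<theta> x + \<theta> y" using th_add[OF x(2)] by (simp add: gi)
  next
    fix y assume "y \<in> prims_in H' n"
    then have y: "y \<in> hm H'.dg n" "y \<in> prims H'" by (simp_all add: gi)
    then obtain x where x: "x \<in> Prim H" "lookup y - f x \<in> Hplus2 H'" using f(6) H'.Prim_lookup by blast
    have "lookup (pm x) = x" using x(1) by (intro lookup_pm) (simp add: Prim_def)
    then have p: "pm x \<in> prims H" "lookup (pm x) = x" using x(1) H.Prim_lookup[of "pm x"] by auto
    have "y - \<theta> (pm x) \<in> decomps H'"
      using x(2) unfolding H'.Hplus2_lookup[symmetric] minus_lookup[symmetric] L[OF p(1)] p(2) .
    \<comment> \<open>Taking degree n components keeps \<open>y\<close>, preserves decomposability,
      and replaces \<open>pm x\<close> by its homogeneous part.\<close>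
    then have "hpart H'.dg n (y - \<theta> (pm x)) \<in> decomps_in H' n" by (rule H'.hpart_decomps)
    then have "y - \<theta> (hpart H.dg n (pm x)) \<in> decomps_in H' n"
      by (simp add: pp.linear_diff[OF plin_hpart] hpart_of_hm[OF y(1)] th_hpart[OF p(1)])
    moreover have "hpart H.dg n (pm x) \<in> prims_in H n" using H.hpart_prims[OF p(1)] by (simp add: gi)
    ultimately show "\<exists>x\<in>prims_in H n. y - \<theta> x \<in> decomps_in H' n" by blast
  qed
  then show ?thesis by blast
qed

text \<open>The isomorphism is the hub: it implies each of the other two conditions, and each of
  them implies it. The second equivalence passes through the first condition.\<close>

theorem theorem8:
  fixes H :: "('b, 'k::field) hopf_data" and H' :: "('c, 'k) hopf_data"
  assumes char: "(2::'k) \<noteq> 0"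
    and hopf: "graded_connected_hopf H" "graded_connected_hopf H'"
    and free: "free_hopf H" "free_hopf H'"
    and cofree: "cofree_hopf H" "cofree_hopf H'"
  shows "(hopf_isomorphic H H' \<longleftrightarrow> prim_quot_isomorphic H H') \<and>
         (prim_quot_isomorphic H H' \<longleftrightarrow> poincare_series H = poincare_series H')"
proof -
  have gc: "gcb H" "gcb H'" using hopf by (simp_all add: gcb_def)
  interpret H: gcb H by (rule gc)
  interpret H': gcb H' by (rule gc)
  have series: "poincare_series H = poincare_series H' \<longleftrightarrow> (\<forall>n. dimH H n = dimH H' n)"
    by (simp add: poincare_series_def fps_eq_iff)
  have iso: "\<exists>\<Phi> \<Psi>. bialg_iso H H' \<Phi> \<Psi>" if "hopf_isomorphic H H'"
    using that bialg_iso_of_hopf_iso[OF gc] by (auto simp: hopf_isomorphic_def)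
  have from_quot: "hopf_isomorphic H H'" if "prim_quot_isomorphic H H'"
    using ex_bialg_iso[OF gc free cofree quotient_iso_of_prim_quot_isomorphic[OF gc that]]
        hopf_isomorphic_of_bialg_iso[OF gc] by blast
  \<comment> \<open>Equal dimensions yield a quotient isomorphism in degree n only relative to an
    isomorphism of the lower degrees, so it is produced during the induction and not
    beforehand.\<close>
  have from_dim: "hopf_isomorphic H H'" if eq: "\<forall>n. dimH H n = dimH H' n"
  proof -
    have "\<exists>\<theta>. quotient_iso H H' n \<theta>" if "0 < n" "truncated_iso H H' n \<phi> \<psi>" for n \<phi> \<psi>
    proof -
      interpret extension_step H H' n \<phi> \<psi> by unfold_locales (use that free cofree in auto)
      show ?thesis by (rule quotient_iso_of_dim) (use eq in simp)
    qed
    then show ?thesis using ex_bialg_iso[OF gc free cofree] hopf_isomorphic_of_bialg_iso[OF gc] by blast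
  qed
  have "hopf_isomorphic H H' \<Longrightarrow> prim_quot_isomorphic H H'"
    using iso prim_quot_isomorphic_of_bialg_iso[OF gc] by blast
  moreover have "hopf_isomorphic H H' \<Longrightarrow> \<forall>n. dimH H n = dimH H' n"
    using iso bialg_iso_dimH[OF gc] by blast
  ultimately show ?thesis using from_quot from_dim series by blast
qed

end
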